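(* Let $H$ be a finite-dimensional Hopf algebra and let $(X,\alpha,\beta)$ be a left-left $(H,\widehat H)$-Yetter--Drinfeld algebra. Then $(X,\alpha,\beta)$ is braided commutative (in the sense of the Heisenberg-algebra condition given in the context) if and only if the (right-left) Yetter--Drinfeld algebra $(X,\lhd_\beta,\alpha)$ over $H$ is braided commutative, i.e. $xy=(y\lhd_\beta x_{[-1]})\,x_{[0]}$ for all $x,y\in X$, where $\alpha(x)=x_{[-1]}^{\mathrm{op}}\otimes x_{[0]}$ and $x\lhd_\beta h=(\mathbf p(h,\cdot)\otimes\mathrm{id}_X)(\beta(x))$.
   Context: $\Bbbk$ is a field, algebras are unital $\Bbbk$-algebras; $X^{\mathrm{op}}$ is the opposite algebra with elements $x^{\mathrm{op}}$, and ${}^{\mathrm{op}}:X\to X^{\mathrm{op}}$ is $x\mapsto x^{\mathrm{op}}$. $H$ has structure maps $\Delta,\varepsilon,S$ ($S$ bijective), with Sweedler notation; $\widehat H$ is the dual Hopf algebra with antipode $\widehat S$ and $\mathbf p(h,\theta)=\theta(h)$, with $\mathbf p(h,\theta\theta')=\mathbf p(h_{(1)},\theta)\mathbf p(h_{(2)},\theta')$, $\mathbf p(hh',\theta)=\mathbf p(h,\theta_{(1)})\mathbf p(h',\theta_{(2)})$. $H^{\mathrm{op}}$ is the Hopf algebra with opposite product (elements $h^{\mathrm{op}}$) and the same coproduct. $U=\sum_ih_i\otimes\widehat h_i\in H\otimes\widehat H$ (dual bases), ${}^{\circ}U=\sum_ih_i^{\mathrm{op}}\otimes\widehat h_i\in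 H^{\mathrm{op}}\otimes\widehat H$ (invertible). $\mathrm{Ad}(W)(z)=WzW^{-1}$; $\Sigma$ is the flip. A left coaction of a Hopf algebra $K$ on an algebra $X$ is an algebra homomorphism $\alpha:X\to K\otimes X$ with $(\mathrm{id}\otimes\alpha)\alpha=(\Delta_K\otimes\mathrm{id})\alpha$, $(\varepsilon_K\otimes\mathrm{id})\alpha=\mathrm{id}$. A left-left $(H,\widehat H)$-Yetter--Drinfeld algebra is a triple $(X,\alpha,\beta)$ with left coactions $\alpha:X\to H^{\mathrm{op}}\otimes X$ of $H^{\mathrm{op}}$ and $\beta:X\to\widehat H\otimes X$ of $\widehat H$ such that $(\mathrm{id}_{\widehat H}\otimes\alpha)\beta=(\Sigma\otimes\mathrm{id}_X)(\mathrm{Ad}({}^{\circ}U)\otimes\mathrm{id}_X)(\mathrm{id}_{H^{\mathrm{op}}}\otimes\beta)\alpha$. In that case $(X,\lhd_\beta,\alpha)$ is a (right-left) Yetter--Drinfeld algebra over $H$. The Heisenberg algebra $\mathcal H(H)=H\#\widehat H$ is $H\otimes\widehat H$ with product $(h\#\theta)(h'\#\theta')=h\,h'_{(1)}\,\mathbf p(h'_{(2)},\theta_{(1)})\#\theta_{(2)}\theta'$. $\mathcal H(H)\otimes X^{\mathrm{op}}$ is the tensor product algebra with multiplication map $\mathfrak m_{\mathcal H(H)\otimes X^{\mathrm{op}}}$. Put $\iota_{1,X^{\mathrm{op}}}(h\otimes x^{\mathrm{op}})=h\#1\otimes x^{\mathrm{op}}$, $\iota_{2,X^{\mathrm{op}}}(\theta\otimes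 x^{\mathrm{op}})=1\#\theta\otimes x^{\mathrm{op}}$, and let $\dot\alpha:X\to H\otimes X$ be the linear map $x\mapsto x_{[-1]}\otimes x_{[0]}$. $(X,\alpha,\beta)$ is called braided commutative if for all $x,y\in X$ $$\mathfrak m_{\mathcal H(H)\otimes X^{\mathrm{op}}}(\iota_{1,X^{\mathrm{op}}}\otimes\iota_{2,X^{\mathrm{op}}})\big((\mathrm{id}\otimes{}^{\mathrm{op}})\dot\alpha(x)\otimes(\widehat S\otimes{}^{\mathrm{op}})\beta(y)\big)=\mathfrak m_{\mathcal H(H)\otimes X^{\mathrm{op}}}(\iota_{2,X^{\mathrm{op}}}\otimes\iota_{1,X^{\mathrm{op}}})\big((\widehat S\otimes{}^{\mathrm{op}})\beta(y)\otimes(\mathrm{id}\otimes{}^{\mathrm{op}})\dot\alpha(x)\big).$$ *)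

theory Defs
  imports "HOL-Algebra.AbelCoset" "Jordan_Normal_Form.Missing_VectorSpace"
begin

section \<open>Tensor products of vector spaces and algebras\<close>

text \<open>
  The ground field is a record \<open>K\<close> with \<open>field K\<close>; vector spaces and algebras over \<open>K\<close> are
  records of type \<open>module\<close>, which carry both a ring structure and a scalar multiplication.
  The tensor product \<open>M \<otimes> N\<close> is the free vector space on \<open>carrier M \<times> carrier N\<close> modulo the
  subspace spanned by the bilinearity relations, so that its elements are cosets.
\<close>

definition free_space :: "('k, 'r) ring_scheme \<Rightarrow> 's set \<Rightarrow> ('k, 's \<Rightarrow> 'k) module" where
  "free_space K S = (ring.func_space K S)
     \<lparr>carrier := {f \<in> S \<rightarrow>\<^sub>E carrier K. finite {s \<in> S. f s \<noteq> \<zero>\<^bsub>K\<^esub>}}\<rparr>"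

definition free_gen :: "('k, 'r) ring_scheme \<Rightarrow> 's set \<Rightarrow> 's \<Rightarrow> 's \<Rightarrow> 'k" where
  "free_gen K S s = (\<lambda>t \<in> S. if t = s then \<one>\<^bsub>K\<^esub> else \<zero>\<^bsub>K\<^esub>)"

definition tensor_relations ::
  "('k, 'r) ring_scheme \<Rightarrow> ('k, 'a, 'm) module_scheme \<Rightarrow> ('k, 'b, 'n) module_scheme
    \<Rightarrow> ('a \<times> 'b \<Rightarrow> 'k) set" where
  "tensor_relations K M N =
    (let F = free_space K (carrier M \<times> carrier N);
         d = (\<lambda>m n. free_gen K (carrier M \<times> carrier N) (m, n))
     in {d (m \<oplus>\<^bsub>M\<^esub> m') n \<ominus>\<^bsub>F\<^esub> (d m n \<oplus>\<^bsub>F\<^esub> d m' n) | m m' n.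
           m \<in> carrier M \<and> m' \<in> carrier M \<and> n \<in> carrier N}
      \<union> {d m (n \<oplus>\<^bsub>N\<^esub> n') \<ominus>\<^bsub>F\<^esub> (d m n \<oplus>\<^bsub>F\<^esub> d m n') | m n n'.
           m \<in> carrier M \<and> n \<in> carrier N \<and> n' \<in> carrier N}
      \<union> {d (c \<odot>\<^bsub>M\<^esub> m) n \<ominus>\<^bsub>F\<^esub> (c \<odot>\<^bsub>F\<^esub> d m n) | c m n.
           c \<in> carrier K \<and> m \<in> carrier M \<and> n \<in> carrier N}
      \<union> {d m (c \<odot>\<^bsub>N\<^esub> n) \<ominus>\<^bsub>F\<^esub> (c \<odot>\<^bsub>F\<^esub> d m n) | c m n.
           c \<in> carrier K \<and> m \<in> carrier M \<and> n \<in> carrier N})"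

definition tensor_null ::
  "('k, 'r) ring_scheme \<Rightarrow> ('k, 'a, 'm) module_scheme \<Rightarrow> ('k, 'b, 'n) module_scheme
    \<Rightarrow> ('a \<times> 'b \<Rightarrow> 'k) set" where
  "tensor_null K M N =
     module.span K (free_space K (carrier M \<times> carrier N)) (tensor_relations K M N)"

text \<open>The product and the unit of \<open>tensor_space\<close> are dummies; they are supplied for
  algebras in \<open>tensor\<close> and, differently, in \<open>heisenberg\<close> below.\<close>

definition tensor_space ::
  "('k, 'r) ring_scheme \<Rightarrow> ('k, 'a, 'm) module_scheme \<Rightarrow> ('k, 'b, 'n) module_scheme
    \<Rightarrow> ('k, ('a \<times> 'b \<Rightarrow> 'k) set) module" where
  "tensor_space K M N =
    (let F = free_space K (carrier M \<times> carrier N); Z = tensor_null K M N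
     in \<lparr>carrier = a_rcosets\<^bsub>F\<^esub> Z,
         mult = (\<lambda>_ _. Z),
         one = Z,
         zero = Z,
         add = set_add F,
         smult = (\<lambda>c t. \<Union>f\<in>t. Z +>\<^bsub>F\<^esub> (c \<odot>\<^bsub>F\<^esub> f))\<rparr>)"

definition tens ::
  "('k, 'r) ring_scheme \<Rightarrow> ('k, 'a, 'm) module_scheme \<Rightarrow> ('k, 'b, 'n) module_scheme
    \<Rightarrow> 'a \<Rightarrow> 'b \<Rightarrow> ('a \<times> 'b \<Rightarrow> 'k) set" where
  "tens K M N m n =
     tensor_null K M N +>\<^bsub>free_space K (carrier M \<times> carrier N)\<^esub>
       free_gen K (carrier M \<times> carrier N) (m, n)"

text \<open>The linear map \<open>M \<otimes> N \<rightarrow> W\<close> induced by a bilinear map \<open>f\<close>; only used for bilinear \<open>f\<close>.\<close>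

definition tlift ::
  "('k, 'r) ring_scheme \<Rightarrow> ('k, 'a, 'm) module_scheme \<Rightarrow> ('k, 'b, 'n) module_scheme
    \<Rightarrow> ('k, 'w, 'l) module_scheme \<Rightarrow> ('a \<Rightarrow> 'b \<Rightarrow> 'w) \<Rightarrow> ('a \<times> 'b \<Rightarrow> 'k) set \<Rightarrow> 'w" where
  "tlift K M N W f =
    (THE F. F \<in> module_hom K (tensor_space K M N) W
          \<and> F \<in> extensional (carrier (tensor_space K M N))
          \<and> (\<forall>m \<in> carrier M. \<forall>n \<in> carrier N. F (tens K M N m n) = f m n))"

definition tensor ::
  "('k, 'r) ring_scheme \<Rightarrow> ('k, 'a, 'm) module_scheme \<Rightarrow> ('k, 'b, 'n) module_scheme
    \<Rightarrow> ('k, ('a \<times> 'b \<Rightarrow> 'k) set) module" where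
  "tensor K A B = (tensor_space K A B)
     \<lparr>mult := (\<lambda>s t. tlift K A B (tensor_space K A B)
        (\<lambda>a b. tlift K A B (tensor_space K A B)
           (\<lambda>a' b'. tens K A B (a \<otimes>\<^bsub>A\<^esub> a') (b \<otimes>\<^bsub>B\<^esub> b')) t) s),
      one := tens K A B \<one>\<^bsub>A\<^esub> \<one>\<^bsub>B\<^esub>\<rparr>"

definition tmap ::
  "('k, 'r) ring_scheme \<Rightarrow> ('k, 'a, 'm) module_scheme \<Rightarrow> ('k, 'b, 'n) module_scheme
    \<Rightarrow> ('k, 'c, 'p) module_scheme \<Rightarrow> ('k, 'd, 'q) module_scheme
    \<Rightarrow> ('a \<Rightarrow> 'c) \<Rightarrow> ('b \<Rightarrow> 'd) \<Rightarrow> ('a \<times> 'b \<Rightarrow> 'k) set \<Rightarrow> ('c \<times> 'd \<Rightarrow> 'k) set" where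
  "tmap K M N M' N' f g = tlift K M N (tensor K M' N') (\<lambda>m n. tens K M' N' (f m) (g n))"

definition tflip ::
  "('k, 'r) ring_scheme \<Rightarrow> ('k, 'a, 'm) module_scheme \<Rightarrow> ('k, 'b, 'n) module_scheme
    \<Rightarrow> ('a \<times> 'b \<Rightarrow> 'k) set \<Rightarrow> ('b \<times> 'a \<Rightarrow> 'k) set" where
  "tflip K M N = tlift K M N (tensor K N M) (\<lambda>m n. tens K N M n m)"

text \<open>The canonical identifications \<open>(L \<otimes> M) \<otimes> N \<rightarrow> L \<otimes> (M \<otimes> N)\<close> and back.\<close>

definition tassoc ::
  "('k, 'r) ring_scheme \<Rightarrow> ('k, 'a, 'm) module_scheme \<Rightarrow> ('k, 'b, 'n) module_scheme
    \<Rightarrow> ('k, 'c, 'p) module_scheme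
    \<Rightarrow> (('a \<times> 'b \<Rightarrow> 'k) set \<times> 'c \<Rightarrow> 'k) set \<Rightarrow> ('a \<times> ('b \<times> 'c \<Rightarrow> 'k) set \<Rightarrow> 'k) set" where
  "tassoc K L M N = tlift K (tensor K L M) N (tensor K L (tensor K M N))
     (\<lambda>s n. tlift K L M (tensor K L (tensor K M N))
        (\<lambda>l m. tens K L (tensor K M N) l (tens K M N m n)) s)"

definition tassoc_inv ::
  "('k, 'r) ring_scheme \<Rightarrow> ('k, 'a, 'm) module_scheme \<Rightarrow> ('k, 'b, 'n) module_scheme
    \<Rightarrow> ('k, 'c, 'p) module_scheme
    \<Rightarrow> ('a \<times> ('b \<times> 'c \<Rightarrow> 'k) set \<Rightarrow> 'k) set \<Rightarrow> (('a \<times> 'b \<Rightarrow> 'k) set \<times> 'c \<Rightarrow> 'k) set" where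
  "tassoc_inv K L M N = tlift K L (tensor K M N) (tensor K (tensor K L M) N)
     (\<lambda>l s. tlift K M N (tensor K (tensor K L M) N)
        (\<lambda>m n. tens K (tensor K L M) N (tens K L M l m) n) s)"

section \<open>Algebras and Hopf algebras\<close>

text \<open>The algebras of \<^theory>\<open>HOL-Algebra.Module\<close> are commutative, hence the following locale.\<close>

locale k_algebra = vectorspace K A + A?: ring A
  for K :: "('k, 'r) ring_scheme" (structure) and A :: "('k, 'a, 'm) module_scheme" +
  assumes smult_mult_left: "\<lbrakk>c \<in> carrier K; x \<in> carrier A; y \<in> carrier A\<rbrakk>
      \<Longrightarrow> (c \<odot>\<^bsub>A\<^esub> x) \<otimes>\<^bsub>A\<^esub> y = c \<odot>\<^bsub>A\<^esub> (x \<otimes>\<^bsub>A\<^esub> y)"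
    and smult_mult_right: "\<lbrakk>c \<in> carrier K; x \<in> carrier A; y \<in> carrier A\<rbrakk>
      \<Longrightarrow> x \<otimes>\<^bsub>A\<^esub> (c \<odot>\<^bsub>A\<^esub> y) = c \<odot>\<^bsub>A\<^esub> (x \<otimes>\<^bsub>A\<^esub> y)"

definition alg_hom ::
  "('k, 'r) ring_scheme \<Rightarrow> ('k, 'a, 'm) module_scheme \<Rightarrow> ('k, 'b, 'n) module_scheme
    \<Rightarrow> ('a \<Rightarrow> 'b) set" where
  "alg_hom K A B = ring_hom A B \<inter> module_hom K A B"

definition self_module :: "('k, 'r) ring_scheme \<Rightarrow> ('k, 'k) module" where
  "self_module K = \<lparr>carrier = carrier K, mult = mult K, one = one K, zero = zero K,
     add = add K, smult = mult K\<rparr>"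

definition mult_map ::
  "('k, 'r) ring_scheme \<Rightarrow> ('k, 'a, 'm) module_scheme \<Rightarrow> ('a \<times> 'a \<Rightarrow> 'k) set \<Rightarrow> 'a" where
  "mult_map K A = tlift K A A A (mult A)"

record ('k, 'a) hopf = "('k, 'a) module" +
  comult :: "'a \<Rightarrow> ('a \<times> 'a \<Rightarrow> 'k) set"
  counit :: "'a \<Rightarrow> 'k"
  antipode :: "'a \<Rightarrow> 'a"

locale hopf_algebra = k_algebra K H
  for K :: "('k, 'r) ring_scheme" (structure) and H :: "('k, 'a) hopf" +
  assumes comult_hom: "comult H \<in> alg_hom K H (tensor K H H)"
    and counit_hom: "counit H \<in> alg_hom K H (self_module K)"
    and antipode_linear: "antipode H \<in> module_hom K H H"
    and antipode_bij: "bij_betw (antipode H) (carrier H) (carrier H)"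
    and coassoc: "h \<in> carrier H \<Longrightarrow>
      tassoc K H H H (tmap K H H (tensor K H H) H (comult H) id (comult H h))
        = tmap K H H H (tensor K H H) id (comult H) (comult H h)"
    and counit_left: "h \<in> carrier H \<Longrightarrow>
      tlift K H H H (\<lambda>a b. counit H a \<odot>\<^bsub>H\<^esub> b) (comult H h) = h"
    and counit_right: "h \<in> carrier H \<Longrightarrow>
      tlift K H H H (\<lambda>a b. counit H b \<odot>\<^bsub>H\<^esub> a) (comult H h) = h"
    and antipode_left: "h \<in> carrier H \<Longrightarrow>
      mult_map K H (tmap K H H H H (antipode H) id (comult H h)) = counit H h \<odot>\<^bsub>H\<^esub> \<one>\<^bsub>H\<^esub>"
    and antipode_right: "h \<in> carrier H \<Longrightarrow>
      mult_map K H (tmap K H H H H id (antipode H) (comult H h)) = counit H h \<odot>\<^bsub>H\<^esub> \<one>\<^bsub>H\<^esub>"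

datatype 'a opp = Op (unop: 'a)

definition opposite :: "('k, 'a, 'm) module_scheme \<Rightarrow> ('k, 'a opp) module" where
  "opposite A = \<lparr>carrier = Op ` carrier A,
     mult = (\<lambda>x y. Op (unop y \<otimes>\<^bsub>A\<^esub> unop x)),
     one = Op \<one>\<^bsub>A\<^esub>,
     zero = Op \<zero>\<^bsub>A\<^esub>,
     add = (\<lambda>x y. Op (unop x \<oplus>\<^bsub>A\<^esub> unop y)),
     smult = (\<lambda>c x. Op (c \<odot>\<^bsub>A\<^esub> unop x))\<rparr>"

definition opposite_hopf :: "('k, 'r) ring_scheme \<Rightarrow> ('k, 'a) hopf \<Rightarrow> ('k, 'a opp) hopf" where
  "opposite_hopf K H = module.extend (opposite H)
     (hopf.fields
        (\<lambda>x. tmap K H H (opposite H) (opposite H) Op Op (comult H (unop x)))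
        (\<lambda>x. counit H (unop x))
        (\<lambda>x. Op (inv_into (carrier H) (antipode H) (unop x))))"

definition pairing :: "'a \<Rightarrow> ('a \<Rightarrow> 'k) \<Rightarrow> 'k" where
  "pairing h \<theta> = \<theta> h"

text \<open>
  The dual of a finite-dimensional Hopf algebra. Functionals are taken to be extensional
  on \<open>carrier H\<close>, so that they are determined by their values there. The product is the
  convolution product, and the coproduct is determined by
  \<open>p(hh', \<theta>) = p(h, \<theta>\<^sub>(\<^sub>1\<^sub>)) p(h', \<theta>\<^sub>(\<^sub>2\<^sub>))\<close>.
\<close>

definition dual_alg :: "('k, 'r) ring_scheme \<Rightarrow> ('k, 'a) hopf \<Rightarrow> ('k, 'a \<Rightarrow> 'k) module" where
  "dual_alg K H = (ring.func_space K (carrier H))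
     \<lparr>carrier := module_hom K H (self_module K) \<inter> extensional (carrier H),
      mult := (\<lambda>\<theta> \<theta>'. \<lambda>h \<in> carrier H.
         tlift K H H (self_module K) (\<lambda>a b. pairing a \<theta> \<otimes>\<^bsub>K\<^esub> pairing b \<theta>') (comult H h)),
      one := restrict (counit H) (carrier H)\<rparr>"

definition dual_comult ::
  "('k, 'r) ring_scheme \<Rightarrow> ('k, 'a) hopf \<Rightarrow> ('a \<Rightarrow> 'k) \<Rightarrow> (('a \<Rightarrow> 'k) \<times> ('a \<Rightarrow> 'k) \<Rightarrow> 'k) set"
  where
  "dual_comult K H \<theta> =
    (THE t. t \<in> carrier (tensor K (dual_alg K H) (dual_alg K H))
      \<and> (\<forall>h \<in> carrier H. \<forall>h' \<in> carrier H.
           tlift K (dual_alg K H) (dual_alg K H) (self_module K)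
             (\<lambda>\<phi> \<psi>. pairing h \<phi> \<otimes>\<^bsub>K\<^esub> pairing h' \<psi>) t
           = pairing (h \<otimes>\<^bsub>H\<^esub> h') \<theta>))"

definition dual_hopf :: "('k, 'r) ring_scheme \<Rightarrow> ('k, 'a) hopf \<Rightarrow> ('k, 'a \<Rightarrow> 'k) hopf" where
  "dual_hopf K H = module.extend (dual_alg K H)
     (hopf.fields
        (dual_comult K H)
        (\<lambda>\<theta>. pairing \<one>\<^bsub>H\<^esub> \<theta>)
        (\<lambda>\<theta>. \<lambda>h \<in> carrier H. pairing (antipode H h) \<theta>))"

section \<open>Yetter--Drinfeld algebras\<close>

definition left_coaction ::
  "('k, 'r) ring_scheme \<Rightarrow> ('k, 'c) hopf \<Rightarrow> ('k, 'x, 'm) module_scheme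
    \<Rightarrow> ('x \<Rightarrow> ('c \<times> 'x \<Rightarrow> 'k) set) \<Rightarrow> bool" where
  "left_coaction K C X \<alpha> \<longleftrightarrow>
     \<alpha> \<in> alg_hom K X (tensor K C X)
   \<and> (\<forall>x \<in> carrier X.
        tmap K C X C (tensor K C X) id \<alpha> (\<alpha> x)
          = tassoc K C C X (tmap K C X (tensor K C C) X (comult C) id (\<alpha> x)))
   \<and> (\<forall>x \<in> carrier X. tlift K C X X (\<lambda>c y. counit C c \<odot>\<^bsub>X\<^esub> y) (\<alpha> x) = x)"

definition dual_vec ::
  "('k, 'r) ring_scheme \<Rightarrow> ('k, 'a) hopf \<Rightarrow> 'a set \<Rightarrow> 'a \<Rightarrow> 'a \<Rightarrow> 'k" where
  "dual_vec K H B b =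
    (THE \<theta>. \<theta> \<in> carrier (dual_hopf K H)
        \<and> (\<forall>b' \<in> B. \<theta> b' = (if b' = b then \<one>\<^bsub>K\<^esub> else \<zero>\<^bsub>K\<^esub>)))"

text \<open>The element \<open>\<Sum>\<^sub>i h\<^sub>i\<^sup>o\<^sup>p \<otimes> h\<^sub>i\<^sup>*\<close> of \<open>H\<^sup>o\<^sup>p \<otimes> H\<^sup>*\<close>; the functionals \<open>h\<^sub>i\<^sup>*\<close>
  form the dual basis, and the element does not depend on the basis chosen.\<close>

definition U_op ::
  "('k, 'r) ring_scheme \<Rightarrow> ('k, 'a) hopf \<Rightarrow> ('a opp \<times> ('a \<Rightarrow> 'k) \<Rightarrow> 'k) set" where
  "U_op K H =
    (let B = (SOME B. finite B \<and> vectorspace.basis K H B)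
     in finsum (tensor K (opposite_hopf K H) (dual_hopf K H))
          (\<lambda>b. tens K (opposite_hopf K H) (dual_hopf K H) (Op b) (dual_vec K H B b)) B)"

definition Ad :: "('a, 'm) ring_scheme \<Rightarrow> 'a \<Rightarrow> 'a \<Rightarrow> 'a" where
  "Ad A w z = w \<otimes>\<^bsub>A\<^esub> z \<otimes>\<^bsub>A\<^esub> inv\<^bsub>A\<^esub> w"

definition yd_algebra ::
  "('k, 'r) ring_scheme \<Rightarrow> ('k, 'a) hopf \<Rightarrow> ('k, 'x, 'm) module_scheme
    \<Rightarrow> ('x \<Rightarrow> ('a opp \<times> 'x \<Rightarrow> 'k) set) \<Rightarrow> ('x \<Rightarrow> (('a \<Rightarrow> 'k) \<times> 'x \<Rightarrow> 'k) set) \<Rightarrow> bool" where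
  "yd_algebra K H X \<alpha> \<beta> \<longleftrightarrow>
    (let Ho = opposite_hopf K H; Hd = dual_hopf K H
     in k_algebra K X
      \<and> left_coaction K Ho X \<alpha>
      \<and> left_coaction K Hd X \<beta>
      \<and> (\<forall>x \<in> carrier X.
           tmap K Hd X Hd (tensor K Ho X) id \<alpha> (\<beta> x)
           = tassoc K Hd Ho X
               (tmap K (tensor K Ho Hd) X (tensor K Hd Ho) X (tflip K Ho Hd) id
                 (tmap K (tensor K Ho Hd) X (tensor K Ho Hd) X
                    (Ad (tensor K Ho Hd) (U_op K H)) id
                   (tassoc_inv K Ho Hd X
                     (tmap K Ho X Ho (tensor K Hd X) id \<beta> (\<alpha> x)))))))"

text \<open>\<open>dual_act K H X \<beta> x h\<close> is \<open>x \<lhd>\<^sub>\<beta> h\<close>.\<close>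

definition dual_act ::
  "('k, 'r) ring_scheme \<Rightarrow> ('k, 'a) hopf \<Rightarrow> ('k, 'x, 'm) module_scheme
    \<Rightarrow> ('x \<Rightarrow> (('a \<Rightarrow> 'k) \<times> 'x \<Rightarrow> 'k) set) \<Rightarrow> 'x \<Rightarrow> 'a \<Rightarrow> 'x" where
  "dual_act K H X \<beta> x h =
     tlift K (dual_hopf K H) X X (\<lambda>\<theta> y. pairing h \<theta> \<odot>\<^bsub>X\<^esub> y) (\<beta> x)"

text \<open>Braided commutativity of a right-left Yetter--Drinfeld algebra \<open>(X, \<lhd>, \<alpha>)\<close>:
  \<open>xy = (y \<lhd> x\<^sub>[\<^sub>-\<^sub>1\<^sub>]) x\<^sub>[\<^sub>0\<^sub>]\<close>.\<close>

definition rl_braided_commutative ::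
  "('k, 'r) ring_scheme \<Rightarrow> ('k, 'a) hopf \<Rightarrow> ('k, 'x, 'm) module_scheme
    \<Rightarrow> ('x \<Rightarrow> 'a \<Rightarrow> 'x) \<Rightarrow> ('x \<Rightarrow> ('a opp \<times> 'x \<Rightarrow> 'k) set) \<Rightarrow> bool" where
  "rl_braided_commutative K H X act \<alpha> \<longleftrightarrow>
    (\<forall>x \<in> carrier X. \<forall>y \<in> carrier X.
       x \<otimes>\<^bsub>X\<^esub> y =
         tlift K (opposite_hopf K H) X X (\<lambda>h z. act y (unop h) \<otimes>\<^bsub>X\<^esub> z) (\<alpha> x))"

section \<open>The Heisenberg algebra and braided commutativity\<close>

text \<open>The product is
  \<open>(h # \<theta>)(h' # \<theta>') = h h'\<^sub>(\<^sub>1\<^sub>) p(h'\<^sub>(\<^sub>2\<^sub>), \<theta>\<^sub>(\<^sub>1\<^sub>)) # \<theta>\<^sub>(\<^sub>2\<^sub>) \<theta>'\<close>, with \<open>h # \<theta>\<close> the pure tensor.\<close>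

definition heisenberg ::
  "('k, 'r) ring_scheme \<Rightarrow> ('k, 'a) hopf \<Rightarrow> ('k, ('a \<times> ('a \<Rightarrow> 'k) \<Rightarrow> 'k) set) module" where
  "heisenberg K H =
    (let Hd = dual_hopf K H; T = tensor_space K H Hd
     in T \<lparr>mult := (\<lambda>s t.
             tlift K H Hd T (\<lambda>h \<theta>.
               tlift K H Hd T (\<lambda>h' \<theta>'.
                 tlift K H H T (\<lambda>h1 h2.
                   tlift K Hd Hd T (\<lambda>\<theta>1 \<theta>2.
                     pairing h2 \<theta>1 \<odot>\<^bsub>T\<^esub> tens K H Hd (h \<otimes>\<^bsub>H\<^esub> h1) (\<theta>2 \<otimes>\<^bsub>Hd\<^esub> \<theta>'))
                   (comult Hd \<theta>))
                 (comult H h'))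
               t)
             s),
           one := tens K H Hd \<one>\<^bsub>H\<^esub> \<one>\<^bsub>Hd\<^esub>\<rparr>)"

definition iota1 ::
  "('k, 'r) ring_scheme \<Rightarrow> ('k, 'a) hopf \<Rightarrow> ('k, 'x, 'm) module_scheme
    \<Rightarrow> ('a \<times> 'x opp \<Rightarrow> 'k) set \<Rightarrow> (('a \<times> ('a \<Rightarrow> 'k) \<Rightarrow> 'k) set \<times> 'x opp \<Rightarrow> 'k) set" where
  "iota1 K H X = tmap K H (opposite X) (heisenberg K H) (opposite X)
     (\<lambda>h. tens K H (dual_hopf K H) h \<one>\<^bsub>dual_hopf K H\<^esub>) id"

definition iota2 ::
  "('k, 'r) ring_scheme \<Rightarrow> ('k, 'a) hopf \<Rightarrow> ('k, 'x, 'm) module_scheme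
    \<Rightarrow> (('a \<Rightarrow> 'k) \<times> 'x opp \<Rightarrow> 'k) set
    \<Rightarrow> (('a \<times> ('a \<Rightarrow> 'k) \<Rightarrow> 'k) set \<times> 'x opp \<Rightarrow> 'k) set" where
  "iota2 K H X = tmap K (dual_hopf K H) (opposite X) (heisenberg K H) (opposite X)
     (\<lambda>\<theta>. tens K H (dual_hopf K H) \<one>\<^bsub>H\<^esub> \<theta>) id"

definition alpha_dot ::
  "('k, 'r) ring_scheme \<Rightarrow> ('k, 'a) hopf \<Rightarrow> ('k, 'x, 'm) module_scheme
    \<Rightarrow> ('x \<Rightarrow> ('a opp \<times> 'x \<Rightarrow> 'k) set) \<Rightarrow> 'x \<Rightarrow> ('a \<times> 'x \<Rightarrow> 'k) set" where
  "alpha_dot K H X \<alpha> x = tmap K (opposite_hopf K H) X H X unop id (\<alpha> x)"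

definition braided_commutative ::
  "('k, 'r) ring_scheme \<Rightarrow> ('k, 'a) hopf \<Rightarrow> ('k, 'x, 'm) module_scheme
    \<Rightarrow> ('x \<Rightarrow> ('a opp \<times> 'x \<Rightarrow> 'k) set) \<Rightarrow> ('x \<Rightarrow> (('a \<Rightarrow> 'k) \<times> 'x \<Rightarrow> 'k) set) \<Rightarrow> bool" where
  "braided_commutative K H X \<alpha> \<beta> \<longleftrightarrow>
    (let Hd = dual_hopf K H; Xo = opposite X;
         E1 = tensor K H Xo; E2 = tensor K Hd Xo;
         A = tensor K (heisenberg K H) Xo;
         a = (\<lambda>x. tmap K H X H Xo id Op (alpha_dot K H X \<alpha> x));
         b = (\<lambda>y. tmap K Hd X Hd Xo (antipode Hd) Op (\<beta> y))
     in \<forall>x \<in> carrier X. \<forall>y \<in> carrier X.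
          mult_map K A (tmap K E1 E2 A A (iota1 K H X) (iota2 K H X) (tens K E1 E2 (a x) (b y)))
          = mult_map K A (tmap K E2 E1 A A (iota2 K H X) (iota1 K H X) (tens K E2 E1 (b y) (a x))))"

end

theory Submission
  imports Defs
begin

text \<open>
  Write \<open>\<alpha>(x) = x\<^sub>[\<^sub>-\<^sub>1\<^sub>]\<^sup>o\<^sup>p \<otimes> x\<^sub>[\<^sub>0\<^sub>]\<close> and \<open>y \<lhd> h\<close> for the action of \<open>H\<close> on \<open>X\<close> that is dual to \<open>\<beta>\<close>.
  In the Heisenberg algebra \<open>(h # 1)(1 # \<theta>) = h # \<theta>\<close>, while
  \<open>(1 # \<theta>)(h # 1) = h\<^sub>1 \<theta>\<^sub>1(h\<^sub>2) # \<theta>\<^sub>2\<close>. An element of \<open>\<H>(H) \<otimes> X\<^sup>o\<^sup>p\<close> is determined by the values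
  in \<open>H \<otimes> X\<close> obtained by evaluating its functional leg at all \<open>g \<in> H\<close>
  (\<open>dual_eval_separates\<close>; this rests on a pair of dual bases). As
  \<open>\<theta>\<^sub>1(h)\<theta>\<^sub>2(g) = \<theta>(hg)\<close>, the Heisenberg condition therefore says
  \<open>x\<^sub>[\<^sub>-\<^sub>1\<^sub>] \<otimes> (y \<lhd> S(g)) x\<^sub>[\<^sub>0\<^sub>] = x\<^sub>[\<^sub>-\<^sub>1\<^sub>]\<^sub>1 \<otimes> x\<^sub>[\<^sub>0\<^sub>] (y \<lhd> S(x\<^sub>[\<^sub>-\<^sub>1\<^sub>]\<^sub>2 g))\<close>
  for all \<open>x\<close>, \<open>y\<close> and \<open>g\<close> (\<open>braided_commutative_evaluated\<close>).

  Taking \<open>g = 1\<close> and applying the counit to the first leg leaves the twisted rule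
  \<open>y x = x\<^sub>[\<^sub>0\<^sub>] (y \<lhd> S(x\<^sub>[\<^sub>-\<^sub>1\<^sub>]))\<close>. Applied to the factors of \<open>(y \<lhd> x\<^sub>[\<^sub>-\<^sub>1\<^sub>]) x\<^sub>[\<^sub>0\<^sub>]\<close>, it gives
  \<open>x\<^sub>[\<^sub>0\<^sub>] (y \<lhd> x\<^sub>[\<^sub>-\<^sub>1\<^sub>]\<^sub>1 S(x\<^sub>[\<^sub>-\<^sub>1\<^sub>]\<^sub>2)) = x y\<close>, because \<open>\<alpha>\<close> is coassociative and \<open>\<lhd>\<close> is an action.
  Conversely, the rule \<open>x y = (y \<lhd> x\<^sub>[\<^sub>-\<^sub>1\<^sub>]) x\<^sub>[\<^sub>0\<^sub>]\<close> turns \<open>x\<^sub>[\<^sub>0\<^sub>] (y \<lhd> S(x\<^sub>[\<^sub>-\<^sub>1\<^sub>] g))\<close> into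
  \<open>(y \<lhd> S(x\<^sub>[\<^sub>-\<^sub>1\<^sub>]\<^sub>1 g) x\<^sub>[\<^sub>-\<^sub>1\<^sub>]\<^sub>2) x\<^sub>[\<^sub>0\<^sub>]\<close>, and \<open>S(h\<^sub>1 g) h\<^sub>2 = \<epsilon>(h) S(g)\<close> (\<open>antipode_cancel\<close>) collapses this to
  \<open>(y \<lhd> S(g)) x\<close>; coassociativity of \<open>\<alpha>\<close> then gives the evaluated form of the Heisenberg condition.

  A Sweedler sum \<open>f(h\<^sub>1, h\<^sub>2)\<close> is expressed as the lift of the bilinear map \<open>f\<close> to the tensor product,
  evaluated at the coproduct of \<open>h\<close>. So the computation needs the universal property of the
  tensor product, proved from the construction by cosets, and then only that linear maps
  commute with lifts, that lifts in different tensors can be interchanged, and coassociativity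
  for trilinear maps. The side conditions of these steps are multilinearity statements, which are
  settled by a set of introduction rules.
\<close>

abbreviation bilinear ::
  "('k, 'r) ring_scheme \<Rightarrow> ('k, 'a, 'm) module_scheme \<Rightarrow> ('k, 'b, 'n) module_scheme
    \<Rightarrow> ('k, 'w, 'l) module_scheme \<Rightarrow> ('a \<Rightarrow> 'b \<Rightarrow> 'w) \<Rightarrow> bool" where
  "bilinear K M N W f \<equiv> (\<forall>m \<in> carrier M. (\<lambda>n. f m n) \<in> module_hom K N W)
     \<and> (\<forall>n \<in> carrier N. (\<lambda>m. f m n) \<in> module_hom K M W)"

lemma module_homI:
  assumes "\<And>m. m \<in> carrier M \<Longrightarrow> f m \<in> carrier N"
    and "\<And>m m'. \<lbrakk>m \<in> carrier M; m' \<in> carrier M\<rbrakk> \<Longrightarrow> f (m \<oplus>\<^bsub>M\<^esub> m') = f m \<oplus>\<^bsub>N\<^esub> f m'"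
    and "\<And>c m. \<lbrakk>c \<in> carrier K; m \<in> carrier M\<rbrakk> \<Longrightarrow> f (c \<odot>\<^bsub>M\<^esub> m) = c \<odot>\<^bsub>N\<^esub> f m"
  shows "f \<in> module_hom K M N"
  using assms by (auto simp: module_hom_def)

section \<open>Free vector spaces\<close>

lemma free_space_carrier:
  "u \<in> carrier (free_space K S) \<longleftrightarrow> u \<in> S \<rightarrow>\<^sub>E carrier K \<and> finite {s \<in> S. u s \<noteq> \<zero>\<^bsub>K\<^esub>}"
  by (simp add: free_space_def)

lemma free_space_ops:
  assumes "cring K"
  shows "zero (free_space K S) = (\<lambda>s \<in> S. \<zero>\<^bsub>K\<^esub>)"
    and "u \<oplus>\<^bsub>free_space K S\<^esub> v = (\<lambda>s \<in> S. u s \<oplus>\<^bsub>K\<^esub> v s)"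
    and "c \<odot>\<^bsub>free_space K S\<^esub> u = (\<lambda>s \<in> S. c \<otimes>\<^bsub>K\<^esub> u s)"
proof -
  interpret cring K by fact
  show "zero (free_space K S) = (\<lambda>s \<in> S. \<zero>\<^bsub>K\<^esub>)"
    "u \<oplus>\<^bsub>free_space K S\<^esub> v = (\<lambda>s \<in> S. u s \<oplus>\<^bsub>K\<^esub> v s)"
    "c \<odot>\<^bsub>free_space K S\<^esub> u = (\<lambda>s \<in> S. c \<otimes>\<^bsub>K\<^esub> u s)"
    by (simp_all add: free_space_def func_space_def)
qed

lemma free_space_module:
  assumes "cring K"
  shows "module K (free_space K S)"
proof -
  interpret cring K by fact
  interpret F: module K "func_space S" by (rule func_space_is_module)
  let ?N = "{f \<in> S \<rightarrow>\<^sub>E carrier K. finite {s \<in> S. f s \<noteq> \<zero>\<^bsub>K\<^esub>}}"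
  have "submodule K ?N (func_space S)"
  proof (rule submodule.intro)
    show "module K (func_space S)" ..
    show "?N \<subseteq> carrier (func_space S)" by (auto simp: func_space_def)
    show "zero (func_space S) \<in> ?N" by (auto simp: func_space_def)
  next
    fix v w assume v: "v \<in> ?N" and w: "w \<in> ?N"
    have "{s \<in> S. v s \<oplus>\<^bsub>K\<^esub> w s \<noteq> \<zero>\<^bsub>K\<^esub>} \<subseteq> {s \<in> S. v s \<noteq> \<zero>\<^bsub>K\<^esub>} \<union> {s \<in> S. w s \<noteq> \<zero>\<^bsub>K\<^esub>}"
      by auto
    then have "finite {s \<in> S. v s \<oplus>\<^bsub>K\<^esub> w s \<noteq> \<zero>\<^bsub>K\<^esub>}"
      using v w by (auto elim!: finite_subset)
    then have "finite {s \<in> S. restrict (\<lambda>v'. v v' \<oplus>\<^bsub>K\<^esub> w v') S s \<noteq> \<zero>\<^bsub>K\<^esub>}"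
      by (rule rev_finite_subset) auto
    then show "v \<oplus>\<^bsub>func_space S\<^esub> w \<in> ?N"
      using v w by (auto simp: func_space_def PiE_mem2)
  next
    fix c v assume c: "c \<in> carrier K" and v: "v \<in> ?N"
    have "finite {s \<in> S. v s \<noteq> \<zero>\<^bsub>K\<^esub>}" using v by simp
    then have "finite {s \<in> S. restrict (\<lambda>v'. c \<otimes>\<^bsub>K\<^esub> v v') S s \<noteq> \<zero>\<^bsub>K\<^esub>}"
      by (rule rev_finite_subset) (use c in auto)
    then show "c \<odot>\<^bsub>func_space S\<^esub> v \<in> ?N"
      using v c by (auto simp: func_space_def PiE_mem2)
  qed
  then show ?thesis
    unfolding free_space_def by (rule F.submodule_is_module)
qed

lemma free_gen_closed:
  assumes "cring K" and "s \<in> S"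
  shows "free_gen K S s \<in> carrier (free_space K S)"
proof -
  interpret cring K by fact
  have "finite {t \<in> S. free_gen K S s t \<noteq> \<zero>\<^bsub>K\<^esub>}"
    by (rule finite_subset[of _ "{s}"]) (auto simp: free_gen_def split: if_splits)
  then show ?thesis
    by (auto simp: free_space_carrier free_gen_def)
qed

text \<open>Finite induction on the support: a vector is split at one point of its support.\<close>

lemma free_space_induct [consumes 2, case_names zero step]:
  assumes "cring K" and "u \<in> carrier (free_space K S)"
    and "P (zero (free_space K S))"
    and "\<And>c s v. \<lbrakk>c \<in> carrier K; s \<in> S; v \<in> carrier (free_space K S); P v\<rbrakk>
      \<Longrightarrow> P (c \<odot>\<^bsub>free_space K S\<^esub> free_gen K S s \<oplus>\<^bsub>free_space K S\<^esub> v)"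
  shows "P u"
proof -
  interpret cring K by fact
  have "P u" if "finite T" "u \<in> carrier (free_space K S)" "{s \<in> S. u s \<noteq> \<zero>\<^bsub>K\<^esub>} = T" for u T
    using that
  proof (induction T arbitrary: u rule: finite_induct)
    case empty
    then have "u = zero (free_space K S)"
      by (auto simp: free_space_carrier free_space_ops[OF assms(1)] intro!: extensionalityI[where A = S])
        (auto simp: PiE_def)
    then show ?case using assms(3) by simp
  next
    case (insert s T)
    define v where "v = u(s := \<zero>\<^bsub>K\<^esub>)"
    have s: "s \<in> S" using insert.prems by auto
    have uc: "\<And>t. t \<in> S \<Longrightarrow> u t \<in> carrier K"
      using insert.prems(1) by (auto simp: free_space_carrier)
    have supp: "{t \<in> S. v t \<noteq> \<zero>\<^bsub>K\<^esub>} = T"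
      using insert.prems insert.hyps by (auto simp: v_def)
    have v: "v \<in> carrier (free_space K S)"
      using insert.prems(1) s supp insert.hyps uc
      by (auto simp: free_space_carrier v_def PiE_def extensional_def split: if_splits)
    have "u = u s \<odot>\<^bsub>free_space K S\<^esub> free_gen K S s \<oplus>\<^bsub>free_space K S\<^esub> v"
      using insert.prems(1) s uc
      by (intro extensionalityI[where A = S])
        (auto simp: free_space_ops[OF assms(1)] free_gen_def v_def free_space_carrier PiE_def)
    with assms(4)[OF uc[OF s] s v insert.IH[OF v supp]] show ?case by simp
  qed
  with assms(2) show ?thesis by (auto simp: free_space_carrier)
qed

text \<open>The sum runs over the support of \<open>u\<close> only, so that it is finite; every larger finite set of
  indices gives the same value, which makes the map additive.\<close>

definition free_extension ::
  "('k, 'r) ring_scheme \<Rightarrow> 's set \<Rightarrow> ('k, 'w, 'l) module_scheme \<Rightarrow> ('s \<Rightarrow> 'w) \<Rightarrow> ('s \<Rightarrow> 'k) \<Rightarrow> 'w"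
  where "free_extension K S W g u = (\<Oplus>\<^bsub>W\<^esub>s \<in> {s \<in> S. u s \<noteq> \<zero>\<^bsub>K\<^esub>}. u s \<odot>\<^bsub>W\<^esub> g s)"

lemma free_extension_superset:
  assumes "module K W" and "g \<in> S \<rightarrow> carrier W" and "u \<in> S \<rightarrow> carrier K"
    and "finite T" and "{s \<in> S. u s \<noteq> \<zero>\<^bsub>K\<^esub>} \<subseteq> T" and "T \<subseteq> S"
  shows "free_extension K S W g u = (\<Oplus>\<^bsub>W\<^esub>s \<in> T. u s \<odot>\<^bsub>W\<^esub> g s)"
proof -
  interpret W: module K W by fact
  show ?thesis unfolding free_extension_def
    using assms(2-6) by (intro W.add.finprod_mono_neutral_cong_left) (auto simp: Pi_iff subset_iff)
qed

lemma free_extension_hom: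
  assumes "module K W" and g: "g \<in> S \<rightarrow> carrier W"
  shows "free_extension K S W g \<in> module_hom K (free_space K S) W"
proof -
  interpret W: module K W by fact
  have K: "cring K" ..
  interpret F: module K "free_space K S" by (rule free_space_module[OF K])
  let ?supp = "\<lambda>u. {s \<in> S. u s \<noteq> \<zero>\<^bsub>K\<^esub>}"
  have mem: "u \<in> S \<rightarrow> carrier K" "finite (?supp u)" if "u \<in> carrier (free_space K S)" for u
    using that by (auto simp: free_space_carrier)
  have closed: "free_extension K S W g u \<in> carrier W" if "u \<in> carrier (free_space K S)" for u
    unfolding free_extension_def using mem[OF that] g by (intro W.finsum_closed) auto
  have add: "free_extension K S W g (u \<oplus>\<^bsub>free_space K S\<^esub> v)
      = free_extension K S W g u \<oplus>\<^bsub>W\<^esub> free_extension K S W g v"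
    if u: "u \<in> carrier (free_space K S)" and v: "v \<in> carrier (free_space K S)" for u v
  proof -
    let ?w = "u \<oplus>\<^bsub>free_space K S\<^esub> v"
    let ?T = "?supp u \<union> ?supp v"
    have w: "?w \<in> carrier (free_space K S)" using u v by simp
    have T: "finite ?T" "?T \<subseteq> S" using mem[OF u] mem[OF v] by auto
    have "?supp ?w \<subseteq> ?T" by (auto simp: free_space_ops[OF K])
    then have "free_extension K S W g ?w = (\<Oplus>\<^bsub>W\<^esub>s \<in> ?T. ?w s \<odot>\<^bsub>W\<^esub> g s)"
      using T mem[OF w] by (intro free_extension_superset[OF assms]) auto
    also have "\<dots> = (\<Oplus>\<^bsub>W\<^esub>s \<in> ?T. u s \<odot>\<^bsub>W\<^esub> g s \<oplus>\<^bsub>W\<^esub> v s \<odot>\<^bsub>W\<^esub> g s)"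
      using mem[OF u] mem[OF v] g
      by (intro W.finsum_cong') (auto simp: free_space_ops[OF K] Pi_iff W.smult_l_distr)
    also have "\<dots> = (\<Oplus>\<^bsub>W\<^esub>s \<in> ?T. u s \<odot>\<^bsub>W\<^esub> g s) \<oplus>\<^bsub>W\<^esub> (\<Oplus>\<^bsub>W\<^esub>s \<in> ?T. v s \<odot>\<^bsub>W\<^esub> g s)"
      using mem[OF u] mem[OF v] g by (intro W.finsum_addf) (auto simp: Pi_iff)
    also have "(\<Oplus>\<^bsub>W\<^esub>s \<in> ?T. u s \<odot>\<^bsub>W\<^esub> g s) = free_extension K S W g u"
      using T mem[OF u] by (intro free_extension_superset[OF assms, symmetric]) auto
    also have "(\<Oplus>\<^bsub>W\<^esub>s \<in> ?T. v s \<odot>\<^bsub>W\<^esub> g s) = free_extension K S W g v"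
      using T mem[OF v] by (intro free_extension_superset[OF assms, symmetric]) auto
    finally show ?thesis .
  qed
  have smult: "free_extension K S W g (c \<odot>\<^bsub>free_space K S\<^esub> u) = c \<odot>\<^bsub>W\<^esub> free_extension K S W g u"
    if c: "c \<in> carrier K" and u: "u \<in> carrier (free_space K S)" for c u
  proof -
    let ?w = "c \<odot>\<^bsub>free_space K S\<^esub> u"
    have w: "?w \<in> carrier (free_space K S)" using u c by simp
    have "free_extension K S W g ?w = (\<Oplus>\<^bsub>W\<^esub>s \<in> ?supp u. ?w s \<odot>\<^bsub>W\<^esub> g s)"
      using mem[OF u] mem[OF w] c
      by (intro free_extension_superset[OF assms]) (auto simp: free_space_ops[OF K])
    also have "\<dots> = (\<Oplus>\<^bsub>W\<^esub>s \<in> ?supp u. c \<odot>\<^bsub>W\<^esub> (u s \<odot>\<^bsub>W\<^esub> g s))"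
      using mem[OF u] g c
      by (intro W.finsum_cong') (auto simp: free_space_ops[OF K] Pi_iff W.smult_assoc1)
    also have "\<dots> = c \<odot>\<^bsub>W\<^esub> free_extension K S W g u"
      unfolding free_extension_def using mem[OF u] g c
      by (intro W.finsum_smult[symmetric]) auto
    finally show ?thesis .
  qed
  show ?thesis unfolding module_hom_def using closed add smult by auto
qed

lemma free_extension_gen:
  assumes "module K W" and "g \<in> S \<rightarrow> carrier W" and "s \<in> S"
  shows "free_extension K S W g (free_gen K S s) = g s"
proof -
  interpret W: module K W by fact
  have "free_extension K S W g (free_gen K S s) = (\<Oplus>\<^bsub>W\<^esub>t \<in> {s}. free_gen K S s t \<odot>\<^bsub>W\<^esub> g t)"
    using assms by (intro free_extension_superset) (auto simp: free_gen_def)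
  also have "\<dots> = g s"
    using assms by (subst W.finsum_insert) (auto simp: free_gen_def Pi_iff)
  finally show ?thesis .
qed

section \<open>The universal property of the tensor product\<close>

text \<open>The module axioms pass along a surjection that respects the operations. It is used for the
  coset map onto the tensor product, for passing to the opposite algebra, and, with the
  identity map, for records that differ only in their products.\<close>

lemma module_surjective_image:
  assumes "module K F" and q: "q ` carrier F = carrier T"
    and add: "\<And>u v. \<lbrakk>u \<in> carrier F; v \<in> carrier F\<rbrakk> \<Longrightarrow> q u \<oplus>\<^bsub>T\<^esub> q v = q (u \<oplus>\<^bsub>F\<^esub> v)"
    and smult: "\<And>c u. \<lbrakk>c \<in> carrier K; u \<in> carrier F\<rbrakk> \<Longrightarrow> c \<odot>\<^bsub>T\<^esub> q u = q (c \<odot>\<^bsub>F\<^esub> u)"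
    and zero: "\<zero>\<^bsub>T\<^esub> = q \<zero>\<^bsub>F\<^esub>"
  shows "module K T"
proof -
  interpret F: module K F by fact
  have *: "(\<forall>t \<in> carrier T. Q t) \<longleftrightarrow> (\<forall>u \<in> carrier F. Q (q u))" for Q
    unfolding q[symmetric] by blast
  have q_mem: "q u \<in> carrier T" if "u \<in> carrier F" for u using q that by blast
  show ?thesis
  proof (rule module_criteria)
    show "cring K" ..
    show "\<zero>\<^bsub>T\<^esub> \<in> carrier T" using zero q_mem by simp
    have "\<forall>v \<in> carrier T. \<forall>w \<in> carrier T. v \<oplus>\<^bsub>T\<^esub> w \<in> carrier T"
      unfolding * by (simp add: add q_mem)
    then show "\<forall>v w. v \<in> carrier T \<and> w \<in> carrier T \<longrightarrow> v \<oplus>\<^bsub>T\<^esub> w \<in> carrier T" by blast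
    show "\<forall>v \<in> carrier T. \<exists>neg_v \<in> carrier T. v \<oplus>\<^bsub>T\<^esub> neg_v = \<zero>\<^bsub>T\<^esub>"
      unfolding *
    proof
      fix u assume u: "u \<in> carrier F"
      then have "q u \<oplus>\<^bsub>T\<^esub> q (\<ominus>\<^bsub>F\<^esub> u) = \<zero>\<^bsub>T\<^esub>" by (simp add: add zero F.r_neg)
      with u q_mem show "\<exists>neg_v \<in> carrier T. q u \<oplus>\<^bsub>T\<^esub> neg_v = \<zero>\<^bsub>T\<^esub>" by blast
    qed
    have "\<forall>c \<in> carrier K. \<forall>v \<in> carrier T. c \<odot>\<^bsub>T\<^esub> v \<in> carrier T"
      unfolding * by (simp add: smult q_mem)
    then show "\<forall>c v. c \<in> carrier K \<and> v \<in> carrier T \<longrightarrow> c \<odot>\<^bsub>T\<^esub> v \<in> carrier T" by blast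
    have "\<forall>v \<in> carrier T. \<forall>w \<in> carrier T. v \<oplus>\<^bsub>T\<^esub> w = w \<oplus>\<^bsub>T\<^esub> v"
      unfolding * by (simp add: add F.a_comm)
    then show "\<forall>v w. v \<in> carrier T \<and> w \<in> carrier T \<longrightarrow> v \<oplus>\<^bsub>T\<^esub> w = w \<oplus>\<^bsub>T\<^esub> v" by blast
    have "\<forall>v \<in> carrier T. \<forall>w \<in> carrier T. \<forall>x \<in> carrier T.
        (v \<oplus>\<^bsub>T\<^esub> w) \<oplus>\<^bsub>T\<^esub> x = v \<oplus>\<^bsub>T\<^esub> (w \<oplus>\<^bsub>T\<^esub> x)"
      unfolding * by (simp add: add F.a_assoc)
    then show "\<forall>v w x. v \<in> carrier T \<and> w \<in> carrier T \<and> x \<in> carrier T \<longrightarrow>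
        (v \<oplus>\<^bsub>T\<^esub> w) \<oplus>\<^bsub>T\<^esub> x = v \<oplus>\<^bsub>T\<^esub> (w \<oplus>\<^bsub>T\<^esub> x)" by blast
    show "\<forall>v \<in> carrier T. v \<oplus>\<^bsub>T\<^esub> \<zero>\<^bsub>T\<^esub> = v"
      unfolding * zero by (simp add: add)
    have "\<forall>a \<in> carrier K. \<forall>b \<in> carrier K. \<forall>v \<in> carrier T.
        (a \<otimes>\<^bsub>K\<^esub> b) \<odot>\<^bsub>T\<^esub> v = a \<odot>\<^bsub>T\<^esub> (b \<odot>\<^bsub>T\<^esub> v)"
      unfolding * by (simp add: smult F.smult_assoc1)
    then show "\<forall>a b v. a \<in> carrier K \<and> b \<in> carrier K \<and> v \<in> carrier T \<longrightarrow>
        (a \<otimes>\<^bsub>K\<^esub> b) \<odot>\<^bsub>T\<^esub> v = a \<odot>\<^bsub>T\<^esub> (b \<odot>\<^bsub>T\<^esub> v)" by blast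
    show "\<forall>v \<in> carrier T. \<one>\<^bsub>K\<^esub> \<odot>\<^bsub>T\<^esub> v = v"
      unfolding * by (simp add: smult)
    have "\<forall>a \<in> carrier K. \<forall>b \<in> carrier K. \<forall>v \<in> carrier T.
        (a \<oplus>\<^bsub>K\<^esub> b) \<odot>\<^bsub>T\<^esub> v = a \<odot>\<^bsub>T\<^esub> v \<oplus>\<^bsub>T\<^esub> b \<odot>\<^bsub>T\<^esub> v"
      unfolding * by (simp add: smult add F.smult_l_distr)
    then show "\<forall>a b v. a \<in> carrier K \<and> b \<in> carrier K \<and> v \<in> carrier T \<longrightarrow>
        (a \<oplus>\<^bsub>K\<^esub> b) \<odot>\<^bsub>T\<^esub> v = a \<odot>\<^bsub>T\<^esub> v \<oplus>\<^bsub>T\<^esub> b \<odot>\<^bsub>T\<^esub> v" by blast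
    have "\<forall>a \<in> carrier K. \<forall>v \<in> carrier T. \<forall>w \<in> carrier T.
        a \<odot>\<^bsub>T\<^esub> (v \<oplus>\<^bsub>T\<^esub> w) = a \<odot>\<^bsub>T\<^esub> v \<oplus>\<^bsub>T\<^esub> a \<odot>\<^bsub>T\<^esub> w"
      unfolding * by (simp add: smult add F.smult_r_distr)
    then show "\<forall>a v w. a \<in> carrier K \<and> v \<in> carrier T \<and> w \<in> carrier T \<longrightarrow>
        a \<odot>\<^bsub>T\<^esub> (v \<oplus>\<^bsub>T\<^esub> w) = a \<odot>\<^bsub>T\<^esub> v \<oplus>\<^bsub>T\<^esub> a \<odot>\<^bsub>T\<^esub> w" by blast
  qed
qed

lemma tensor_relations_closed:
  assumes "module K M" and "module K N"
  shows "tensor_relations K M N \<subseteq> carrier (free_space K (carrier M \<times> carrier N))"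
proof -
  interpret M: module K M by fact
  interpret N: module K N by fact
  have K: "cring K" ..
  interpret F: module K "free_space K (carrier M \<times> carrier N)" by (rule free_space_module[OF K])
  note gen = free_gen_closed[OF K, where S = "carrier M \<times> carrier N"]
  show ?thesis unfolding tensor_relations_def Let_def by (auto intro!: gen F.minus_closed)
qed

lemma tensor_null_submodule:
  assumes "module K M" and "module K N"
  shows "submodule K (tensor_null K M N) (free_space K (carrier M \<times> carrier N))"
proof -
  interpret M: module K M by fact
  have K: "cring K" ..
  interpret F: module K "free_space K (carrier M \<times> carrier N)" by (rule free_space_module[OF K])
  show ?thesis unfolding tensor_null_def
    by (rule F.span_is_submodule[OF tensor_relations_closed[OF assms]])
qed

lemma tensor_null_subgroup:
  assumes "module K M" and "module K N"
  shows "abelian_subgroup (tensor_null K M N) (free_space K (carrier M \<times> carrier N))"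
proof -
  interpret M: module K M by fact
  have K: "cring K" ..
  interpret F: module K "free_space K (carrier M \<times> carrier N)" by (rule free_space_module[OF K])
  interpret Z: submodule K "tensor_null K M N" "free_space K (carrier M \<times> carrier N)"
    by (rule tensor_null_submodule[OF assms])
  show ?thesis
  proof (rule abelian_subgroupI3)
    show "additive_subgroup (tensor_null K M N) (free_space K (carrier M \<times> carrier N))"
    proof (rule additive_subgroup.intro, rule subgroup.intro)
      fix x assume x: "x \<in> tensor_null K M N"
      then have "(\<ominus>\<^bsub>K\<^esub> \<one>\<^bsub>K\<^esub>) \<odot>\<^bsub>free_space K (carrier M \<times> carrier N)\<^esub> x \<in> tensor_null K M N"
        by simp
      with x Z.subset show "inv\<^bsub>add_monoid (free_space K (carrier M \<times> carrier N))\<^esub> x \<in> tensor_null K M N"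
        by (simp add: subset_iff F.smult_l_minus a_inv_def[symmetric] del: Z.smult_closed)
    qed (use Z.subset in auto)
    show "abelian_group (free_space K (carrier M \<times> carrier N))" ..
  qed
qed

text \<open>Everything about the tensor product as a set of cosets that later proofs need: it is the
  image of the free space under the coset map, with operations computed on representatives.\<close>

lemma tensor_quotient:
  fixes K :: "('k, 'r) ring_scheme" and M :: "('k, 'a, 'm) module_scheme"
    and N :: "('k, 'b, 'n) module_scheme"
  assumes "module K M" and "module K N"
  defines "F \<equiv> free_space K (carrier M \<times> carrier N)"
  defines "q \<equiv> a_r_coset F (tensor_null K M N)"
  defines "T \<equiv> tensor_space K M N"
  shows "q ` carrier F = carrier T"
    and "\<And>u v. \<lbrakk>u \<in> carrier F; v \<in> carrier F\<rbrakk> \<Longrightarrow> q u \<oplus>\<^bsub>T\<^esub> q v = q (u \<oplus>\<^bsub>F\<^esub> v)"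
    and "\<And>c u. \<lbrakk>c \<in> carrier K; u \<in> carrier F\<rbrakk> \<Longrightarrow> c \<odot>\<^bsub>T\<^esub> q u = q (c \<odot>\<^bsub>F\<^esub> u)"
    and "\<zero>\<^bsub>T\<^esub> = q \<zero>\<^bsub>F\<^esub>"
    and "\<And>u v. \<lbrakk>u \<in> carrier F; v \<in> carrier F; q u = q v\<rbrakk> \<Longrightarrow> u \<ominus>\<^bsub>F\<^esub> v \<in> tensor_null K M N"
    and "\<And>u. u \<in> carrier F \<Longrightarrow> u \<in> q u"
    and "\<And>u v. \<lbrakk>u \<in> carrier F; v \<in> carrier F; u \<ominus>\<^bsub>F\<^esub> v \<in> tensor_null K M N\<rbrakk> \<Longrightarrow> q u = q v"
    and "\<And>u v. \<lbrakk>u \<in> carrier F; v \<in> q u\<rbrakk> \<Longrightarrow> v \<in> carrier F \<and> q v = q u"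
proof -
  interpret M: module K M by fact
  have K: "cring K" ..
  interpret F: module K F unfolding F_def by (rule free_space_module[OF K])
  interpret Z: submodule K "tensor_null K M N" F
    unfolding F_def by (rule tensor_null_submodule[OF assms(1,2)])
  interpret Q: abelian_subgroup "tensor_null K M N" F
    unfolding F_def by (rule tensor_null_subgroup[OF assms(1,2)])
  show "q ` carrier F = carrier T"
    by (auto simp: q_def T_def tensor_space_def Let_def F_def A_RCOSETS_def RCOSETS_def
        a_r_coset_def)
  show add: "q u \<oplus>\<^bsub>T\<^esub> q v = q (u \<oplus>\<^bsub>F\<^esub> v)" if "u \<in> carrier F" "v \<in> carrier F" for u v
    using Q.a_rcos_sum[OF that] by (simp add: q_def T_def tensor_space_def Let_def F_def)
  show self: "u \<in> q u" if "u \<in> carrier F" for u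
    unfolding q_def by (rule Q.a_rcos_self[OF that])
  show mem: "v \<in> carrier F \<and> q v = q u" if "u \<in> carrier F" "v \<in> q u" for u v
    using that Q.a_repr_independence'[of v u] Q.a_elemrcos_carrier[of u v]
    unfolding q_def by blast
  show diff: "u \<ominus>\<^bsub>F\<^esub> v \<in> tensor_null K M N" if "u \<in> carrier F" "v \<in> carrier F" "q u = q v" for u v
    using that self[of u] unfolding q_def by (simp add: Q.a_rcos_module a_minus_def)
  show diff': "q u = q v" if "u \<in> carrier F" "v \<in> carrier F" "u \<ominus>\<^bsub>F\<^esub> v \<in> tensor_null K M N" for u v
    using that mem[of v u] unfolding q_def by (simp add: Q.a_rcos_module a_minus_def)
  show "c \<odot>\<^bsub>T\<^esub> q u = q (c \<odot>\<^bsub>F\<^esub> u)" if c: "c \<in> carrier K" and u: "u \<in> carrier F" for c u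
  proof -
    have "q (c \<odot>\<^bsub>F\<^esub> f) = q (c \<odot>\<^bsub>F\<^esub> u)" if "f \<in> q u" for f
    proof (rule diff')
      have f: "f \<in> carrier F" "q f = q u" using mem[OF u that] by auto
      have "c \<odot>\<^bsub>F\<^esub> (f \<ominus>\<^bsub>F\<^esub> u) \<in> tensor_null K M N"
        by (rule Z.smult_closed[OF c diff[OF f(1) u f(2)]])
      also have "c \<odot>\<^bsub>F\<^esub> (f \<ominus>\<^bsub>F\<^esub> u) = c \<odot>\<^bsub>F\<^esub> f \<ominus>\<^bsub>F\<^esub> c \<odot>\<^bsub>F\<^esub> u"
        unfolding a_minus_def using c f(1) u
        by (subst F.smult_r_distr) (simp_all add: F.smult_r_minus)
      finally show "c \<odot>\<^bsub>F\<^esub> f \<ominus>\<^bsub>F\<^esub> c \<odot>\<^bsub>F\<^esub> u \<in> tensor_null K M N" .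
      show "c \<odot>\<^bsub>F\<^esub> f \<in> carrier F" "c \<odot>\<^bsub>F\<^esub> u \<in> carrier F" using c f(1) u by auto
    qed
    then have "(\<Union>f \<in> q u. q (c \<odot>\<^bsub>F\<^esub> f)) = (\<Union>f \<in> q u. q (c \<odot>\<^bsub>F\<^esub> u))"
      by (rule SUP_cong[OF refl])
    also have "\<dots> = q (c \<odot>\<^bsub>F\<^esub> u)"
      using self[OF u] by (subst UN_constant) (rule if_not_P, blast)
    finally show ?thesis
      by (simp add: q_def T_def tensor_space_def Let_def F_def)
  qed
  show "\<zero>\<^bsub>T\<^esub> = q \<zero>\<^bsub>F\<^esub>"
    using F.a_coset_add_zero[OF Z.subset] by (simp add: q_def T_def tensor_space_def Let_def F_def)
qed

lemma bilinear_rules: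
  assumes "bilinear K M N W f"
  shows bilinear_closed: "\<lbrakk>m \<in> carrier M; n \<in> carrier N\<rbrakk> \<Longrightarrow> f m n \<in> carrier W"
    and bilinear_add_left: "\<lbrakk>m \<in> carrier M; m' \<in> carrier M; n \<in> carrier N\<rbrakk>
      \<Longrightarrow> f (m \<oplus>\<^bsub>M\<^esub> m') n = f m n \<oplus>\<^bsub>W\<^esub> f m' n"
    and bilinear_add_right: "\<lbrakk>m \<in> carrier M; n \<in> carrier N; n' \<in> carrier N\<rbrakk>
      \<Longrightarrow> f m (n \<oplus>\<^bsub>N\<^esub> n') = f m n \<oplus>\<^bsub>W\<^esub> f m n'"
    and bilinear_smult_left: "\<lbrakk>c \<in> carrier K; m \<in> carrier M; n \<in> carrier N\<rbrakk>
      \<Longrightarrow> f (c \<odot>\<^bsub>M\<^esub> m) n = c \<odot>\<^bsub>W\<^esub> f m n"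
    and bilinear_smult_right: "\<lbrakk>c \<in> carrier K; m \<in> carrier M; n \<in> carrier N\<rbrakk>
      \<Longrightarrow> f m (c \<odot>\<^bsub>N\<^esub> n) = c \<odot>\<^bsub>W\<^esub> f m n"
  using assms by (auto simp: module_hom_def)

lemma tensor_space_module:
  assumes "module K M" and "module K N"
  shows "module K (tensor_space K M N)"
proof -
  interpret M: module K M by fact
  have K: "cring K" ..
  note Q = tensor_quotient[OF assms]
  show ?thesis
  proof (rule module_surjective_image[where q = "a_r_coset (free_space K (carrier M \<times> carrier N))
      (tensor_null K M N)"])
    show "module K (free_space K (carrier M \<times> carrier N))" by (rule free_space_module[OF K])
  qed (rule Q; assumption?)+

qed

lemma tens_bilinear:
  assumes "module K M" and "module K N"
  shows "bilinear K M N (tensor_space K M N) (tens K M N)"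
proof -
  interpret M: module K M by fact
  interpret N: module K N by fact
  have K: "cring K" ..
  let ?S = "carrier M \<times> carrier N"
  let ?F = "free_space K ?S"
  let ?Z = "tensor_null K M N"
  interpret F: module K ?F by (rule free_space_module[OF K])
  note Q = tensor_quotient[OF assms]
  have gen [simp]: "free_gen K ?S (m, n) \<in> carrier ?F" if "m \<in> carrier M" "n \<in> carrier N" for m n
    using that by (intro free_gen_closed[OF K]) auto
  have rel: "r \<in> tensor_relations K M N \<Longrightarrow> r \<in> ?Z" for r
    unfolding tensor_null_def using F.in_own_span[OF tensor_relations_closed[OF assms]] by blast
  have closed: "tens K M N m n \<in> carrier (tensor_space K M N)"
    if "m \<in> carrier M" "n \<in> carrier N" for m n
    unfolding Q(1)[symmetric] tens_def using that by (intro imageI gen)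
  have add_l: "tens K M N (m \<oplus>\<^bsub>M\<^esub> m') n
      = tens K M N m n \<oplus>\<^bsub>tensor_space K M N\<^esub> tens K M N m' n"
    if "m \<in> carrier M" "m' \<in> carrier M" "n \<in> carrier N" for m m' n
    unfolding tens_def Q(2)[OF gen[OF that(1,3)] gen[OF that(2,3)]]
    by (rule Q(7), simp_all add: that)
      (rule rel, unfold tensor_relations_def Let_def, use that in blast)
  have add_r: "tens K M N m (n \<oplus>\<^bsub>N\<^esub> n')
      = tens K M N m n \<oplus>\<^bsub>tensor_space K M N\<^esub> tens K M N m n'"
    if "m \<in> carrier M" "n \<in> carrier N" "n' \<in> carrier N" for m n n'
    unfolding tens_def Q(2)[OF gen[OF that(1,2)] gen[OF that(1,3)]]
    by (rule Q(7), simp_all add: that)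
      (rule rel, unfold tensor_relations_def Let_def, use that in blast)
  have smult_l: "tens K M N (c \<odot>\<^bsub>M\<^esub> m) n = c \<odot>\<^bsub>tensor_space K M N\<^esub> tens K M N m n"
    if "c \<in> carrier K" "m \<in> carrier M" "n \<in> carrier N" for c m n
    unfolding tens_def Q(3)[OF that(1) gen[OF that(2,3)]]
    by (rule Q(7), simp_all add: that)
      (rule rel, unfold tensor_relations_def Let_def, use that in blast)
  have smult_r: "tens K M N m (c \<odot>\<^bsub>N\<^esub> n) = c \<odot>\<^bsub>tensor_space K M N\<^esub> tens K M N m n"
    if "c \<in> carrier K" "m \<in> carrier M" "n \<in> carrier N" for c m n
    unfolding tens_def Q(3)[OF that(1) gen[OF that(2,3)]]
    by (rule Q(7), simp_all add: that)
      (rule rel, unfold tensor_relations_def Let_def, use that in blast)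
  show ?thesis
    by (intro conjI ballI module_homI) (simp_all add: closed add_l add_r smult_l smult_r)
qed

text \<open>A multiple \<open>c (m \<otimes> n) = (cm) \<otimes> n\<close> of a pure tensor is pure, so sums of pure tensors exhaust
  the tensor product and scalar multiples do not form a case of their own.\<close>

lemma tensor_induct [consumes 3, case_names tens add]:
  assumes "module K M" and "module K N" and t: "t \<in> carrier (tensor_space K M N)"
    and tens: "\<And>m n. \<lbrakk>m \<in> carrier M; n \<in> carrier N\<rbrakk> \<Longrightarrow> P (tens K M N m n)"
    and add: "\<And>s t. \<lbrakk>s \<in> carrier (tensor_space K M N); t \<in> carrier (tensor_space K M N); P s; P t\<rbrakk>
      \<Longrightarrow> P (s \<oplus>\<^bsub>tensor_space K M N\<^esub> t)"
  shows "P t"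
proof -
  interpret M: module K M by fact
  interpret N: module K N by fact
  have K: "cring K" ..
  let ?S = "carrier M \<times> carrier N"
  let ?F = "free_space K ?S"
  let ?q = "a_r_coset ?F (tensor_null K M N)"
  interpret F: module K ?F by (rule free_space_module[OF K])
  interpret T: module K "tensor_space K M N" by (rule tensor_space_module[OF assms(1,2)])
  note Q = tensor_quotient[OF assms(1,2)]
  note bil = bilinear_rules[OF tens_bilinear[OF assms(1,2)]]
  have "P (?q u)" if "u \<in> carrier ?F" for u
    using K that
  proof (induction u rule: free_space_induct)
    case zero
    \<comment> \<open>Zero is the pure tensor \<open>0 \<otimes> 0\<close>.\<close>
    have "tens K M N (\<zero>\<^bsub>K\<^esub> \<odot>\<^bsub>M\<^esub> \<zero>\<^bsub>M\<^esub>) \<zero>\<^bsub>N\<^esub>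
        = \<zero>\<^bsub>K\<^esub> \<odot>\<^bsub>tensor_space K M N\<^esub> tens K M N \<zero>\<^bsub>M\<^esub> \<zero>\<^bsub>N\<^esub>"
      by (intro bil) auto
    then have "tens K M N \<zero>\<^bsub>M\<^esub> \<zero>\<^bsub>N\<^esub> = \<zero>\<^bsub>tensor_space K M N\<^esub>"
      by (simp add: bil(1))
    with tens[of "\<zero>\<^bsub>M\<^esub>" "\<zero>\<^bsub>N\<^esub>"] show ?case by (simp add: Q(4))
  next
    case (step c s v)
    obtain m n where s: "s = (m, n)" "m \<in> carrier M" "n \<in> carrier N" using step by auto
    have g: "free_gen K ?S s \<in> carrier ?F" using step by (intro free_gen_closed[OF K])
    have "?q (c \<odot>\<^bsub>?F\<^esub> free_gen K ?S s) = c \<odot>\<^bsub>tensor_space K M N\<^esub> tens K M N m n"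
      using step g s by (simp add: Q(3)[symmetric] tens_def)
    also have "\<dots> = tens K M N (c \<odot>\<^bsub>M\<^esub> m) n"
      using s step by (simp add: bil(4))
    finally have 1: "?q (c \<odot>\<^bsub>?F\<^esub> free_gen K ?S s) = tens K M N (c \<odot>\<^bsub>M\<^esub> m) n" .
    have "?q (c \<odot>\<^bsub>?F\<^esub> free_gen K ?S s \<oplus>\<^bsub>?F\<^esub> v)
        = tens K M N (c \<odot>\<^bsub>M\<^esub> m) n \<oplus>\<^bsub>tensor_space K M N\<^esub> ?q v"
      using g step by (simp add: Q(2)[symmetric] 1)
    moreover have "?q v \<in> carrier (tensor_space K M N)" using step Q(1) by blast
    ultimately show ?case
      using step s tens[of "c \<odot>\<^bsub>M\<^esub> m" n] by (simp add: add bil(1))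
  qed
  with t show ?thesis unfolding Q(1)[symmetric] by blast
qed

lemma tensor_hom_ext:
  assumes "module K M" and "module K N"
    and F: "F \<in> module_hom K (tensor_space K M N) W"
    and G: "G \<in> module_hom K (tensor_space K M N) W"
    and eq: "\<And>m n. \<lbrakk>m \<in> carrier M; n \<in> carrier N\<rbrakk> \<Longrightarrow> F (tens K M N m n) = G (tens K M N m n)"
    and t: "t \<in> carrier (tensor_space K M N)"
  shows "F t = G t"
  using assms(1,2) t
  by (induction t rule: tensor_induct) (use F G in \<open>auto simp: eq module_hom_def\<close>)

text \<open>The linear extension of \<open>f\<close> to the free space kills the bilinearity relations, hence their span,
  and so it is constant on cosets.\<close>

lemma tlift_exists:
  assumes "module K M" and "module K N" and "module K W" and f: "bilinear K M N W f"
  shows "\<exists>F. F \<in> module_hom K (tensor_space K M N) W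
          \<and> F \<in> extensional (carrier (tensor_space K M N))
          \<and> (\<forall>m \<in> carrier M. \<forall>n \<in> carrier N. F (tens K M N m n) = f m n)"
proof -
  interpret M: module K M by fact
  interpret N: module K N by fact
  interpret W: module K W by fact
  have K: "cring K" ..
  let ?S = "carrier M \<times> carrier N"
  let ?F = "free_space K ?S"
  let ?q = "a_r_coset ?F (tensor_null K M N)"
  let ?T = "tensor_space K M N"
  interpret F: module K ?F by (rule free_space_module[OF K])
  interpret T: module K ?T by (rule tensor_space_module[OF assms(1,2)])
  note Q = tensor_quotient[OF assms(1,2)]
  define g where "g = free_extension K ?S W (\<lambda>(m, n). f m n)"
  have f_closed: "(\<lambda>(m, n). f m n) \<in> ?S \<rightarrow> carrier W"
    by (auto simp: bilinear_closed[OF f])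
  have g_hom: "g \<in> module_hom K ?F W"
    unfolding g_def by (rule free_extension_hom[OF assms(3) f_closed])
  interpret g: mod_hom K ?F W g
    by (intro mod_hom.intro mod_hom_axioms.intro) (use g_hom assms(3) F.module_axioms in auto)
  have gen: "free_gen K ?S (m, n) \<in> carrier ?F" if "m \<in> carrier M" "n \<in> carrier N" for m n
    using that by (intro free_gen_closed[OF K]) auto
  have g_gen: "g (free_gen K ?S (m, n)) = f m n" if "m \<in> carrier M" "n \<in> carrier N" for m n
    unfolding g_def using that by (subst free_extension_gen[OF assms(3) f_closed]) auto
  have ker: "u \<ominus>\<^bsub>?F\<^esub> v \<in> g.ker"
    if "u \<in> carrier ?F" "v \<in> carrier ?F" "g u = g v" for u v
    using that by (simp add: g.ker_def)
  note f_eqs = bilinear_rules[OF f]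
  have "tensor_relations K M N \<subseteq> g.ker"
    unfolding tensor_relations_def Let_def
    by (rule subsetI, elim UnE CollectE exE conjE; hypsubst; rule ker)
      (simp_all add: gen g_gen f_eqs)
  then have null: "tensor_null K M N \<subseteq> g.ker"
    unfolding tensor_null_def by (intro F.span_is_subset g.ker_is_submodule)
  \<comment> \<open>The value on a coset is read off at an arbitrary representative.\<close>
  define G where "G = (\<lambda>t \<in> carrier ?T. g (SOME u. u \<in> t))"
  have G_q: "G (?q u) = g u" if u: "u \<in> carrier ?F" for u
  proof -
    define v where "v = (SOME v. v \<in> ?q u)"
    have "\<exists>v. v \<in> ?q u" using Q(6)[OF u] by blast
    then have v: "v \<in> ?q u" unfolding v_def by (rule someI_ex)
    note v' = conjunct1[OF Q(8)[OF u v]] conjunct2[OF Q(8)[OF u v]]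
    have "v \<ominus>\<^bsub>?F\<^esub> u \<in> g.ker" using Q(5)[OF v'(1) u v'(2)] null by blast
    then have "g v \<ominus>\<^bsub>W\<^esub> g u = \<zero>\<^bsub>W\<^esub>"
      using g.f_minus[OF v'(1) u] by (simp add: g.ker_def)
    then have "g v = g u" using W.minus_other_side[OF g.f_im[OF v'(1)] g.f_im[OF u]] by blast
    moreover have "?q u \<in> carrier ?T" using Q(1) u by blast
    ultimately show ?thesis unfolding G_def v_def by simp
  qed
  have "G \<in> module_hom K ?T W"
  proof (rule module_homI)
    fix t assume "t \<in> carrier ?T"
    then obtain u where u: "u \<in> carrier ?F" "t = ?q u" unfolding Q(1)[symmetric] by blast
    show "G t \<in> carrier W" unfolding u(2) G_q[OF u(1)] by (rule g.f_im[OF u(1)])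
    show "G (c \<odot>\<^bsub>?T\<^esub> t) = c \<odot>\<^bsub>W\<^esub> G t" if c: "c \<in> carrier K" for c
      unfolding u(2) Q(3)[OF c u(1)] G_q[OF u(1)] G_q[OF F.smult_closed[OF c u(1)]]
      by (rule g.f_smult[OF c u(1)])
    fix t' assume "t' \<in> carrier ?T"
    then obtain u' where u': "u' \<in> carrier ?F" "t' = ?q u'" unfolding Q(1)[symmetric] by blast
    show "G (t \<oplus>\<^bsub>?T\<^esub> t') = G t \<oplus>\<^bsub>W\<^esub> G t'"
      unfolding u(2) u'(2) Q(2)[OF u(1) u'(1)] G_q[OF u(1)] G_q[OF u'(1)]
        G_q[OF F.M.a_closed[OF u(1) u'(1)]]
      by (rule g.f_add[OF u(1) u'(1)])
  qed
  moreover have "G \<in> extensional (carrier ?T)" unfolding G_def by simp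
  moreover have "G (tens K M N m n) = f m n" if "m \<in> carrier M" "n \<in> carrier N" for m n
    unfolding tens_def G_q[OF gen[OF that]] by (rule g_gen[OF that])
  ultimately show ?thesis by (intro exI[of _ G] conjI ballI)
qed

text \<open>The lift exists and is determined by its values on pure tensors, so the definite
  description that defines it denotes.\<close>

lemma
  assumes "module K M" and "module K N" and "module K W" and "bilinear K M N W f"
  shows tlift_hom: "tlift K M N W f \<in> module_hom K (tensor_space K M N) W"
    and tlift_tens: "\<lbrakk>m \<in> carrier M; n \<in> carrier N\<rbrakk> \<Longrightarrow> tlift K M N W f (tens K M N m n) = f m n"
proof -
  let ?T = "tensor_space K M N"
  define P where "P F \<longleftrightarrow> F \<in> module_hom K ?T W \<and> F \<in> extensional (carrier ?T)
          \<and> (\<forall>m \<in> carrier M. \<forall>n \<in> carrier N. F (tens K M N m n) = f m n)" for F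
  have "\<exists>!F. P F"
  proof (rule ex_ex1I)
    show "\<exists>F. P F" unfolding P_def by (rule tlift_exists[OF assms])
    fix F G assume "P F" and "P G"
    note F = \<open>P F\<close>[unfolded P_def] and G = \<open>P G\<close>[unfolded P_def]
    show "F = G"
    proof (rule extensionalityI[OF conjunct1[OF conjunct2[OF F]] conjunct1[OF conjunct2[OF G]]])
      fix t assume t: "t \<in> carrier ?T"
      show "F t = G t"
        by (rule tensor_hom_ext[OF assms(1,2) conjunct1[OF F] conjunct1[OF G] _ t])
          (simp add: F G)
    qed
  qed
  then have *: "P (tlift K M N W f)" unfolding tlift_def P_def by (rule theI')
  show "tlift K M N W f \<in> module_hom K ?T W"
    by (rule conjunct1[OF *[unfolded P_def]])
  show "\<lbrakk>m \<in> carrier M; n \<in> carrier N\<rbrakk> \<Longrightarrow> tlift K M N W f (tens K M N m n) = f m n"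
    using * unfolding P_def by simp
qed

lemma tlift_cong:
  assumes "\<And>m n. \<lbrakk>m \<in> carrier M; n \<in> carrier N\<rbrakk> \<Longrightarrow> f m n = g m n"
  shows "tlift K M N W f t = tlift K M N W g t"
  unfolding tlift_def using assms by simp

section \<open>Multilinear calculus\<close>

abbreviation trilinear ::
  "('k, 'r) ring_scheme \<Rightarrow> ('k, 'a, 'm) module_scheme \<Rightarrow> ('k, 'b, 'n) module_scheme
    \<Rightarrow> ('k, 'c, 'p) module_scheme \<Rightarrow> ('k, 'w, 'l) module_scheme \<Rightarrow> ('a \<Rightarrow> 'b \<Rightarrow> 'c \<Rightarrow> 'w) \<Rightarrow> bool" where
  "trilinear K L M N W f \<equiv> (\<forall>l \<in> carrier L. \<forall>m \<in> carrier M. (\<lambda>n. f l m n) \<in> module_hom K N W)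
     \<and> (\<forall>l \<in> carrier L. \<forall>n \<in> carrier N. (\<lambda>m. f l m n) \<in> module_hom K M W)
     \<and> (\<forall>m \<in> carrier M. \<forall>n \<in> carrier N. (\<lambda>l. f l m n) \<in> module_hom K L W)"

lemma tensor_record_simps [simp]:
  "carrier (tensor K A B) = carrier (tensor_space K A B)"
  "add (tensor K A B) = add (tensor_space K A B)"
  "smult (tensor K A B) = smult (tensor_space K A B)"
  "zero (tensor K A B) = zero (tensor_space K A B)"
  by (simp_all add: tensor_def)

lemma module_hom_cong:
  assumes "carrier M = carrier M'" "add M = add M'" "smult M = smult M'"
    and "carrier N = carrier N'" "add N = add N'" "smult N = smult N'"
  shows "module_hom K M N = module_hom K M' N'"
  using assms by (simp add: module_hom_def)

lemma tensor_relations_cong: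
  assumes "carrier M = carrier M'" "add M = add M'" "smult M = smult M'"
    and "carrier N = carrier N'" "add N = add N'" "smult N = smult N'"
  shows "tensor_relations K M N = tensor_relations K M' N'"
  using assms by (simp add: tensor_relations_def)

lemma tensor_cong:
  assumes "carrier M = carrier M'" "add M = add M'" "smult M = smult M'"
    and "carrier N = carrier N'" "add N = add N'" "smult N = smult N'"
  shows tensor_space_cong: "tensor_space K M N = tensor_space K M' N'"
    and tens_cong: "tens K M N = tens K M' N'"
  using assms tensor_relations_cong[OF assms, of K]
  by (auto simp: tensor_space_def tens_def tensor_null_def fun_eq_iff)

lemma tlift_space_cong:
  assumes "carrier M = carrier M'" "add M = add M'" "smult M = smult M'"
    and "carrier N = carrier N'" "add N = add N'" "smult N = smult N'"
    and "carrier W = carrier W'" "add W = add W'" "smult W = smult W'"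
  shows "tlift K M N W = tlift K M' N' W'"
  unfolding tlift_def
  by (simp add: tensor_cong[OF assms(1-6)] assms(1,4)
      module_hom_cong[OF refl refl refl assms(7-9), of K "tensor_space K M' N'"])

lemma module_cong:
  assumes "module K M" and "carrier M = carrier M'" "add M = add M'" "smult M = smult M'"
    "zero M = zero M'"
  shows "module K M'"
  by (rule module_surjective_image[OF assms(1), where q = "\<lambda>x. x"]) (simp_all add: assms(2-5)[symmetric])

text \<open>Tensor products, pure tensors and lifts depend on the vector space structure alone. Hence the
  tensor product algebra may be replaced by the tensor product space in all these places; the latter
  is the normal form.\<close>

lemma tensor_norm [simp]:
  "module_hom K M (tensor K A B) = module_hom K M (tensor_space K A B)"
  "module_hom K (tensor K A B) N = module_hom K (tensor_space K A B) N"
  "tensor_space K (tensor K A B) N = tensor_space K (tensor_space K A B) N"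
  "tensor_space K M (tensor K A B) = tensor_space K M (tensor_space K A B)"
  "tens K (tensor K A B) N = tens K (tensor_space K A B) N"
  "tens K M (tensor K A B) = tens K M (tensor_space K A B)"
  "tlift K (tensor K A B) N W = tlift K (tensor_space K A B) N W"
  "tlift K M (tensor K A B) W = tlift K M (tensor_space K A B) W"
  "tlift K M N (tensor K A B) = tlift K M N (tensor_space K A B)"
  by (rule module_hom_cong tensor_space_cong tens_cong tlift_space_cong; simp)+

lemma tensor_module:
  assumes "module K A" and "module K B"
  shows "module K (tensor K A B)"
  by (rule module_cong[OF tensor_space_module[OF assms]]) simp_all

lemma tmap_as_tlift:
  "tmap K M N M' N' g h = tlift K M N (tensor_space K M' N') (\<lambda>m n. tens K M' N' (g m) (h n))"
  by (simp add: tmap_def)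

lemma id_module_hom: "id \<in> module_hom K M M"
  by (simp add: module_hom_def)

lemma hom_closed:
  assumes "f \<in> module_hom K M N" and "m \<in> carrier M"
  shows "f m \<in> carrier N"
  using assms by (auto simp: module_hom_def)

lemma hom_id: "(\<lambda>p. p) \<in> module_hom K P P"
  by (simp add: module_hom_def)

lemma hom_comp:
  assumes "f \<in> module_hom K M N" and "g \<in> module_hom K P M"
  shows "(\<lambda>p. f (g p)) \<in> module_hom K P N"
  by (rule module_homI) (simp_all add: hom_closed[OF assms(1)] hom_closed[OF assms(2)]
      module_hom_add[OF assms(1)] module_hom_add[OF assms(2)]
      module_hom_smult[OF assms(1)] module_hom_smult[OF assms(2)])

lemma bilinear_hom_left:
  assumes "bilinear K M N W f" and "g \<in> module_hom K P M" and "n \<in> carrier N"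
  shows "(\<lambda>p. f (g p) n) \<in> module_hom K P W"
  using hom_comp[of "\<lambda>m. f m n" K M W g P] assms by simp

lemma bilinear_hom_right:
  assumes "bilinear K M N W f" and "m \<in> carrier M" and "g \<in> module_hom K P N"
  shows "(\<lambda>p. f m (g p)) \<in> module_hom K P W"
  using hom_comp[of "f m" K N W g P] assms by simp

lemma bilinear_comp:
  assumes "f \<in> module_hom K W V" and "bilinear K M N W g"
  shows "bilinear K M N V (\<lambda>m n. f (g m n))"
  using assms(2) by (intro conjI ballI hom_comp[OF assms(1)]) auto

lemma tens_closed:
  assumes "module K M" and "module K N" and "m \<in> carrier M" and "n \<in> carrier N"
  shows "tens K M N m n \<in> carrier (tensor_space K M N)"
  by (rule bilinear_closed[OF tens_bilinear[OF assms(1,2)] assms(3,4)])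

lemma hom_tens_left:
  assumes "module K M" and "module K N" and "g \<in> module_hom K P M" and "n \<in> carrier N"
  shows "(\<lambda>p. tens K M N (g p) n) \<in> module_hom K P (tensor_space K M N)"
  by (rule bilinear_hom_left[OF tens_bilinear[OF assms(1,2)] assms(3,4)])

lemma hom_tens_right:
  assumes "module K M" and "module K N" and "m \<in> carrier M" and "g \<in> module_hom K P N"
  shows "(\<lambda>p. tens K M N m (g p)) \<in> module_hom K P (tensor_space K M N)"
  by (rule bilinear_hom_right[OF tens_bilinear[OF assms(1,2)] assms(3,4)])

lemma tlift_closed:
  assumes "module K M" and "module K N" and "module K W" and "bilinear K M N W f"
    and "t \<in> carrier (tensor_space K M N)"
  shows "tlift K M N W f t \<in> carrier W"
  by (rule hom_closed[OF tlift_hom[OF assms(1-4)] assms(5)])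

lemma hom_tlift_arg:
  assumes "module K M" and "module K N" and "module K W" and "bilinear K M N W f"
    and "g \<in> module_hom K P (tensor_space K M N)"
  shows "(\<lambda>p. tlift K M N W f (g p)) \<in> module_hom K P W"
  by (rule hom_comp[OF tlift_hom[OF assms(1-4)] assms(5)])

lemma hom_sum:
  assumes "module K W" and "f \<in> module_hom K P W" and "g \<in> module_hom K P W"
  shows "(\<lambda>p. f p \<oplus>\<^bsub>W\<^esub> g p) \<in> module_hom K P W"
proof -
  interpret W: module K W by fact
  note f = hom_closed[OF assms(2)] module_hom_add[OF assms(2)] module_hom_smult[OF assms(2)]
  note g = hom_closed[OF assms(3)] module_hom_add[OF assms(3)] module_hom_smult[OF assms(3)]
  show ?thesis
    by (rule module_homI) (simp_all add: f g W.smult_r_distr W.M.a_ac)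
qed

lemma hom_finsum:
  assumes "module K W" and "module K P" and "finite B" and "\<And>b. b \<in> B \<Longrightarrow> F b \<in> module_hom K P W"
  shows "(\<lambda>p. \<Oplus>\<^bsub>W\<^esub>b \<in> B. F b p) \<in> module_hom K P W"
proof -
  interpret W: module K W by fact
  show ?thesis
    using assms(3,4)
  proof (induction B rule: finite_induct)
    case empty
    then show ?case by (intro module_homI) simp_all
  next
    case (insert b B)
    have b: "F b \<in> module_hom K P W" and F: "\<And>b'. b' \<in> B \<Longrightarrow> F b' \<in> module_hom K P W"
      using insert.prems by auto
    have hom: "(\<lambda>p. F b p \<oplus>\<^bsub>W\<^esub> (\<Oplus>\<^bsub>W\<^esub>b \<in> B. F b p)) \<in> module_hom K P W"
      by (rule hom_sum[OF assms(1) b insert.IH[OF F]])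
    have eq: "(\<Oplus>\<^bsub>W\<^esub>b \<in> insert b B. F b p) = F b p \<oplus>\<^bsub>W\<^esub> (\<Oplus>\<^bsub>W\<^esub>b \<in> B. F b p)"
      if "p \<in> carrier P" for p
      using insert.hyps hom_closed[OF b that] hom_closed[OF F that]
      by (intro W.finsum_insert) auto
    interpret P: module K P by fact
    show ?case
      using hom_closed[OF hom] module_hom_add[OF hom] module_hom_smult[OF hom]
      by (intro module_homI) (simp_all add: eq)
  qed
qed

text \<open>Both sides are linear in \<open>t\<close> and agree on pure tensors. This is the step that moves a linear map inside a Sweedler sum.\<close>

lemma tlift_apply:
  assumes "module K M" and "module K N" and "module K W" and "module K V"
    and "bilinear K M N W f" and "g \<in> module_hom K W V"
    and "t \<in> carrier (tensor_space K M N)"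
  shows "g (tlift K M N W f t) = tlift K M N V (\<lambda>m n. g (f m n)) t"
proof (rule tensor_hom_ext[OF assms(1,2) _ _ _ assms(7)])
  have b: "bilinear K M N V (\<lambda>m n. g (f m n))" by (rule bilinear_comp[OF assms(6,5)])
  show "(\<lambda>t. g (tlift K M N W f t)) \<in> module_hom K (tensor_space K M N) V"
    by (rule hom_comp[OF assms(6) tlift_hom[OF assms(1-3,5)]])
  show "tlift K M N V (\<lambda>m n. g (f m n)) \<in> module_hom K (tensor_space K M N) V"
    by (rule tlift_hom[OF assms(1,2,4) b])
  show "g (tlift K M N W f (tens K M N m n)) = tlift K M N V (\<lambda>m n. g (f m n)) (tens K M N m n)"
    if "m \<in> carrier M" "n \<in> carrier N" for m n
    by (simp add: tlift_tens[OF assms(1-3,5) that] tlift_tens[OF assms(1,2,4) b that])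
qed

text \<open>Linearity in a parameter of the map that is lifted, for a fixed tensor. The claim is evident for a
  pure tensor and stable under sums.\<close>

lemma hom_tlift:
  assumes "module K M" and "module K N" and "module K W"
    and t: "t \<in> carrier (tensor_space K M N)"
    and P: "module K P"
    and f: "\<And>p. p \<in> carrier P \<Longrightarrow> bilinear K M N W (f p)"
    and p: "\<And>m n. \<lbrakk>m \<in> carrier M; n \<in> carrier N\<rbrakk> \<Longrightarrow> (\<lambda>p. f p m n) \<in> module_hom K P W"
  shows "(\<lambda>p. tlift K M N W (f p) t) \<in> module_hom K P W"
proof -
  interpret W: module K W by fact
  interpret P: module K P by fact
  note hom = tlift_hom[OF assms(1-3)]
  show ?thesis
    using assms(1,2) t
  proof (induction t rule: tensor_induct)
    case (tens m n)
    have "(\<lambda>p. f p m n) \<in> module_hom K P W" by (rule p[OF tens])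
    note p' = hom_closed[OF this] module_hom_add[OF this] module_hom_smult[OF this]
    show ?case
      by (rule module_homI) (simp_all add: tlift_tens[OF assms(1-3) f tens] p')
  next
    case (add s t)
    have eq: "tlift K M N W (f p) (s \<oplus>\<^bsub>tensor_space K M N\<^esub> t)
        = tlift K M N W (f p) s \<oplus>\<^bsub>W\<^esub> tlift K M N W (f p) t" if "p \<in> carrier P" for p
      by (rule module_hom_add[OF hom[OF f[OF that]] add(1,2)])
    have sum: "(\<lambda>p. tlift K M N W (f p) s \<oplus>\<^bsub>W\<^esub> tlift K M N W (f p) t) \<in> module_hom K P W"
      by (rule hom_sum[OF assms(3) add(3,4)])
    show ?case
      using hom_closed[OF sum] module_hom_add[OF sum] module_hom_smult[OF sum]
      by (intro module_homI) (simp_all add: eq)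
  qed
qed

text \<open>These rules reduce the multilinearity of a nested term to that of the operations in it.
  They are syntax directed: for a term in which the variable in question occurs once, the
  position of that variable selects the rule. Later collections add the structure maps of the
  algebras at hand.\<close>

lemmas hom_rules = hom_id hom_tens_left hom_tens_right hom_tlift hom_tlift_arg
  tens_closed tlift_closed tensor_space_module

text \<open>Two Sweedler sums over independent tensors may be interchanged: for a pure tensor \<open>s\<close> there
  is nothing to show, and both sides are linear in \<open>s\<close>.\<close>

lemma tlift_fubini:
  assumes "module K M" and "module K N" and "module K P" and "module K Q" and "module K W"
    and s: "s \<in> carrier (tensor_space K M N)" and t: "t \<in> carrier (tensor_space K P Q)"
    and f1: "\<And>m n. \<lbrakk>m \<in> carrier M; n \<in> carrier N\<rbrakk> \<Longrightarrow> bilinear K P Q W (f m n)"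
    and f2: "\<And>p q. \<lbrakk>p \<in> carrier P; q \<in> carrier Q\<rbrakk> \<Longrightarrow> bilinear K M N W (\<lambda>m n. f m n p q)"
  shows "tlift K M N W (\<lambda>m n. tlift K P Q W (\<lambda>p q. f m n p q) t) s
    = tlift K P Q W (\<lambda>p q. tlift K M N W (\<lambda>m n. f m n p q) s) t"
proof -
  have b1: "bilinear K M N W (\<lambda>m n. tlift K P Q W (\<lambda>p q. f m n p q) t)"
    by (intro conjI ballI hom_rules assms) (use f1 f2 in auto)
  have b2: "bilinear K P Q W (\<lambda>p q. tlift K M N W (\<lambda>m n. f m n p q) s)"
    if "s \<in> carrier (tensor_space K M N)" for s
    by (intro conjI ballI hom_rules assms that) (use f1 f2 in auto)
  show ?thesis
  proof (rule tensor_hom_ext[OF assms(1,2) _ _ _ s])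
    show "tlift K M N W (\<lambda>m n. tlift K P Q W (\<lambda>p q. f m n p q) t)
        \<in> module_hom K (tensor_space K M N) W"
      by (rule tlift_hom[OF assms(1,2,5) b1])
    show "(\<lambda>s. tlift K P Q W (\<lambda>p q. tlift K M N W (\<lambda>m n. f m n p q) s) t)
        \<in> module_hom K (tensor_space K M N) W"
    proof (rule hom_tlift[OF assms(3,4,5) t tensor_space_module[OF assms(1,2)] b2])
      show "tlift K M N W (\<lambda>m n. f m n p q) \<in> module_hom K (tensor_space K M N) W"
        if "p \<in> carrier P" "q \<in> carrier Q" for p q
        by (rule tlift_hom[OF assms(1,2,5) f2[OF that]])
    qed
    show "tlift K M N W (\<lambda>m n. tlift K P Q W (\<lambda>p q. f m n p q) t) (tens K M N m n)
        = tlift K P Q W (\<lambda>p q. tlift K M N W (\<lambda>m n. f m n p q) (tens K M N m n)) t"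
      if "m \<in> carrier M" "n \<in> carrier N" for m n
      by (simp add: tlift_tens[OF assms(1,2,5) b1 that] tlift_tens[OF assms(1,2,5) f2 that]
          cong: tlift_cong)
  qed
qed

lemma
  assumes "module K M" and "module K N" and "module K M'" and "module K N'"
    and "g \<in> module_hom K M M'" and "h \<in> module_hom K N N'"
  shows tmap_hom: "tmap K M N M' N' g h \<in> module_hom K (tensor_space K M N) (tensor_space K M' N')"
    and tmap_tens: "\<lbrakk>m \<in> carrier M; n \<in> carrier N\<rbrakk>
      \<Longrightarrow> tmap K M N M' N' g h (tens K M N m n) = tens K M' N' (g m) (h n)"
    and tlift_tmap: "\<lbrakk>module K W; bilinear K M' N' W f; t \<in> carrier (tensor_space K M N)\<rbrakk>
      \<Longrightarrow> tlift K M' N' W f (tmap K M N M' N' g h t) = tlift K M N W (\<lambda>m n. f (g m) (h n)) t"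
proof -
  have b: "bilinear K M N (tensor_space K M' N') (\<lambda>m n. tens K M' N' (g m) (h n))"
    by (intro conjI ballI hom_rules assms) (auto intro: hom_closed assms)
  note T = tensor_space_module[OF assms(3,4)]
  show "tmap K M N M' N' g h \<in> module_hom K (tensor_space K M N) (tensor_space K M' N')"
    unfolding tmap_def by (simp add: tlift_hom[OF assms(1,2) T b])
  show "\<lbrakk>m \<in> carrier M; n \<in> carrier N\<rbrakk>
      \<Longrightarrow> tmap K M N M' N' g h (tens K M N m n) = tens K M' N' (g m) (h n)"
    unfolding tmap_def by (simp add: tlift_tens[OF assms(1,2) T b])
  assume W: "module K W" and f: "bilinear K M' N' W f" and t: "t \<in> carrier (tensor_space K M N)"
  show "tlift K M' N' W f (tmap K M N M' N' g h t) = tlift K M N W (\<lambda>m n. f (g m) (h n)) t"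
    unfolding tmap_def tensor_norm
    by (subst tlift_apply[OF assms(1,2) T W b tlift_hom[OF assms(3,4) W f] t])
      (intro tlift_cong tlift_tens[OF assms(3,4) W f]; blast intro: hom_closed assms)
qed

text \<open>On pure tensors both sides are values of \<open>f\<close>. This removes the associator from the coassociativity
  axioms.\<close>

lemma tlift_tassoc:
  assumes "module K L" and "module K M" and "module K N" and "module K W"
    and f: "trilinear K L M N W f"
    and s: "s \<in> carrier (tensor_space K (tensor_space K L M) N)"
  shows "tlift K L (tensor_space K M N) W (\<lambda>l u. tlift K M N W (\<lambda>m n. f l m n) u) (tassoc K L M N s)
    = tlift K (tensor_space K L M) N W (\<lambda>u n. tlift K L M W (\<lambda>l m. f l m n) u) s"
proof -
  let ?MN = "tensor_space K M N" and ?LM = "tensor_space K L M"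
  let ?T = "tensor_space K L ?MN"
  note mods = assms(1-4) tensor_space_module
  have MN: "module K ?MN" and LM: "module K ?LM" and T: "module K ?T"
    by (intro mods)+
  have b1: "bilinear K L M ?T (\<lambda>l m. tens K L ?MN l (tens K M N m n))" if "n \<in> carrier N" for n
    by (intro conjI ballI hom_rules mods that) assumption+
  have b2: "bilinear K ?LM N ?T (\<lambda>u n. tlift K L M ?T (\<lambda>l m. tens K L ?MN l (tens K M N m n)) u)"
    by (intro conjI ballI hom_rules mods) assumption+
  have b3: "bilinear K L ?MN W (\<lambda>l u. tlift K M N W (\<lambda>m n. f l m n) u)"
    by (intro conjI ballI hom_rules mods) (use f in auto)
  have "tlift K L ?MN W (\<lambda>l u. tlift K M N W (\<lambda>m n. f l m n) u) (tassoc K L M N s)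
    = tlift K ?LM N W (\<lambda>u n. tlift K L ?MN W (\<lambda>l u. tlift K M N W (\<lambda>m n. f l m n) u)
        (tlift K L M ?T (\<lambda>l m. tens K L ?MN l (tens K M N m n)) u)) s"
    unfolding tassoc_def tensor_norm
    by (rule tlift_apply[OF LM assms(3) T assms(4) b2 tlift_hom[OF assms(1) MN assms(4) b3] s])
  also have "\<dots> = tlift K ?LM N W (\<lambda>u n. tlift K L M W (\<lambda>l m. f l m n) u) s"
  proof (intro tlift_cong)
    fix u n assume u: "u \<in> carrier ?LM" and n: "n \<in> carrier N"
    have "tlift K L ?MN W (\<lambda>l u. tlift K M N W (\<lambda>m n. f l m n) u)
        (tlift K L M ?T (\<lambda>l m. tens K L ?MN l (tens K M N m n)) u)
      = tlift K L M W (\<lambda>l m. tlift K L ?MN W (\<lambda>l u. tlift K M N W (\<lambda>m n. f l m n) u)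
          (tens K L ?MN l (tens K M N m n))) u"
      by (rule tlift_apply[OF assms(1,2) T assms(4) b1[OF n] tlift_hom[OF assms(1) MN assms(4) b3] u])
    also have "\<dots> = tlift K L M W (\<lambda>l m. f l m n) u"
    proof (intro tlift_cong)
      fix l m assume l: "l \<in> carrier L" and m: "m \<in> carrier M"
      have bl: "bilinear K M N W (f l)" using f l by simp
      show "tlift K L ?MN W (\<lambda>l u. tlift K M N W (\<lambda>m n. f l m n) u)
          (tens K L ?MN l (tens K M N m n)) = f l m n"
        by (simp add: tlift_tens[OF assms(1) MN assms(4) b3 l tens_closed[OF assms(2,3) m n]]
            tlift_tens[OF assms(2,3,4) bl m n])
    qed
    finally show "tlift K L ?MN W (\<lambda>l u. tlift K M N W (\<lambda>m n. f l m n) u)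
        (tlift K L M ?T (\<lambda>l m. tens K L ?MN l (tens K M N m n)) u)
      = tlift K L M W (\<lambda>l m. f l m n) u" .
  qed
  finally show ?thesis .
qed

text \<open>Coassociativity in Sweedler form, \<open>f(x\<^sub>[\<^sub>-\<^sub>1\<^sub>], x\<^sub>[\<^sub>0\<^sub>]\<^sub>[\<^sub>-\<^sub>1\<^sub>], x\<^sub>[\<^sub>0\<^sub>]\<^sub>[\<^sub>0\<^sub>]) = f(x\<^sub>[\<^sub>-\<^sub>1\<^sub>]\<^sub>1, x\<^sub>[\<^sub>-\<^sub>1\<^sub>]\<^sub>2, x\<^sub>[\<^sub>0\<^sub>])\<close>, obtained by
  applying the lift of \<open>f\<close> to the coassociativity axiom. The case \<open>X = C\<close> with the coproduct as
  coaction is coassociativity of the coproduct.\<close>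

lemma tlift_coassoc:
  assumes "module K C" and "module K X" and "module K W"
    and comult: "comult C \<in> module_hom K C (tensor_space K C C)"
    and \<delta>: "\<delta> \<in> module_hom K X (tensor_space K C X)"
    and f: "trilinear K C C X W f" and x: "x \<in> carrier X"
    and eq: "tmap K C X C (tensor K C X) id \<delta> (\<delta> x)
      = tassoc K C C X (tmap K C X (tensor K C C) X (comult C) id (\<delta> x))"
  shows "tlift K C X W (\<lambda>c y. tlift K C X W (\<lambda>d z. f c d z) (\<delta> y)) (\<delta> x)
    = tlift K C X W (\<lambda>c y. tlift K C C W (\<lambda>c1 c2. f c1 c2 y) (comult C c)) (\<delta> x)"
proof -
  let ?CC = "tensor_space K C C" and ?CX = "tensor_space K C X"
  have CC: "module K ?CC" and CX: "module K ?CX"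
    by (intro tensor_space_module assms)+
  have id_C: "id \<in> module_hom K C C" and id_X: "id \<in> module_hom K X X"
    by (simp_all add: module_hom_def)
  have \<delta>x: "\<delta> x \<in> carrier ?CX" by (rule hom_closed[OF \<delta> x])
  have b: "bilinear K C ?CX W (\<lambda>c u. tlift K C X W (\<lambda>d z. f c d z) u)"
    by (intro conjI ballI hom_rules assms CX) (use f in auto)
  have b': "bilinear K ?CC X W (\<lambda>u z. tlift K C C W (\<lambda>c d. f c d z) u)"
    by (intro conjI ballI hom_rules assms CC) (use f in auto)
  note eq' = arg_cong[OF eq, of "tlift K C ?CX W (\<lambda>c u. tlift K C X W (\<lambda>d z. f c d z) u)"]
  have tmap_norm: "tmap K C X C (tensor K C X) = tmap K C X C ?CX"
    "tmap K C X (tensor K C C) X = tmap K C X ?CC X"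
    by (simp_all add: tmap_def fun_eq_iff)
  have mem: "tmap K C X ?CC X (comult C) id (\<delta> x) \<in> carrier (tensor_space K ?CC X)"
    by (rule hom_closed[OF tmap_hom[OF assms(1,2) CC assms(2) comult id_X] \<delta>x])
  show ?thesis
    using eq'
    unfolding tmap_norm tlift_tmap[OF assms(1,2,1) CX id_C \<delta> assms(3) b \<delta>x]
      tlift_tassoc[OF assms(1,1,2,3) f mem]
      tlift_tmap[OF assms(1,2) CC assms(2) comult id_X assms(3) b' \<delta>x]
    by simp
qed

section \<open>Sweedler calculus\<close>

lemma self_module_simps [simp]:
  "carrier (self_module K) = carrier K" "mult (self_module K) = mult K"
  "one (self_module K) = one K" "add (self_module K) = add K"
  "zero (self_module K) = zero K" "smult (self_module K) = mult K"
  by (simp_all add: self_module_def)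

lemma self_module_module:
  assumes "cring K"
  shows "module K (self_module K)"
proof -
  interpret cring K by fact
  show ?thesis
    by (rule module_criteria)
      (auto simp: assms a_ac m_ac l_distr r_distr intro!: bexI[where x = "\<ominus>\<^bsub>K\<^esub> _"] r_neg)
qed

lemma smult_bilinear:
  assumes "module K W"
  shows "bilinear K (self_module K) W W (smult W)"
proof -
  interpret module K W by fact
  show ?thesis
    by (intro conjI ballI module_homI)
      (simp_all add: smult_l_distr smult_r_distr smult_assoc1[symmetric] R.m_comm)
qed

lemma hom_smult_left:
  assumes "module K W" and "g \<in> module_hom K P (self_module K)" and "w \<in> carrier W"
  shows "(\<lambda>p. g p \<odot>\<^bsub>W\<^esub> w) \<in> module_hom K P W"
  by (rule bilinear_hom_left[OF smult_bilinear[OF assms(1)] assms(2,3)])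

lemma hom_smult_right:
  assumes "module K W" and "c \<in> carrier K" and "g \<in> module_hom K P W"
  shows "(\<lambda>p. c \<odot>\<^bsub>W\<^esub> g p) \<in> module_hom K P W"
  using bilinear_hom_right[OF smult_bilinear[OF assms(1)] _ assms(3), of c] assms(2) by simp

lemma hom_scalar_mult_left:
  assumes "cring K" and "g \<in> module_hom K P (self_module K)" and "w \<in> carrier K"
  shows "(\<lambda>p. g p \<otimes>\<^bsub>K\<^esub> w) \<in> module_hom K P (self_module K)"
  using hom_smult_left[OF self_module_module[OF assms(1)] assms(2), of w] assms(3) by simp

lemma hom_scalar_mult_right:
  assumes "cring K" and "c \<in> carrier K" and "g \<in> module_hom K P (self_module K)"
  shows "(\<lambda>p. c \<otimes>\<^bsub>K\<^esub> g p) \<in> module_hom K P (self_module K)"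
  using hom_smult_right[OF self_module_module[OF assms(1)] assms(2,3)] by simp

lemma (in k_algebra) algebra_module: "module K A" ..

lemma (in k_algebra) mult_bilinear: "bilinear K A A A (mult A)"
  by (intro conjI ballI module_homI)
    (simp_all add: A.l_distr A.r_distr smult_mult_left smult_mult_right)

lemma (in k_algebra) scalar_cring: "cring K" ..

lemma (in k_algebra) algebra_smult_closed:
  "\<lbrakk>c \<in> carrier K; x \<in> carrier A\<rbrakk> \<Longrightarrow> c \<odot>\<^bsub>A\<^esub> x \<in> carrier A"
  by (rule smult_closed)

lemmas (in k_algebra) algebra_hom_rules =
  bilinear_hom_left[OF mult_bilinear] bilinear_hom_right[OF mult_bilinear]
  hom_smult_left hom_smult_right
  hom_scalar_mult_left[OF scalar_cring] hom_scalar_mult_right[OF scalar_cring]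
  algebra_module self_module_module[OF scalar_cring] A.m_closed algebra_smult_closed A.one_closed

lemma opposite_simps [simp]:
  "carrier (opposite A) = Op ` carrier A"
  "x \<otimes>\<^bsub>opposite A\<^esub> y = Op (unop y \<otimes>\<^bsub>A\<^esub> unop x)"
  "one (opposite A) = Op (one A)" "zero (opposite A) = Op (zero A)"
  "x \<oplus>\<^bsub>opposite A\<^esub> y = Op (unop x \<oplus>\<^bsub>A\<^esub> unop y)"
  "c \<odot>\<^bsub>opposite A\<^esub> x = Op (c \<odot>\<^bsub>A\<^esub> unop x)"
  by (simp_all add: opposite_def)

lemma opposite_hopf_simps [simp]:
  "carrier (opposite_hopf K H) = Op ` carrier H"
  "add (opposite_hopf K H) = add (opposite H)" "zero (opposite_hopf K H) = zero (opposite H)"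
  "smult (opposite_hopf K H) = smult (opposite H)"
  "counit (opposite_hopf K H) x = counit H (unop x)"
  by (simp_all add: opposite_hopf_def module.defs hopf.defs opposite_def)

lemma opposite_module:
  assumes "module K A"
  shows "module K (opposite A)"
  by (rule module_surjective_image[OF assms, where q = Op]) simp_all

lemma opposite_hopf_module:
  assumes "module K H"
  shows "module K (opposite_hopf K H)"
  by (rule module_cong[OF opposite_module[OF assms]]) simp_all

lemma hom_Op:
  assumes "g \<in> module_hom K P A"
  shows "(\<lambda>p. Op (g p)) \<in> module_hom K P (opposite A)"
  by (rule module_homI)
    (simp_all add: hom_closed[OF assms] module_hom_add[OF assms] module_hom_smult[OF assms])

lemma hom_unop:
  assumes "g \<in> module_hom K P (opposite A)"
  shows "(\<lambda>p. unop (g p)) \<in> module_hom K P A"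
proof (rule module_homI)
  show "unop (g p) \<in> carrier A" if "p \<in> carrier P" for p
    using hom_closed[OF assms that] by auto
qed (simp_all add: module_hom_add[OF assms] module_hom_smult[OF assms])

lemma opposite_hopf_hom:
  "module_hom K P (opposite_hopf K H) = module_hom K P (opposite H)"
  by (rule module_hom_cong) simp_all

lemma hom_Op_hopf: "g \<in> module_hom K P H \<Longrightarrow> (\<lambda>p. Op (g p)) \<in> module_hom K P (opposite_hopf K H)"
  unfolding opposite_hopf_hom by (rule hom_Op)

lemma hom_unop_hopf: "g \<in> module_hom K P (opposite_hopf K H) \<Longrightarrow> (\<lambda>p. unop (g p)) \<in> module_hom K P H"
  unfolding opposite_hopf_hom by (rule hom_unop)

lemma opposite_closed:
  "x \<in> carrier A \<Longrightarrow> Op x \<in> carrier (opposite A)"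
  "x \<in> carrier H \<Longrightarrow> Op x \<in> carrier (opposite_hopf K H)"
  "y \<in> carrier (opposite A) \<Longrightarrow> unop y \<in> carrier A"
  "y \<in> carrier (opposite_hopf K H) \<Longrightarrow> unop y \<in> carrier H"
  by auto

lemma opposite_hopf_comult:
  "comult (opposite_hopf K H) x
    = tmap K H H (opposite_hopf K H) (opposite_hopf K H) Op Op (comult H (unop x))"
proof -
  have "tmap K H H (opposite_hopf K H) (opposite_hopf K H) = tmap K H H (opposite H) (opposite H)"
    unfolding tmap_def tensor_norm
    by (simp add: tens_cong[of "opposite_hopf K H" "opposite H" "opposite_hopf K H" "opposite H"]
        tensor_space_cong[of "opposite_hopf K H" "opposite H" "opposite_hopf K H" "opposite H"])
  then show ?thesis
    by (simp add: opposite_hopf_def module.defs hopf.defs)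
qed

context hopf_algebra
begin

lemma comult_module_hom: "comult H \<in> module_hom K H (tensor_space K H H)"
  using comult_hom by (simp add: alg_hom_def)

lemma counit_module_hom: "counit H \<in> module_hom K H (self_module K)"
  using counit_hom by (simp add: alg_hom_def)

lemma comult_closed: "h \<in> carrier H \<Longrightarrow> comult H h \<in> carrier (tensor_space K H H)"
  by (rule hom_closed[OF comult_module_hom])

lemma counit_closed: "h \<in> carrier H \<Longrightarrow> counit H h \<in> carrier K"
  using hom_closed[OF counit_module_hom] by simp

lemma antipode_closed: "h \<in> carrier H \<Longrightarrow> antipode H h \<in> carrier H"
  by (rule hom_closed[OF antipode_linear])

lemmas hopf_hom_rules = hom_rules algebra_hom_rules
  hom_comp[OF comult_module_hom] hom_comp[OF counit_module_hom] hom_comp[OF antipode_linear]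
  comult_closed counit_closed antipode_closed

text \<open>The Sweedler sum \<open>f(h\<^sub>1, h\<^sub>2)\<close>.\<close>

abbreviation sweedler :: "('k, 'w, 'l) module_scheme \<Rightarrow> ('a \<Rightarrow> 'a \<Rightarrow> 'w) \<Rightarrow> 'a \<Rightarrow> 'w" where
  "sweedler W f h \<equiv> tlift K H H W f (comult H h)"

lemma sweedler_coassoc:
  assumes "module K W" and "trilinear K H H H W f" and "h \<in> carrier H"
  shows "sweedler W (\<lambda>a b. sweedler W (\<lambda>b1 b2. f a b1 b2) b) h
    = sweedler W (\<lambda>a b. sweedler W (\<lambda>a1 a2. f a1 a2 b) a) h"
  by (rule tlift_coassoc[OF algebra_module algebra_module assms(1) comult_module_hom
      comult_module_hom assms(2,3) coassoc[OF assms(3), symmetric]])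

lemma sweedler_one:
  assumes "module K W" and "bilinear K H H W f"
  shows "sweedler W f \<one>\<^bsub>H\<^esub> = f \<one>\<^bsub>H\<^esub> \<one>\<^bsub>H\<^esub>"
proof -
  have "comult H \<one>\<^bsub>H\<^esub> = tens K H H \<one>\<^bsub>H\<^esub> \<one>\<^bsub>H\<^esub>"
    using comult_hom by (auto simp: alg_hom_def tensor_def dest: ring_hom_one)
  then show ?thesis
    by (simp add: tlift_tens[OF algebra_module algebra_module assms])
qed

lemma sweedler_mult:
  assumes "module K W" and f: "bilinear K H H W f" and h: "h \<in> carrier H" and g: "g \<in> carrier H"
  shows "sweedler W f (h \<otimes>\<^bsub>H\<^esub> g)
    = sweedler W (\<lambda>a b. sweedler W (\<lambda>a' b'. f (a \<otimes>\<^bsub>H\<^esub> a') (b \<otimes>\<^bsub>H\<^esub> b')) g) h"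
proof -
  let ?T = "tensor_space K H H"
  note rules = hopf_hom_rules assms(1) h g
  have T: "module K ?T" by (intro rules)
  have b1: "bilinear K H H ?T (\<lambda>a' b'. tens K H H (a \<otimes>\<^bsub>H\<^esub> a') (b \<otimes>\<^bsub>H\<^esub> b'))"
    if "a \<in> carrier H" "b \<in> carrier H" for a b
    by (intro conjI ballI rules that)
  have b2: "bilinear K H H ?T (\<lambda>a b. tlift K H H ?T (\<lambda>a' b'. tens K H H (a \<otimes>\<^bsub>H\<^esub> a') (b \<otimes>\<^bsub>H\<^esub> b')) (comult H g))"
    by (intro conjI ballI rules)
  have f_hom: "tlift K H H W f \<in> module_hom K ?T W"
    by (rule tlift_hom[OF algebra_module algebra_module assms(1) f])
  have "comult H (h \<otimes>\<^bsub>H\<^esub> g) = tlift K H H ?T (\<lambda>a b. tlift K H H ?T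
      (\<lambda>a' b'. tens K H H (a \<otimes>\<^bsub>H\<^esub> a') (b \<otimes>\<^bsub>H\<^esub> b')) (comult H g)) (comult H h)"
    using comult_hom ring_hom_mult[of "comult H" H "tensor K H H", OF _ h g]
    unfolding alg_hom_def by (simp add: tensor_def)
  then have "sweedler W f (h \<otimes>\<^bsub>H\<^esub> g) = tlift K H H W f (tlift K H H ?T (\<lambda>a b. tlift K H H ?T
      (\<lambda>a' b'. tens K H H (a \<otimes>\<^bsub>H\<^esub> a') (b \<otimes>\<^bsub>H\<^esub> b')) (comult H g)) (comult H h))"
    by simp
  also have "\<dots> = sweedler W (\<lambda>a b. tlift K H H W f (tlift K H H ?T
      (\<lambda>a' b'. tens K H H (a \<otimes>\<^bsub>H\<^esub> a') (b \<otimes>\<^bsub>H\<^esub> b')) (comult H g))) h"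
    by (rule tlift_apply[OF algebra_module algebra_module T assms(1) b2 f_hom comult_closed[OF h]])
  also have "\<dots> = sweedler W (\<lambda>a b. sweedler W (\<lambda>a' b'. f (a \<otimes>\<^bsub>H\<^esub> a') (b \<otimes>\<^bsub>H\<^esub> b')) g) h"
    by (intro tlift_cong
        tlift_apply[OF algebra_module algebra_module T assms(1) b1 f_hom comult_closed[OF g], THEN trans])
      (assumption | intro tlift_cong tlift_tens[OF algebra_module algebra_module assms(1) f] rules)+
  finally show ?thesis .
qed

lemma sweedler_apply:
  assumes "module K W" and "module K V" and "bilinear K H H W f" and "g \<in> module_hom K W V"
    and "h \<in> carrier H"
  shows "g (sweedler W f h) = sweedler V (\<lambda>a b. g (f a b)) h"
  by (rule tlift_apply[OF algebra_module algebra_module assms(1-4) comult_closed[OF assms(5)]])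

lemma sweedler_counit_left:
  assumes "module K W" and g: "g \<in> module_hom K H W" and "h \<in> carrier H"
  shows "sweedler W (\<lambda>a b. counit H a \<odot>\<^bsub>W\<^esub> g b) h = g h"
proof -
  have b: "bilinear K H H H (\<lambda>a b. counit H a \<odot>\<^bsub>H\<^esub> b)"
    by (intro conjI ballI hopf_hom_rules)
  have "g (sweedler H (\<lambda>a b. counit H a \<odot>\<^bsub>H\<^esub> b) h) = sweedler W (\<lambda>a b. g (counit H a \<odot>\<^bsub>H\<^esub> b)) h"
    by (rule sweedler_apply[OF algebra_module assms(1) b g assms(3)])
  also have "\<dots> = sweedler W (\<lambda>a b. counit H a \<odot>\<^bsub>W\<^esub> g b) h"
    by (intro tlift_cong module_hom_smult[OF g] counit_closed)
  finally show ?thesis by (simp add: counit_left assms(3))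
qed

lemma sweedler_counit_right:
  assumes "module K W" and g: "g \<in> module_hom K H W" and "h \<in> carrier H"
  shows "sweedler W (\<lambda>a b. counit H b \<odot>\<^bsub>W\<^esub> g a) h = g h"
proof -
  have b: "bilinear K H H H (\<lambda>a b. counit H b \<odot>\<^bsub>H\<^esub> a)"
    by (intro conjI ballI hopf_hom_rules)
  have "g (sweedler H (\<lambda>a b. counit H b \<odot>\<^bsub>H\<^esub> a) h) = sweedler W (\<lambda>a b. g (counit H b \<odot>\<^bsub>H\<^esub> a)) h"
    by (rule sweedler_apply[OF algebra_module assms(1) b g assms(3)])
  also have "\<dots> = sweedler W (\<lambda>a b. counit H b \<odot>\<^bsub>W\<^esub> g a) h"
    by (intro tlift_cong module_hom_smult[OF g] counit_closed)
  finally show ?thesis by (simp add: counit_right assms(3))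
qed

lemma sweedler_antipode_left:
  assumes "h \<in> carrier H"
  shows "sweedler H (\<lambda>a b. antipode H a \<otimes>\<^bsub>H\<^esub> b) h = counit H h \<odot>\<^bsub>H\<^esub> \<one>\<^bsub>H\<^esub>"
  using antipode_left[OF assms] unfolding mult_map_def
    tlift_tmap[OF algebra_module algebra_module algebra_module algebra_module antipode_linear id_module_hom
      algebra_module mult_bilinear comult_closed[OF assms]]
  by simp

lemma sweedler_antipode_right:
  assumes "h \<in> carrier H"
  shows "sweedler H (\<lambda>a b. a \<otimes>\<^bsub>H\<^esub> antipode H b) h = counit H h \<odot>\<^bsub>H\<^esub> \<one>\<^bsub>H\<^esub>"
  using antipode_right[OF assms] unfolding mult_map_def
    tlift_tmap[OF algebra_module algebra_module algebra_module algebra_module id_module_hom antipode_linear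
      algebra_module mult_bilinear comult_closed[OF assms]]
  by simp

lemma counit_one: "counit H \<one>\<^bsub>H\<^esub> = \<one>\<^bsub>K\<^esub>"
  using counit_hom by (auto simp: alg_hom_def dest: ring_hom_one)

lemma counit_mult:
  "\<lbrakk>h \<in> carrier H; g \<in> carrier H\<rbrakk> \<Longrightarrow> counit H (h \<otimes>\<^bsub>H\<^esub> g) = counit H h \<otimes>\<^bsub>K\<^esub> counit H g"
  using counit_hom ring_hom_mult[of "counit H" H "self_module K" h g] by (simp add: alg_hom_def)

lemma antipode_one: "antipode H \<one>\<^bsub>H\<^esub> = \<one>\<^bsub>H\<^esub>"
proof -
  have b: "bilinear K H H H (\<lambda>a b. antipode H a \<otimes>\<^bsub>H\<^esub> b)"
    by (intro conjI ballI hopf_hom_rules)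
  have "antipode H \<one>\<^bsub>H\<^esub> \<otimes>\<^bsub>H\<^esub> \<one>\<^bsub>H\<^esub> = counit H \<one>\<^bsub>H\<^esub> \<odot>\<^bsub>H\<^esub> \<one>\<^bsub>H\<^esub>"
    using sweedler_antipode_left[of "\<one>\<^bsub>H\<^esub>"] sweedler_one[OF algebra_module b] by simp
  then show ?thesis
    by (simp add: counit_one antipode_closed smult_one)
qed

text \<open>The element \<open>S(h\<^sub>1 g\<^sub>1) h\<^sub>2 g\<^sub>2 S(g\<^sub>3)\<close> is computed in two ways. Contracting \<open>g\<^sub>2 S(g\<^sub>3)\<close> gives the
  left-hand side; contracting \<open>S((h g\<^sub>1)\<^sub>1) (h g\<^sub>1)\<^sub>2\<close> gives the right-hand side.\<close>

lemma antipode_cancel: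
  assumes h: "h \<in> carrier H" and g: "g \<in> carrier H"
  shows "sweedler H (\<lambda>a b. antipode H (a \<otimes>\<^bsub>H\<^esub> g) \<otimes>\<^bsub>H\<^esub> b) h = counit H h \<odot>\<^bsub>H\<^esub> antipode H g"
proof -
  note rules = hopf_hom_rules h g
  note mods = algebra_module algebra_module
  define f where "f g1 g2 g3 = sweedler H (\<lambda>a b. (antipode H (a \<otimes>\<^bsub>H\<^esub> g1) \<otimes>\<^bsub>H\<^esub> (b \<otimes>\<^bsub>H\<^esub> g2))
    \<otimes>\<^bsub>H\<^esub> antipode H g3) h" for g1 g2 g3
  have f: "trilinear K H H H H f"
    unfolding f_def by (intro conjI ballI rules)
  \<comment> \<open>With \<open>g''\<close> standing for \<open>g\<^sub>2 \<otimes> g\<^sub>3\<close>, the factors \<open>g\<^sub>2 S(g\<^sub>3)\<close> contract.\<close>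
  have "sweedler H (\<lambda>g1 g''. sweedler H (\<lambda>g2 g3. f g1 g2 g3) g'') g
    = sweedler H (\<lambda>g1 g''. counit H g'' \<odot>\<^bsub>H\<^esub> sweedler H (\<lambda>a b. antipode H (a \<otimes>\<^bsub>H\<^esub> g1) \<otimes>\<^bsub>H\<^esub> b) h) g"
  proof (intro tlift_cong)
    fix g1 g'' assume g1: "g1 \<in> carrier H" and g'': "g'' \<in> carrier H"
    have "sweedler H (\<lambda>g2 g3. f g1 g2 g3) g''
      = sweedler H (\<lambda>a b. sweedler H (\<lambda>g2 g3. (antipode H (a \<otimes>\<^bsub>H\<^esub> g1) \<otimes>\<^bsub>H\<^esub> (b \<otimes>\<^bsub>H\<^esub> g2))
          \<otimes>\<^bsub>H\<^esub> antipode H g3) g'') h"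
      unfolding f_def
      by (rule tlift_fubini[OF mods mods algebra_module comult_closed[OF g''] comult_closed[OF h]];
          intro conjI ballI rules g1)
    also have "\<dots> = sweedler H (\<lambda>a b. counit H g'' \<odot>\<^bsub>H\<^esub> (antipode H (a \<otimes>\<^bsub>H\<^esub> g1) \<otimes>\<^bsub>H\<^esub> b)) h"
    proof (intro tlift_cong)
      fix a b assume a: "a \<in> carrier H" and b: "b \<in> carrier H"
      let ?c = "antipode H (a \<otimes>\<^bsub>H\<^esub> g1) \<otimes>\<^bsub>H\<^esub> b"
      have c: "?c \<in> carrier H" by (intro rules a b g1)
      have "sweedler H (\<lambda>g2 g3. (antipode H (a \<otimes>\<^bsub>H\<^esub> g1) \<otimes>\<^bsub>H\<^esub> (b \<otimes>\<^bsub>H\<^esub> g2)) \<otimes>\<^bsub>H\<^esub> antipode H g3) g''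
        = sweedler H (\<lambda>g2 g3. ?c \<otimes>\<^bsub>H\<^esub> (g2 \<otimes>\<^bsub>H\<^esub> antipode H g3)) g''"
        by (intro tlift_cong) (simp add: a b g1 antipode_closed A.m_assoc)
      also have "\<dots> = ?c \<otimes>\<^bsub>H\<^esub> sweedler H (\<lambda>g2 g3. g2 \<otimes>\<^bsub>H\<^esub> antipode H g3) g''"
        by (rule sweedler_apply[symmetric, OF mods _ _ g'']; intro conjI ballI rules c)
      also have "\<dots> = counit H g'' \<odot>\<^bsub>H\<^esub> ?c"
        using c g'' by (simp add: sweedler_antipode_right smult_mult_right counit_closed)
      finally show "sweedler H (\<lambda>g2 g3. (antipode H (a \<otimes>\<^bsub>H\<^esub> g1) \<otimes>\<^bsub>H\<^esub> (b \<otimes>\<^bsub>H\<^esub> g2)) \<otimes>\<^bsub>H\<^esub> antipode H g3) g''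
        = counit H g'' \<odot>\<^bsub>H\<^esub> ?c" .
    qed
    also have "\<dots> = counit H g'' \<odot>\<^bsub>H\<^esub> sweedler H (\<lambda>a b. antipode H (a \<otimes>\<^bsub>H\<^esub> g1) \<otimes>\<^bsub>H\<^esub> b) h"
      by (rule sweedler_apply[symmetric, OF mods _ _ h]; intro conjI ballI rules g1 g'')
    finally show "sweedler H (\<lambda>g2 g3. f g1 g2 g3) g''
      = counit H g'' \<odot>\<^bsub>H\<^esub> sweedler H (\<lambda>a b. antipode H (a \<otimes>\<^bsub>H\<^esub> g1) \<otimes>\<^bsub>H\<^esub> b) h" .
  qed
  also have "\<dots> = sweedler H (\<lambda>a b. antipode H (a \<otimes>\<^bsub>H\<^esub> g) \<otimes>\<^bsub>H\<^esub> b) h"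
    by (rule sweedler_counit_right[OF algebra_module _ g]; intro conjI ballI rules)
  finally have R: "sweedler H (\<lambda>g1 g''. sweedler H (\<lambda>g2 g3. f g1 g2 g3) g'') g
    = sweedler H (\<lambda>a b. antipode H (a \<otimes>\<^bsub>H\<^esub> g) \<otimes>\<^bsub>H\<^esub> b) h" .
  \<comment> \<open>With \<open>g'\<close> standing for \<open>g\<^sub>1 \<otimes> g\<^sub>2\<close>, the coproduct of \<open>h g'\<close> appears.\<close>
  have "sweedler H (\<lambda>g' g3. sweedler H (\<lambda>g1 g2. f g1 g2 g3) g') g
    = sweedler H (\<lambda>g' g3. counit H g' \<odot>\<^bsub>H\<^esub> (counit H h \<odot>\<^bsub>H\<^esub> antipode H g3)) g"
  proof (intro tlift_cong)
    fix g' g3 assume g': "g' \<in> carrier H" and g3: "g3 \<in> carrier H"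
    have "sweedler H (\<lambda>g1 g2. f g1 g2 g3) g'
      = sweedler H (\<lambda>a b. sweedler H (\<lambda>g1 g2. (antipode H (a \<otimes>\<^bsub>H\<^esub> g1) \<otimes>\<^bsub>H\<^esub> (b \<otimes>\<^bsub>H\<^esub> g2))
          \<otimes>\<^bsub>H\<^esub> antipode H g3) g') h"
      unfolding f_def
      by (rule tlift_fubini[OF mods mods algebra_module comult_closed[OF g'] comult_closed[OF h]];
          intro conjI ballI rules g3)
    also have "\<dots> = sweedler H (\<lambda>x y. (antipode H x \<otimes>\<^bsub>H\<^esub> y) \<otimes>\<^bsub>H\<^esub> antipode H g3) (h \<otimes>\<^bsub>H\<^esub> g')"
      by (rule sweedler_mult[symmetric, OF algebra_module _ h g']; intro conjI ballI rules g3)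
    also have "\<dots> = sweedler H (\<lambda>x y. antipode H x \<otimes>\<^bsub>H\<^esub> y) (h \<otimes>\<^bsub>H\<^esub> g') \<otimes>\<^bsub>H\<^esub> antipode H g3"
      by (rule sweedler_apply[symmetric, OF mods, where g = "\<lambda>z. z \<otimes>\<^bsub>H\<^esub> antipode H g3"];
          intro conjI ballI rules g3 g')
    also have "\<dots> = (counit H g' \<otimes>\<^bsub>K\<^esub> counit H h) \<odot>\<^bsub>H\<^esub> antipode H g3"
      using h g' g3 by (simp add: sweedler_antipode_left counit_mult smult_mult_left counit_closed
          antipode_closed R.m_comm)
    also have "\<dots> = counit H g' \<odot>\<^bsub>H\<^esub> (counit H h \<odot>\<^bsub>H\<^esub> antipode H g3)"
      using h g' g3 by (simp add: smult_assoc1 counit_closed antipode_closed)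
    finally show "sweedler H (\<lambda>g1 g2. f g1 g2 g3) g'
      = counit H g' \<odot>\<^bsub>H\<^esub> (counit H h \<odot>\<^bsub>H\<^esub> antipode H g3)" .
  qed
  also have "\<dots> = counit H h \<odot>\<^bsub>H\<^esub> antipode H g"
    by (rule sweedler_counit_left[OF algebra_module _ g]; intro conjI ballI rules)
  finally have L: "sweedler H (\<lambda>g' g3. sweedler H (\<lambda>g1 g2. f g1 g2 g3) g') g
    = counit H h \<odot>\<^bsub>H\<^esub> antipode H g" .
  show ?thesis
    using sweedler_coassoc[OF algebra_module f g] L R by simp
qed

section \<open>The dual Hopf algebra\<close>

abbreviation Hd :: "('k, 'a \<Rightarrow> 'k) hopf" where "Hd \<equiv> dual_hopf K H"
abbreviation KK :: "('k, 'k) module" where "KK \<equiv> self_module K"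

lemma dual_hopf_simps:
  "carrier Hd = module_hom K H KK \<inter> extensional (carrier H)"
  "\<theta> \<oplus>\<^bsub>Hd\<^esub> \<theta>' = (\<lambda>h \<in> carrier H. \<theta> h \<oplus>\<^bsub>K\<^esub> \<theta>' h)"
  "c \<odot>\<^bsub>Hd\<^esub> \<theta> = (\<lambda>h \<in> carrier H. c \<otimes>\<^bsub>K\<^esub> \<theta> h)"
  "\<zero>\<^bsub>Hd\<^esub> = (\<lambda>h \<in> carrier H. \<zero>\<^bsub>K\<^esub>)"
  "\<theta> \<otimes>\<^bsub>Hd\<^esub> \<theta>' = (\<lambda>h \<in> carrier H. sweedler KK (\<lambda>a b. pairing a \<theta> \<otimes>\<^bsub>K\<^esub> pairing b \<theta>') h)"
  "\<one>\<^bsub>Hd\<^esub> = restrict (counit H) (carrier H)"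
  "comult Hd = dual_comult K H"
  "counit Hd \<theta> = pairing \<one>\<^bsub>H\<^esub> \<theta>"
  "antipode Hd \<theta> = (\<lambda>h \<in> carrier H. pairing (antipode H h) \<theta>)"
  by (simp_all add: dual_hopf_def dual_alg_def module.defs hopf.defs R.func_space_def)

text \<open>Members of the dual are extensional, so a linear functional has to be restricted.\<close>

lemma functional_in_dual:
  assumes "f \<in> module_hom K H KK"
  shows "restrict f (carrier H) \<in> carrier Hd"
  unfolding dual_hopf_simps
  by (intro IntI module_homI) (simp_all add: hom_closed[OF assms, simplified]
      module_hom_add[OF assms] module_hom_smult[OF assms] algebra_smult_closed)

lemma pairing_hom_left: "\<theta> \<in> carrier Hd \<Longrightarrow> (\<lambda>h. pairing h \<theta>) \<in> module_hom K H KK"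
  unfolding dual_hopf_simps pairing_def by simp

lemma pairing_hom_right: "h \<in> carrier H \<Longrightarrow> (\<lambda>\<theta>. pairing h \<theta>) \<in> module_hom K Hd KK"
  unfolding pairing_def
  by (intro module_homI) (auto simp: dual_hopf_simps dest: hom_closed)

lemma pairing_bilinear: "bilinear K H Hd KK pairing"
  by (intro conjI ballI pairing_hom_left pairing_hom_right)

lemma pairing_closed: "\<lbrakk>h \<in> carrier H; \<theta> \<in> carrier Hd\<rbrakk> \<Longrightarrow> pairing h \<theta> \<in> carrier K"
  using hom_closed[OF pairing_hom_left] by simp

lemma dual_ext:
  assumes "\<theta> \<in> carrier Hd" and "\<theta>' \<in> carrier Hd"
    and "\<And>h. h \<in> carrier H \<Longrightarrow> pairing h \<theta> = pairing h \<theta>'"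
  shows "\<theta> = \<theta>'"
  by (rule extensionalityI[where A = "carrier H"])
    (use assms in \<open>auto simp: dual_hopf_simps pairing_def\<close>)

lemma dual_module: "module K Hd"
proof -
  interpret F: module K "R.func_space (carrier H)" by (rule R.func_space_is_module)
  have "submodule K (carrier Hd) (R.func_space (carrier H))"
  proof (rule submodule.intro)
    show "module K (R.func_space (carrier H))" ..
    show "carrier Hd \<subseteq> carrier (R.func_space (carrier H))"
      by (auto simp: dual_hopf_simps R.func_space_def PiE_def module_hom_def)
    show "\<zero>\<^bsub>R.func_space (carrier H)\<^esub> \<in> carrier Hd"
      using functional_in_dual[of "\<lambda>h. \<zero>\<^bsub>K\<^esub>"] by (simp add: R.func_space_def module_hom_def)
  next
    fix v w assume "v \<in> carrier Hd" "w \<in> carrier Hd"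
    then have "v \<in> module_hom K H KK" "w \<in> module_hom K H KK" by (simp_all add: dual_hopf_simps)
    from functional_in_dual[OF hom_sum[OF self_module_module[OF scalar_cring] this]]
    show "v \<oplus>\<^bsub>R.func_space (carrier H)\<^esub> w \<in> carrier Hd" by (simp add: R.func_space_def)
  next
    fix c v assume c: "c \<in> carrier K" and "v \<in> carrier Hd"
    then have "v \<in> module_hom K H KK" by (simp add: dual_hopf_simps)
    from functional_in_dual[OF hom_scalar_mult_right[OF scalar_cring c this]]
    show "c \<odot>\<^bsub>R.func_space (carrier H)\<^esub> v \<in> carrier Hd" by (simp add: R.func_space_def)
  qed
  note m = F.submodule_is_module[OF this]
  show ?thesis
    by (rule module_cong[OF m]) (simp_all add: dual_hopf_simps R.func_space_def fun_eq_iff)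
qed

text \<open>Functionals agree if their values do, so linearity of a map into the dual can be checked
  after pairing with each \<open>h\<close>.\<close>

lemma hom_dualI:
  assumes P: "module K P" and F: "\<And>p. p \<in> carrier P \<Longrightarrow> F p \<in> carrier Hd"
    and hom: "\<And>h. h \<in> carrier H \<Longrightarrow> (\<lambda>p. pairing h (F p)) \<in> module_hom K P KK"
  shows "F \<in> module_hom K P Hd"
proof -
  interpret P: module K P by fact
  interpret D: module K Hd by (rule dual_module)
  show ?thesis
  proof (rule module_homI)
    show "F (p \<oplus>\<^bsub>P\<^esub> p') = F p \<oplus>\<^bsub>Hd\<^esub> F p'" if "p \<in> carrier P" "p' \<in> carrier P" for p p'
      by (rule dual_ext) (simp_all add: that F module_hom_add[OF hom] module_hom_add[OF pairing_hom_right])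
    show "F (c \<odot>\<^bsub>P\<^esub> p) = c \<odot>\<^bsub>Hd\<^esub> F p" if "c \<in> carrier K" "p \<in> carrier P" for c p
      by (rule dual_ext) (simp_all add: that F module_hom_smult[OF hom] module_hom_smult[OF pairing_hom_right])
  qed (rule F)
qed

lemmas dual_hom_rules = hopf_hom_rules dual_module pairing_closed
  bilinear_hom_left[OF pairing_bilinear] bilinear_hom_right[OF pairing_bilinear]

lemma scalar_module: "module K KK"
  by (rule self_module_module[OF scalar_cring])

lemma dual_mult_closed:
  assumes "\<theta> \<in> carrier Hd" and "\<theta>' \<in> carrier Hd"
  shows "\<theta> \<otimes>\<^bsub>Hd\<^esub> \<theta>' \<in> carrier Hd"
  unfolding dual_hopf_simps(5)
  by (rule functional_in_dual; intro conjI ballI dual_hom_rules assms)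

lemma pairing_dual_mult:
  "h \<in> carrier H \<Longrightarrow> pairing h (\<theta> \<otimes>\<^bsub>Hd\<^esub> \<theta>') = sweedler KK (\<lambda>a b. pairing a \<theta> \<otimes>\<^bsub>K\<^esub> pairing b \<theta>') h"
  by (simp add: dual_hopf_simps pairing_def)

lemma dual_mult_bilinear: "bilinear K Hd Hd Hd (mult Hd)"
  by (intro conjI ballI hom_dualI dual_module dual_mult_closed; (assumption | simp only: pairing_dual_mult))
    (intro conjI ballI dual_hom_rules; assumption)+

lemma dual_one_closed: "\<one>\<^bsub>Hd\<^esub> \<in> carrier Hd"
  unfolding dual_hopf_simps(6) by (rule functional_in_dual[OF counit_module_hom])

lemma pairing_dual_one: "h \<in> carrier H \<Longrightarrow> pairing h \<one>\<^bsub>Hd\<^esub> = counit H h"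
  by (simp add: dual_hopf_simps pairing_def)

lemma dual_mult_one:
  assumes "\<theta> \<in> carrier Hd"
  shows "\<theta> \<otimes>\<^bsub>Hd\<^esub> \<one>\<^bsub>Hd\<^esub> = \<theta>" and "\<one>\<^bsub>Hd\<^esub> \<otimes>\<^bsub>Hd\<^esub> \<theta> = \<theta>"
proof -
  show "\<theta> \<otimes>\<^bsub>Hd\<^esub> \<one>\<^bsub>Hd\<^esub> = \<theta>"
  proof (rule dual_ext[OF dual_mult_closed[OF assms dual_one_closed] assms])
    fix h assume h: "h \<in> carrier H"
    have "sweedler KK (\<lambda>a b. pairing a \<theta> \<otimes>\<^bsub>K\<^esub> pairing b \<one>\<^bsub>Hd\<^esub>) h
      = sweedler KK (\<lambda>a b. counit H b \<odot>\<^bsub>KK\<^esub> pairing a \<theta>) h"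
      by (intro tlift_cong)
        (simp add: pairing_dual_one R.m_comm counit_closed pairing_closed assms)
    then show "pairing h (\<theta> \<otimes>\<^bsub>Hd\<^esub> \<one>\<^bsub>Hd\<^esub>) = pairing h \<theta>"
      by (simp only: pairing_dual_mult[OF h]
          sweedler_counit_right[OF scalar_module pairing_hom_left[OF assms] h])
  qed
  show "\<one>\<^bsub>Hd\<^esub> \<otimes>\<^bsub>Hd\<^esub> \<theta> = \<theta>"
  proof (rule dual_ext[OF dual_mult_closed[OF dual_one_closed assms] assms])
    fix h assume h: "h \<in> carrier H"
    have "sweedler KK (\<lambda>a b. pairing a \<one>\<^bsub>Hd\<^esub> \<otimes>\<^bsub>K\<^esub> pairing b \<theta>) h
      = sweedler KK (\<lambda>a b. counit H a \<odot>\<^bsub>KK\<^esub> pairing b \<theta>) h"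
      by (intro tlift_cong) (simp add: pairing_dual_one)
    then show "pairing h (\<one>\<^bsub>Hd\<^esub> \<otimes>\<^bsub>Hd\<^esub> \<theta>) = pairing h \<theta>"
      by (simp only: pairing_dual_mult[OF h]
          sweedler_counit_left[OF scalar_module pairing_hom_left[OF assms] h])
  qed
qed

lemma dual_antipode_closed:
  assumes "\<theta> \<in> carrier Hd"
  shows "antipode Hd \<theta> \<in> carrier Hd"
  unfolding dual_hopf_simps(9) by (rule functional_in_dual; intro dual_hom_rules assms)

lemma pairing_dual_antipode:
  "h \<in> carrier H \<Longrightarrow> pairing h (antipode Hd \<theta>) = pairing (antipode H h) \<theta>"
  by (simp add: dual_hopf_simps pairing_def)

lemma dual_antipode_hom: "antipode Hd \<in> module_hom K Hd Hd"
  by (rule hom_dualI[OF dual_module dual_antipode_closed])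
    (simp_all add: pairing_dual_antipode pairing_hom_right antipode_closed)

end

lemma hom_finsum_apply:
  assumes "module K M" and "module K N" and g: "g \<in> module_hom K M N"
    and "finite B" and "\<And>b. b \<in> B \<Longrightarrow> f b \<in> carrier M"
  shows "g (\<Oplus>\<^bsub>M\<^esub>b \<in> B. f b) = (\<Oplus>\<^bsub>N\<^esub>b \<in> B. g (f b))"
proof -
  interpret M: module K M by fact
  interpret N: module K N by fact
  have "g (\<zero>\<^bsub>K\<^esub> \<odot>\<^bsub>M\<^esub> \<zero>\<^bsub>M\<^esub>) = \<zero>\<^bsub>K\<^esub> \<odot>\<^bsub>N\<^esub> g \<zero>\<^bsub>M\<^esub>"
    by (rule module_hom_smult[OF g]) simp_all
  then have zero: "g \<zero>\<^bsub>M\<^esub> = \<zero>\<^bsub>N\<^esub>" using hom_closed[OF g, of "\<zero>\<^bsub>M\<^esub>"] by simp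
  show ?thesis
    using assms(4,5)
  proof (induction B rule: finite_induct)
    case empty
    then show ?case by (simp add: zero)
  next
    case (insert b B)
    have b: "f b \<in> carrier M" and B: "f \<in> B \<rightarrow> carrier M" using insert.prems by auto
    have gB: "(\<lambda>b. g (f b)) \<in> B \<rightarrow> carrier N" using B hom_closed[OF g] by auto
    have "(\<Oplus>\<^bsub>M\<^esub>b \<in> insert b B. f b) = f b \<oplus>\<^bsub>M\<^esub> (\<Oplus>\<^bsub>M\<^esub>b \<in> B. f b)"
      by (rule M.finsum_insert[OF insert.hyps B b])
    moreover have "(\<Oplus>\<^bsub>N\<^esub>b \<in> insert b B. g (f b)) = g (f b) \<oplus>\<^bsub>N\<^esub> (\<Oplus>\<^bsub>N\<^esub>b \<in> B. g (f b))"
      by (rule N.finsum_insert[OF insert.hyps gB hom_closed[OF g b]])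
    moreover have "g (\<Oplus>\<^bsub>M\<^esub>b \<in> B. f b) = (\<Oplus>\<^bsub>N\<^esub>b \<in> B. g (f b))"
      using insert by simp
    ultimately show ?case
      using module_hom_add[OF g b M.finsum_closed[OF B]] by simp
  qed
qed

locale findim_hopf_algebra = hopf_algebra K H
  for K :: "('k, 'r) ring_scheme" (structure) and H :: "('k, 'a) hopf" +
  assumes findim: "vectorspace.fin_dim K H"
begin

text \<open>The functionals are the coordinates with respect to a finite basis; they are linear because
  coordinates are unique.\<close>

lemma dual_basis_exists:
  obtains B \<phi> where "finite B" and "B \<subseteq> carrier H"
    and "\<And>b. b \<in> B \<Longrightarrow> \<phi> b \<in> carrier Hd"
    and "\<And>h. h \<in> carrier H \<Longrightarrow> h = (\<Oplus>\<^bsub>H\<^esub>b \<in> B. pairing h (\<phi> b) \<odot>\<^bsub>H\<^esub> b)"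
proof -
  obtain B where B: "finite B" "basis B" using finite_basis_exists[OF findim] by blast
  have sub: "B \<subseteq> carrier H" using B(2) by (simp add: basis_def)
  have ex: "\<exists>!a. a \<in> B \<rightarrow>\<^sub>E carrier K \<and> lincomb a B = h" if "h \<in> carrier H" for h
    using basis_criterion[OF B(1) sub] B(2) that by blast
  define coord where "coord h = (THE a. a \<in> B \<rightarrow>\<^sub>E carrier K \<and> lincomb a B = h)" for h
  have coord: "coord h \<in> B \<rightarrow>\<^sub>E carrier K" "lincomb (coord h) B = h" if "h \<in> carrier H" for h
    using theI'[OF ex[OF that]] by (simp_all add: coord_def)
  have unique: "coord h = a" if "a \<in> B \<rightarrow>\<^sub>E carrier K" "lincomb a B = h" "h \<in> carrier H" for a h
    unfolding coord_def by (rule the1_equality[OF ex[OF that(3)]]) (simp add: that)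
  interpret L: mod_hom K "R.func_space B" H "\<lambda>a. lincomb a B"
    by (rule lincomb_is_mod_hom[OF B(1) sub])
  have fc: "carrier (R.func_space B) = B \<rightarrow>\<^sub>E carrier K" by (simp add: R.func_space_def)
  have add: "coord (h \<oplus>\<^bsub>H\<^esub> h') = coord h \<oplus>\<^bsub>R.func_space B\<^esub> coord h'"
    if "h \<in> carrier H" "h' \<in> carrier H" for h h'
  proof (rule unique)
    have c: "coord h \<in> carrier (R.func_space B)" "coord h' \<in> carrier (R.func_space B)"
      using coord(1) that by (simp_all add: fc)
    show "coord h \<oplus>\<^bsub>R.func_space B\<^esub> coord h' \<in> B \<rightarrow>\<^sub>E carrier K"
      using L.M.a_closed[OF c] by (simp only: fc)
    show "lincomb (coord h \<oplus>\<^bsub>R.func_space B\<^esub> coord h') B = h \<oplus>\<^bsub>H\<^esub> h'"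
      using L.f_add[OF c] coord(2) that by simp
    show "h \<oplus>\<^bsub>H\<^esub> h' \<in> carrier H" using that by simp
  qed
  have smult: "coord (c \<odot>\<^bsub>H\<^esub> h) = c \<odot>\<^bsub>R.func_space B\<^esub> coord h"
    if "c \<in> carrier K" "h \<in> carrier H" for c h
  proof (rule unique)
    have ch: "coord h \<in> carrier (R.func_space B)"
      using coord(1) that by (simp add: fc)
    show "c \<odot>\<^bsub>R.func_space B\<^esub> coord h \<in> B \<rightarrow>\<^sub>E carrier K"
      using L.M.smult_closed[OF that(1) ch] by (simp only: fc)
    show "lincomb (c \<odot>\<^bsub>R.func_space B\<^esub> coord h) B = c \<odot>\<^bsub>H\<^esub> h"
      using L.f_smult[OF that(1) ch] coord(2) that by simp
    show "c \<odot>\<^bsub>H\<^esub> h \<in> carrier H" using that by (rule algebra_smult_closed)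
  qed
  have "(\<lambda>h. coord h b) \<in> module_hom K H KK" if "b \<in> B" for b
    using that coord(1)
    by (intro module_homI) (auto simp: add smult R.func_space_def)
  note dual = functional_in_dual[OF this]
  show ?thesis
  proof (rule that[of B "\<lambda>b. restrict (\<lambda>h. coord h b) (carrier H)", OF B(1) sub dual])
    fix h assume h: "h \<in> carrier H"
    have "h = lincomb (coord h) B" by (rule coord(2)[OF h, symmetric])
    also have "\<dots> = (\<Oplus>\<^bsub>H\<^esub>b \<in> B. pairing h (restrict (\<lambda>h. coord h b) (carrier H)) \<odot>\<^bsub>H\<^esub> b)"
      using h by (simp add: lincomb_def pairing_def)
    finally show "h = (\<Oplus>\<^bsub>H\<^esub>b \<in> B. pairing h (restrict (\<lambda>h. coord h b) (carrier H)) \<odot>\<^bsub>H\<^esub> b)" .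
  qed
qed

lemma dual_basis_expansion:
  obtains B \<phi> where "finite B" and "B \<subseteq> carrier H"
    and "\<And>b. b \<in> B \<Longrightarrow> \<phi> b \<in> carrier Hd"
    and "\<And>h \<theta>. \<lbrakk>h \<in> carrier H; \<theta> \<in> carrier Hd\<rbrakk>
      \<Longrightarrow> pairing h \<theta> = (\<Oplus>\<^bsub>KK\<^esub>b \<in> B. pairing h (\<phi> b) \<odot>\<^bsub>KK\<^esub> pairing b \<theta>)"
    and "\<And>\<theta>. \<theta> \<in> carrier Hd \<Longrightarrow> \<theta> = (\<Oplus>\<^bsub>Hd\<^esub>b \<in> B. pairing b \<theta> \<odot>\<^bsub>Hd\<^esub> \<phi> b)"
proof -
  obtain B \<phi> where B: "finite B" "B \<subseteq> carrier H" and \<phi>: "\<And>b. b \<in> B \<Longrightarrow> \<phi> b \<in> carrier Hd"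
    and ex: "\<And>h. h \<in> carrier H \<Longrightarrow> h = (\<Oplus>\<^bsub>H\<^esub>b \<in> B. pairing h (\<phi> b) \<odot>\<^bsub>H\<^esub> b)"
    by (rule dual_basis_exists) (rule that)
  interpret D: module K Hd by (rule dual_module)
  interpret S: module K KK by (rule scalar_module)
  have p: "pairing h \<theta> = (\<Oplus>\<^bsub>KK\<^esub>b \<in> B. pairing h (\<phi> b) \<odot>\<^bsub>KK\<^esub> pairing b \<theta>)"
    if h: "h \<in> carrier H" and \<theta>: "\<theta> \<in> carrier Hd" for h \<theta>
  proof -
    have "pairing h \<theta> = pairing (\<Oplus>\<^bsub>H\<^esub>b \<in> B. pairing h (\<phi> b) \<odot>\<^bsub>H\<^esub> b) \<theta>"
      by (rule arg_cong[where f = "\<lambda>h. pairing h \<theta>", OF ex[OF h]])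
    also have "\<dots> = (\<Oplus>\<^bsub>KK\<^esub>b \<in> B. pairing (pairing h (\<phi> b) \<odot>\<^bsub>H\<^esub> b) \<theta>)"
      by (rule hom_finsum_apply[OF algebra_module scalar_module pairing_hom_left[OF \<theta>] B(1)])
        (use B \<phi> h in \<open>auto intro: algebra_smult_closed pairing_closed\<close>)
    also have "\<dots> = (\<Oplus>\<^bsub>KK\<^esub>b \<in> B. pairing h (\<phi> b) \<odot>\<^bsub>KK\<^esub> pairing b \<theta>)"
      by (rule S.finsum_cong', rule refl)
        (use B \<phi> h \<theta> in \<open>auto simp: module_hom_smult[OF pairing_hom_left[OF \<theta>]] pairing_closed subset_iff\<close>)
    finally show ?thesis .
  qed
  show ?thesis
  proof (rule that[OF B \<phi> p])
    fix \<theta> assume \<theta>: "\<theta> \<in> carrier Hd"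
    have mem: "pairing b \<theta> \<odot>\<^bsub>Hd\<^esub> \<phi> b \<in> carrier Hd" if "b \<in> B" for b
      using that B \<phi> \<theta> by (auto intro: pairing_closed)
    show "\<theta> = (\<Oplus>\<^bsub>Hd\<^esub>b \<in> B. pairing b \<theta> \<odot>\<^bsub>Hd\<^esub> \<phi> b)"
    proof (rule dual_ext[OF \<theta>])
      show "(\<Oplus>\<^bsub>Hd\<^esub>b \<in> B. pairing b \<theta> \<odot>\<^bsub>Hd\<^esub> \<phi> b) \<in> carrier Hd"
        using mem by (intro D.finsum_closed) auto
      fix h assume h: "h \<in> carrier H"
      have "pairing h (\<Oplus>\<^bsub>Hd\<^esub>b \<in> B. pairing b \<theta> \<odot>\<^bsub>Hd\<^esub> \<phi> b)
        = (\<Oplus>\<^bsub>KK\<^esub>b \<in> B. pairing h (pairing b \<theta> \<odot>\<^bsub>Hd\<^esub> \<phi> b))"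
        by (rule hom_finsum_apply[OF dual_module scalar_module pairing_hom_right[OF h] B(1) mem])
      also have "\<dots> = (\<Oplus>\<^bsub>KK\<^esub>b \<in> B. pairing h (\<phi> b) \<odot>\<^bsub>KK\<^esub> pairing b \<theta>)"
        by (rule S.finsum_cong', rule refl)
          (use B \<phi> h \<theta> in \<open>auto simp: module_hom_smult[OF pairing_hom_right[OF h]] pairing_closed
            subset_iff R.m_comm\<close>)
      finally show "pairing h \<theta> = pairing h (\<Oplus>\<^bsub>Hd\<^esub>b \<in> B. pairing b \<theta> \<odot>\<^bsub>Hd\<^esub> \<phi> b)"
        by (rule trans[OF p[OF h \<theta>] sym])
    qed
  qed
qed

abbreviation eval_first :: "('k, 'w, 'l) module_scheme \<Rightarrow> 'a \<Rightarrow> (('a \<Rightarrow> 'k) \<times> 'w \<Rightarrow> 'k) set \<Rightarrow> 'w" where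
  "eval_first W h \<equiv> tlift K Hd W W (\<lambda>\<theta> w. pairing h \<theta> \<odot>\<^bsub>W\<^esub> w)"

abbreviation pairing2 :: "'a \<Rightarrow> 'a \<Rightarrow> (('a \<Rightarrow> 'k) \<times> ('a \<Rightarrow> 'k) \<Rightarrow> 'k) set \<Rightarrow> 'k" where
  "pairing2 h h' \<equiv> tlift K Hd Hd KK (\<lambda>\<phi> \<psi>. pairing h \<phi> \<otimes>\<^bsub>K\<^esub> pairing h' \<psi>)"

text \<open>Dual bases recover a tensor from its evaluations: \<open>t = \<Sum>\<^sub>b \<phi>\<^sub>b \<otimes> t(b)\<close>, where \<open>t(b)\<close> results from
  evaluating the first leg at \<open>b\<close>.\<close>

lemma dual_tensor_separation:
  assumes W: "module K W" and t: "t \<in> carrier (tensor_space K Hd W)"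
    and t': "t' \<in> carrier (tensor_space K Hd W)"
    and eq: "\<And>h. h \<in> carrier H \<Longrightarrow>
      eval_first W h t = eval_first W h t'"
  shows "t = t'"
proof -
  obtain B \<phi> where B: "finite B" "B \<subseteq> carrier H" and \<phi>: "\<And>b. b \<in> B \<Longrightarrow> \<phi> b \<in> carrier Hd"
    and ex: "\<And>\<theta>. \<theta> \<in> carrier Hd \<Longrightarrow> \<theta> = (\<Oplus>\<^bsub>Hd\<^esub>b \<in> B. pairing b \<theta> \<odot>\<^bsub>Hd\<^esub> \<phi> b)"
    by (rule dual_basis_expansion) (rule that)
  let ?T = "tensor_space K Hd W"
  have T: "module K ?T" by (rule tensor_space_module[OF dual_module W])
  interpret W: module K W by (rule W)
  interpret D: module K Hd by (rule dual_module)
  interpret T: module K ?T by (rule T)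
  have bH: "b \<in> carrier H" if "b \<in> B" for b using that B by auto
  have bil: "bilinear K Hd W W (\<lambda>\<theta> w. pairing h \<theta> \<odot>\<^bsub>W\<^esub> w)" if "h \<in> carrier H" for h
    by (intro conjI ballI dual_hom_rules W that)
  have rec: "s = (\<Oplus>\<^bsub>?T\<^esub>b \<in> B. tens K Hd W (\<phi> b) (eval_first W b s))"
    if s: "s \<in> carrier ?T" for s
  proof (rule tensor_hom_ext[OF dual_module W hom_id _ _ s])
    show "(\<lambda>s. \<Oplus>\<^bsub>?T\<^esub>b \<in> B. tens K Hd W (\<phi> b) (eval_first W b s))
      \<in> module_hom K ?T ?T"
      by (rule hom_finsum[OF T T B(1)]; intro conjI ballI dual_hom_rules W \<phi> bH)
    fix \<theta> w assume \<theta>: "\<theta> \<in> carrier Hd" and w: "w \<in> carrier W"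
    have "tens K Hd W \<theta> w = tens K Hd W (\<Oplus>\<^bsub>Hd\<^esub>b \<in> B. pairing b \<theta> \<odot>\<^bsub>Hd\<^esub> \<phi> b) w"
      by (rule arg_cong[where f = "\<lambda>\<theta>. tens K Hd W \<theta> w", OF ex[OF \<theta>]])
    also have "\<dots> = (\<Oplus>\<^bsub>?T\<^esub>b \<in> B. tens K Hd W (pairing b \<theta> \<odot>\<^bsub>Hd\<^esub> \<phi> b) w)"
      by (rule hom_finsum_apply[OF dual_module T _ B(1)], intro hom_rules dual_module W w)
        (use \<phi> bH \<theta> pairing_closed in auto)
    also have "\<dots> = (\<Oplus>\<^bsub>?T\<^esub>b \<in> B. tens K Hd W (\<phi> b)
        (eval_first W b (tens K Hd W \<theta> w)))"
    proof (rule T.finsum_cong', rule refl)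
      have eq: "tens K Hd W (pairing b \<theta> \<odot>\<^bsub>Hd\<^esub> \<phi> b) w = tens K Hd W (\<phi> b)
        (eval_first W b (tens K Hd W \<theta> w))" if "b \<in> B" for b
        using that \<theta> w by (simp add: tlift_tens[OF dual_module W W bil[OF bH]] pairing_closed[OF bH] \<phi>
            bilinear_rules[OF tens_bilinear[OF dual_module W]])
      then show "tens K Hd W (pairing b \<theta> \<odot>\<^bsub>Hd\<^esub> \<phi> b) w = tens K Hd W (\<phi> b)
        (eval_first W b (tens K Hd W \<theta> w))" if "b \<in> B" for b
        using that .
      show "(\<lambda>b. tens K Hd W (\<phi> b) (eval_first W b (tens K Hd W \<theta> w)))
        \<in> B \<rightarrow> carrier ?T"
        by (rule Pi_I; intro conjI ballI dual_hom_rules W \<phi> bH \<theta> w)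
    qed
    finally show "tens K Hd W \<theta> w = (\<Oplus>\<^bsub>?T\<^esub>b \<in> B. tens K Hd W (\<phi> b)
        (eval_first W b (tens K Hd W \<theta> w)))" .
  qed
  have "(\<Oplus>\<^bsub>?T\<^esub>b \<in> B. tens K Hd W (\<phi> b) (eval_first W b t))
    = (\<Oplus>\<^bsub>?T\<^esub>b \<in> B. tens K Hd W (\<phi> b) (eval_first W b t'))"
  proof (rule T.finsum_cong'[OF refl])
    show "(\<lambda>b. tens K Hd W (\<phi> b) (eval_first W b t')) \<in> B \<rightarrow> carrier ?T"
      by (rule Pi_I; intro conjI ballI dual_hom_rules W \<phi> bH t')
  qed (simp add: eq bH)
  then show ?thesis by (rule trans[OF rec[OF t] trans[OF _ rec[OF t', symmetric]]])
qed

lemma pairing_pairing_bilinear: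
  "\<lbrakk>h \<in> carrier H; h' \<in> carrier H\<rbrakk> \<Longrightarrow> bilinear K Hd Hd KK (\<lambda>\<phi> \<psi>. pairing h \<phi> \<otimes>\<^bsub>K\<^esub> pairing h' \<psi>)"
  by (intro conjI ballI dual_hom_rules)

lemma dual_tensor_ext:
  assumes t: "t \<in> carrier (tensor_space K Hd Hd)" and t': "t' \<in> carrier (tensor_space K Hd Hd)"
    and eq: "\<And>h h'. \<lbrakk>h \<in> carrier H; h' \<in> carrier H\<rbrakk> \<Longrightarrow>
      pairing2 h h' t
      = pairing2 h h' t'"
  shows "t = t'"
proof (rule dual_tensor_separation[OF dual_module t t'])
  fix h assume h: "h \<in> carrier H"
  have bil: "bilinear K Hd Hd Hd (\<lambda>\<theta> w. pairing h \<theta> \<odot>\<^bsub>Hd\<^esub> w)"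
    by (intro conjI ballI dual_hom_rules h)
  have ev: "pairing h' (eval_first Hd h s)
    = pairing2 h h' s"
    if h': "h' \<in> carrier H" and s: "s \<in> carrier (tensor_space K Hd Hd)" for h' s
    unfolding tlift_apply[OF dual_module dual_module dual_module scalar_module bil pairing_hom_right[OF h'] s]
    by (intro tlift_cong)
      (simp add: module_hom_smult[OF pairing_hom_right[OF h']] pairing_closed h)
  show "eval_first Hd h t
    = eval_first Hd h t'"
    by (rule dual_ext)
      (simp_all add: ev t t' eq h tlift_closed[OF dual_module dual_module dual_module bil])
qed

text \<open>The coproduct of the dual is given by a definite description. The tensor \<open>\<Sum>\<^sub>b \<phi>\<^sub>b \<otimes> \<theta>(b \<cdot>)\<close>, for a pair
  of dual bases, satisfies the description, and separation makes it the only one.\<close>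

lemma dual_comult_closed_eval:
  assumes \<theta>: "\<theta> \<in> carrier Hd"
  shows dual_comult_closed: "comult Hd \<theta> \<in> carrier (tensor_space K Hd Hd)"
    and dual_comult_eval: "\<lbrakk>h \<in> carrier H; h' \<in> carrier H\<rbrakk> \<Longrightarrow>
      pairing2 h h' (comult Hd \<theta>)
      = pairing (h \<otimes>\<^bsub>H\<^esub> h') \<theta>"
proof -
  obtain B \<phi> where B: "finite B" "B \<subseteq> carrier H" and \<phi>: "\<And>b. b \<in> B \<Longrightarrow> \<phi> b \<in> carrier Hd"
    and ex: "\<And>h \<theta>. \<lbrakk>h \<in> carrier H; \<theta> \<in> carrier Hd\<rbrakk>
      \<Longrightarrow> pairing h \<theta> = (\<Oplus>\<^bsub>KK\<^esub>b \<in> B. pairing h (\<phi> b) \<odot>\<^bsub>KK\<^esub> pairing b \<theta>)"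
    by (rule dual_basis_expansion) (rule that)
  have bH: "b \<in> carrier H" if "b \<in> B" for b using that B by auto
  let ?T = "tensor_space K Hd Hd"
  have T: "module K ?T" by (rule tensor_space_module[OF dual_module dual_module])
  interpret T: module K ?T by (rule T)
  interpret S: module K KK by (rule scalar_module)
  define P where "P t \<longleftrightarrow> t \<in> carrier ?T \<and> (\<forall>h \<in> carrier H. \<forall>h' \<in> carrier H.
      pairing2 h h' t = pairing (h \<otimes>\<^bsub>H\<^esub> h') \<theta>)" for t
  \<comment> \<open>The functionals \<open>\<theta>(\<cdot> h')\<close> and \<open>\<theta>(b \<cdot>)\<close>.\<close>
  define tr where "tr h' = restrict (\<lambda>h. pairing (h \<otimes>\<^bsub>H\<^esub> h') \<theta>) (carrier H)" for h'
  define tl where "tl b = restrict (\<lambda>h'. pairing (b \<otimes>\<^bsub>H\<^esub> h') \<theta>) (carrier H)" for b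
  have tr: "tr h' \<in> carrier Hd" if "h' \<in> carrier H" for h'
    unfolding tr_def by (rule functional_in_dual; intro dual_hom_rules \<theta> that)
  have tl: "tl b \<in> carrier Hd" if "b \<in> carrier H" for b
    unfolding tl_def by (rule functional_in_dual; intro dual_hom_rules \<theta> that)
  have swap: "pairing h' (tl b) = pairing b (tr h')" if "b \<in> carrier H" "h' \<in> carrier H" for b h'
    using that by (simp add: tl_def tr_def pairing_def)
  define t where "t = (\<Oplus>\<^bsub>?T\<^esub>b \<in> B. tens K Hd Hd (\<phi> b) (tl b))"
  have mem: "tens K Hd Hd (\<phi> b) (tl b) \<in> carrier ?T" if "b \<in> B" for b
    by (intro tens_closed dual_module \<phi> tl bH that)
  have "P t"
    unfolding P_def
  proof (intro conjI ballI)
    show "t \<in> carrier ?T" unfolding t_def using mem by (intro T.finsum_closed) auto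
    fix h h' assume h: "h \<in> carrier H" and h': "h' \<in> carrier H"
    note b = pairing_pairing_bilinear[OF h h']
    have "pairing2 h h' t
      = (\<Oplus>\<^bsub>KK\<^esub>b \<in> B. pairing2 h h'
          (tens K Hd Hd (\<phi> b) (tl b)))"
      unfolding t_def
      by (rule hom_finsum_apply[OF T scalar_module tlift_hom[OF dual_module dual_module scalar_module b] B(1) mem])
    also have "\<dots> = (\<Oplus>\<^bsub>KK\<^esub>b \<in> B. pairing h (\<phi> b) \<odot>\<^bsub>KK\<^esub> pairing b (tr h'))"
      by (rule S.finsum_cong', rule refl)
        (auto simp: h tlift_tens[OF dual_module dual_module scalar_module b] \<phi> tl tr[OF h'] bH
          pairing_closed swap[OF bH h'])
    also have "\<dots> = pairing h (tr h')" by (rule ex[OF h tr[OF h'], symmetric])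
    also have "\<dots> = pairing (h \<otimes>\<^bsub>H\<^esub> h') \<theta>" using h by (simp add: tr_def pairing_def)
    finally show "pairing2 h h' t = pairing (h \<otimes>\<^bsub>H\<^esub> h') \<theta>" .
  qed
  moreover have "s = s'" if "P s" "P s'" for s s'
    using that unfolding P_def by (intro dual_tensor_ext) auto
  ultimately have "\<exists>!t. P t" by blast
  then have *: "P (THE t. P t)" by (rule theI')
  have c: "carrier (tensor_space K (dual_alg K H) (dual_alg K H)) = carrier ?T"
    by (rule arg_cong[where f = carrier], rule tensor_space_cong)
      (simp_all add: dual_hopf_def module.defs hopf.defs)
  have l: "tlift K (dual_alg K H) (dual_alg K H) KK = tlift K Hd Hd KK"
    by (rule tlift_space_cong) (simp_all add: dual_hopf_def module.defs hopf.defs)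
  have "comult Hd \<theta> = (THE t. P t)"
    unfolding dual_hopf_simps(7) dual_comult_def P_def tensor_record_simps c l ..
  with * have "P (comult Hd \<theta>)" by simp
  then show "comult Hd \<theta> \<in> carrier ?T"
    and "\<lbrakk>h \<in> carrier H; h' \<in> carrier H\<rbrakk> \<Longrightarrow>
      pairing2 h h' (comult Hd \<theta>)
      = pairing (h \<otimes>\<^bsub>H\<^esub> h') \<theta>"
    by (simp_all add: P_def)
qed

text \<open>Since the values are known only through the defining property, linearity too comes from separation.\<close>

lemma dual_comult_hom: "comult Hd \<in> module_hom K Hd (tensor_space K Hd Hd)"
proof -
  have T: "module K (tensor_space K Hd Hd)" by (rule tensor_space_module[OF dual_module dual_module])
  interpret T: module K "tensor_space K Hd Hd" by (rule T)
  interpret D: module K Hd by (rule dual_module)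
  note hom = tlift_hom[OF dual_module dual_module scalar_module pairing_pairing_bilinear]
  show ?thesis
  proof (rule module_homI)
    show "comult Hd (\<theta> \<oplus>\<^bsub>Hd\<^esub> \<theta>') = comult Hd \<theta> \<oplus>\<^bsub>tensor_space K Hd Hd\<^esub> comult Hd \<theta>'"
      if "\<theta> \<in> carrier Hd" "\<theta>' \<in> carrier Hd" for \<theta> \<theta>'
      by (rule dual_tensor_ext)
        (simp_all add: that dual_comult_closed dual_comult_eval module_hom_add[OF hom]
          module_hom_add[OF pairing_hom_right])
    show "comult Hd (c \<odot>\<^bsub>Hd\<^esub> \<theta>) = c \<odot>\<^bsub>tensor_space K Hd Hd\<^esub> comult Hd \<theta>"
      if "c \<in> carrier K" "\<theta> \<in> carrier Hd" for c \<theta>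
      by (rule dual_tensor_ext)
        (simp_all add: that dual_comult_closed dual_comult_eval module_hom_smult[OF hom]
          module_hom_smult[OF pairing_hom_right])
  qed (rule dual_comult_closed)
qed

lemma dual_comult_one: "comult Hd \<one>\<^bsub>Hd\<^esub> = tens K Hd Hd \<one>\<^bsub>Hd\<^esub> \<one>\<^bsub>Hd\<^esub>"
  by (rule dual_tensor_ext)
    (simp_all add: dual_comult_closed dual_one_closed dual_comult_eval tens_closed dual_module
      tlift_tens[OF dual_module dual_module scalar_module pairing_pairing_bilinear]
      pairing_dual_one counit_mult)

lemmas findim_hom_rules = dual_hom_rules
  bilinear_hom_left[OF dual_mult_bilinear] bilinear_hom_right[OF dual_mult_bilinear]
  dual_mult_closed dual_one_closed dual_comult_closed hom_comp[OF dual_comult_hom]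
  dual_antipode_closed hom_comp[OF dual_antipode_hom]

end

section \<open>Products in tensor product algebras\<close>

lemma tensor_mult_unfold:
  "mult (tensor K A B) = (\<lambda>s t. tlift K A B (tensor_space K A B)
        (\<lambda>a b. tlift K A B (tensor_space K A B)
           (\<lambda>a' b'. tens K A B (a \<otimes>\<^bsub>A\<^esub> a') (b \<otimes>\<^bsub>B\<^esub> b')) t) s)"
  by (simp add: tensor_def)

lemma
  assumes "module K A" and "module K B" and "bilinear K A A A (mult A)" and "bilinear K B B B (mult B)"
  shows tensor_mult_bilinear: "bilinear K (tensor_space K A B) (tensor_space K A B) (tensor_space K A B)
      (mult (tensor K A B))"
    and tensor_mult_tens: "\<lbrakk>a \<in> carrier A; b \<in> carrier B; a' \<in> carrier A; b' \<in> carrier B\<rbrakk>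
      \<Longrightarrow> tens K A B a b \<otimes>\<^bsub>tensor K A B\<^esub> tens K A B a' b' = tens K A B (a \<otimes>\<^bsub>A\<^esub> a') (b \<otimes>\<^bsub>B\<^esub> b')"
proof -
  note rules = hom_rules assms(1,2) bilinear_hom_left[OF assms(3)] bilinear_hom_right[OF assms(3)]
    bilinear_hom_left[OF assms(4)] bilinear_hom_right[OF assms(4)]
    bilinear_closed[OF assms(3)] bilinear_closed[OF assms(4)]
  show "bilinear K (tensor_space K A B) (tensor_space K A B) (tensor_space K A B) (mult (tensor K A B))"
    unfolding tensor_mult_unfold by (intro conjI ballI rules)
  show "tens K A B a b \<otimes>\<^bsub>tensor K A B\<^esub> tens K A B a' b' = tens K A B (a \<otimes>\<^bsub>A\<^esub> a') (b \<otimes>\<^bsub>B\<^esub> b')"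
    if m: "a \<in> carrier A" "b \<in> carrier B" "a' \<in> carrier A" "b' \<in> carrier B"
  proof -
    note T = tensor_space_module[OF assms(1,2)]
    have "bilinear K A B (tensor_space K A B) (\<lambda>a b. tlift K A B (tensor_space K A B)
        (\<lambda>a' b'. tens K A B (a \<otimes>\<^bsub>A\<^esub> a') (b \<otimes>\<^bsub>B\<^esub> b')) (tens K A B a' b'))"
      by (intro conjI ballI rules m)
    note outer = tlift_tens[OF assms(1,2) T this m(1,2)]
    have "bilinear K A B (tensor_space K A B) (\<lambda>a' b'. tens K A B (a \<otimes>\<^bsub>A\<^esub> a') (b \<otimes>\<^bsub>B\<^esub> b'))"
      by (intro conjI ballI rules m)
    note inner = tlift_tens[OF assms(1,2) T this m(3,4)]
    show ?thesis unfolding tensor_mult_unfold outer inner ..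
  qed
qed

text \<open>Two elements given by Sweedler sums are multiplied summand by summand.\<close>

lemma tlift_bilinear:
  assumes "module K M" "module K N" "module K P" "module K Q" "module K V" "module K V'" "module K W"
    and op: "bilinear K V V' W op"
    and f: "bilinear K M N V f" and g: "bilinear K P Q V' g"
    and s: "s \<in> carrier (tensor_space K M N)" and t: "t \<in> carrier (tensor_space K P Q)"
  shows "op (tlift K M N V f s) (tlift K P Q V' g t)
    = tlift K M N W (\<lambda>m n. tlift K P Q W (\<lambda>p q. op (f m n) (g p q)) t) s"
proof -
  have gt: "tlift K P Q V' g t \<in> carrier V'" by (rule tlift_closed[OF assms(3,4,6) g t])
  have "op (tlift K M N V f s) (tlift K P Q V' g t)
    = tlift K M N W (\<lambda>m n. op (f m n) (tlift K P Q V' g t)) s"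
    by (rule tlift_apply[OF assms(1,2,5,7) f _ s, where g = "\<lambda>v. op v (tlift K P Q V' g t)"])
      (use op gt in simp)
  also have "\<dots> = tlift K M N W (\<lambda>m n. tlift K P Q W (\<lambda>p q. op (f m n) (g p q)) t) s"
  proof (intro tlift_cong)
    fix m n assume "m \<in> carrier M" "n \<in> carrier N"
    then have "f m n \<in> carrier V" by (rule bilinear_closed[OF f])
    then have "op (f m n) \<in> module_hom K V' W" using op by simp
    then show "op (f m n) (tlift K P Q V' g t) = tlift K P Q W (\<lambda>p q. op (f m n) (g p q)) t"
      by (rule tlift_apply[OF assms(3,4,6,7) g _ t])
  qed
  finally show ?thesis .
qed

lemma mult_map_tmap:
  assumes "module K M" and "module K N" and "module K A" and A: "bilinear K A A A (mult A)"
    and f: "f \<in> module_hom K M A" and g: "g \<in> module_hom K N A"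
    and "m \<in> carrier M" and "n \<in> carrier N"
  shows "mult_map K A (tmap K M N A A f g (tens K M N m n)) = f m \<otimes>\<^bsub>A\<^esub> g n"
  unfolding mult_map_def tmap_tens[OF assms(1-3,3) f g assms(7,8)]
  by (rule tlift_tens[OF assms(3,3,3) A hom_closed[OF f assms(7)] hom_closed[OF g assms(8)]])

lemma (in k_algebra) opposite_mult_bilinear:
  "bilinear K (opposite A) (opposite A) (opposite A) (mult (opposite A))"
  unfolding opposite_def
  by (intro conjI ballI module_homI)
    (auto simp: A.l_distr A.r_distr smult_mult_left smult_mult_right)

section \<open>The Heisenberg algebra\<close>

context findim_hopf_algebra
begin

abbreviation HT :: "('k, ('a \<times> ('a \<Rightarrow> 'k) \<Rightarrow> 'k) set) module" where "HT \<equiv> tensor_space K H Hd"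
abbreviation Heis :: "('k, ('a \<times> ('a \<Rightarrow> 'k) \<Rightarrow> 'k) set) module" where "Heis \<equiv> heisenberg K H"

lemma heisenberg_record_simps [simp]:
  "carrier Heis = carrier HT" "add Heis = add HT" "smult Heis = smult HT" "zero Heis = zero HT"
  by (simp_all add: heisenberg_def Let_def)

lemma heisenberg_norm [simp]:
  "module_hom K M Heis = module_hom K M HT"
  "module_hom K Heis N = module_hom K HT N"
  "tensor_space K Heis N = tensor_space K HT N"
  "tens K Heis N = tens K HT N"
  "tlift K Heis N W = tlift K HT N W"
  "tlift K M N Heis = tlift K M N HT"
  by (rule module_hom_cong tensor_space_cong tens_cong tlift_space_cong; simp)+

lemma HT_module: "module K HT"
  by (rule tensor_space_module[OF algebra_module dual_module])

lemma heisenberg_module: "module K Heis"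
  by (rule module_cong[OF HT_module]) simp_all

lemma heisenberg_mult_unfold:
  "mult Heis = (\<lambda>s t. tlift K H Hd HT (\<lambda>h \<theta>. tlift K H Hd HT (\<lambda>h' \<theta>'.
      sweedler HT (\<lambda>h1 h2. tlift K Hd Hd HT (\<lambda>\<theta>1 \<theta>2.
        pairing h2 \<theta>1 \<odot>\<^bsub>HT\<^esub> tens K H Hd (h \<otimes>\<^bsub>H\<^esub> h1) (\<theta>2 \<otimes>\<^bsub>Hd\<^esub> \<theta>')) (comult Hd \<theta>)) h') t) s)"
  by (simp add: heisenberg_def Let_def)

lemma heisenberg_mult_bilinear: "bilinear K HT HT HT (mult Heis)"
  unfolding heisenberg_mult_unfold by (intro conjI ballI findim_hom_rules)

lemma heisenberg_mult_tens:
  assumes m: "h \<in> carrier H" "\<theta> \<in> carrier Hd" "h' \<in> carrier H" "\<theta>' \<in> carrier Hd"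
  shows "tens K H Hd h \<theta> \<otimes>\<^bsub>Heis\<^esub> tens K H Hd h' \<theta>'
    = sweedler HT (\<lambda>h1 h2. tlift K Hd Hd HT (\<lambda>\<theta>1 \<theta>2.
        pairing h2 \<theta>1 \<odot>\<^bsub>HT\<^esub> tens K H Hd (h \<otimes>\<^bsub>H\<^esub> h1) (\<theta>2 \<otimes>\<^bsub>Hd\<^esub> \<theta>')) (comult Hd \<theta>)) h'"
proof -
  have "bilinear K H Hd HT (\<lambda>h \<theta>. tlift K H Hd HT (\<lambda>h' \<theta>'.
      sweedler HT (\<lambda>h1 h2. tlift K Hd Hd HT (\<lambda>\<theta>1 \<theta>2.
        pairing h2 \<theta>1 \<odot>\<^bsub>HT\<^esub> tens K H Hd (h \<otimes>\<^bsub>H\<^esub> h1) (\<theta>2 \<otimes>\<^bsub>Hd\<^esub> \<theta>')) (comult Hd \<theta>)) h') (tens K H Hd h' \<theta>'))"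
    by (intro conjI ballI findim_hom_rules m)
  note outer = tlift_tens[OF algebra_module dual_module HT_module this m(1,2)]
  have "bilinear K H Hd HT (\<lambda>h' \<theta>'. sweedler HT (\<lambda>h1 h2. tlift K Hd Hd HT (\<lambda>\<theta>1 \<theta>2.
        pairing h2 \<theta>1 \<odot>\<^bsub>HT\<^esub> tens K H Hd (h \<otimes>\<^bsub>H\<^esub> h1) (\<theta>2 \<otimes>\<^bsub>Hd\<^esub> \<theta>')) (comult Hd \<theta>)) h')"
    by (intro conjI ballI findim_hom_rules m)
  note inner = tlift_tens[OF algebra_module dual_module HT_module this m(3,4)]
  show ?thesis unfolding heisenberg_mult_unfold outer inner ..
qed

text \<open>Both coproducts in the product formula are taken at units, hence trivial.\<close>

lemma heisenberg_left_right:
  assumes h: "h \<in> carrier H" and \<theta>: "\<theta> \<in> carrier Hd"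
  shows "tens K H Hd h \<one>\<^bsub>Hd\<^esub> \<otimes>\<^bsub>Heis\<^esub> tens K H Hd \<one>\<^bsub>H\<^esub> \<theta> = tens K H Hd h \<theta>"
proof -
  note rules = findim_hom_rules h \<theta>
  have b1: "bilinear K H H HT (\<lambda>h1 h2. tlift K Hd Hd HT (\<lambda>\<theta>1 \<theta>2.
      pairing h2 \<theta>1 \<odot>\<^bsub>HT\<^esub> tens K H Hd (h \<otimes>\<^bsub>H\<^esub> h1) (\<theta>2 \<otimes>\<^bsub>Hd\<^esub> \<theta>)) (comult Hd \<one>\<^bsub>Hd\<^esub>))"
    by (intro conjI ballI rules)
  have b2: "bilinear K Hd Hd HT (\<lambda>\<theta>1 \<theta>2.
      pairing \<one>\<^bsub>H\<^esub> \<theta>1 \<odot>\<^bsub>HT\<^esub> tens K H Hd (h \<otimes>\<^bsub>H\<^esub> \<one>\<^bsub>H\<^esub>) (\<theta>2 \<otimes>\<^bsub>Hd\<^esub> \<theta>))"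
    by (intro conjI ballI rules)
  have t: "tens K H Hd h \<theta> \<in> carrier HT" by (intro rules)
  interpret T: module K HT by (rule HT_module)
  show ?thesis
    unfolding heisenberg_mult_tens[OF h dual_one_closed A.one_closed \<theta>] sweedler_one[OF HT_module b1]
    unfolding dual_comult_one tlift_tens[OF dual_module dual_module HT_module b2 dual_one_closed dual_one_closed]
    using t h \<theta> by (simp add: pairing_dual_one counit_one dual_mult_one)
qed

text \<open>In this order both coproducts survive; only the products with units disappear.\<close>

lemma heisenberg_right_left:
  assumes h: "h \<in> carrier H" and \<theta>: "\<theta> \<in> carrier Hd"
  shows "tens K H Hd \<one>\<^bsub>H\<^esub> \<theta> \<otimes>\<^bsub>Heis\<^esub> tens K H Hd h \<one>\<^bsub>Hd\<^esub>
    = sweedler HT (\<lambda>h1 h2. tlift K Hd Hd HT (\<lambda>\<theta>1 \<theta>2.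
        pairing h2 \<theta>1 \<odot>\<^bsub>HT\<^esub> tens K H Hd h1 \<theta>2) (comult Hd \<theta>)) h"
  unfolding heisenberg_mult_tens[OF A.one_closed \<theta> h dual_one_closed]
  by (intro tlift_cong) (simp add: dual_mult_one)

end

section \<open>Coactions\<close>

lemma left_coaction_hom:
  "left_coaction K C X \<delta> \<Longrightarrow> \<delta> \<in> module_hom K X (tensor_space K C X)"
  by (simp add: left_coaction_def alg_hom_def)

lemma left_coaction_coassoc:
  assumes "left_coaction K C X \<delta>" and "module K C" and "module K X" and "module K W"
    and "comult C \<in> module_hom K C (tensor_space K C C)"
    and "trilinear K C C X W f" and "x \<in> carrier X"
  shows "tlift K C X W (\<lambda>c y. tlift K C X W (\<lambda>d z. f c d z) (\<delta> y)) (\<delta> x)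
    = tlift K C X W (\<lambda>c y. tlift K C C W (\<lambda>c1 c2. f c1 c2 y) (comult C c)) (\<delta> x)"
  by (rule tlift_coassoc[OF assms(2-5) left_coaction_hom[OF assms(1)] assms(6,7)])
    (use assms(1,7) in \<open>simp add: left_coaction_def\<close>)

locale coacted_algebra = findim_hopf_algebra K H + X: k_algebra K X
  for K :: "('k, 'r) ring_scheme" (structure) and H :: "('k, 'a) hopf"
    and X :: "('k, 'x, 'm) module_scheme" +
  fixes \<alpha> :: "'x \<Rightarrow> ('a opp \<times> 'x \<Rightarrow> 'k) set"
    and \<beta> :: "'x \<Rightarrow> (('a \<Rightarrow> 'k) \<times> 'x \<Rightarrow> 'k) set"
  assumes coaction_\<alpha>: "left_coaction K (opposite_hopf K H) X \<alpha>"
    and coaction_\<beta>: "left_coaction K Hd X \<beta>"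
begin

abbreviation Ho :: "('k, 'a opp) hopf" where "Ho \<equiv> opposite_hopf K H"
abbreviation Xo :: "('k, 'x opp) module" where "Xo \<equiv> opposite X"
abbreviation act :: "'x \<Rightarrow> 'a \<Rightarrow> 'x" where "act \<equiv> dual_act K H X \<beta>"

text \<open>The Sweedler sums \<open>f(x\<^sub>[\<^sub>-\<^sub>1\<^sub>], x\<^sub>[\<^sub>0\<^sub>])\<close> of the two coactions; for \<open>\<alpha>\<close> the first leg is taken
  back from the opposite algebra to \<open>H\<close>.\<close>

abbreviation asum :: "('k, 'w, 'l) module_scheme \<Rightarrow> ('a \<Rightarrow> 'x \<Rightarrow> 'w) \<Rightarrow> 'x \<Rightarrow> 'w" where
  "asum W f x \<equiv> tlift K Ho X W (\<lambda>h z. f (unop h) z) (\<alpha> x)"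
abbreviation bsum :: "('k, 'w, 'l) module_scheme \<Rightarrow> (('a \<Rightarrow> 'k) \<Rightarrow> 'x \<Rightarrow> 'w) \<Rightarrow> 'x \<Rightarrow> 'w" where
  "bsum W f y \<equiv> tlift K Hd X W f (\<beta> y)"

lemmas \<alpha>_hom = left_coaction_hom[OF coaction_\<alpha>]
lemmas \<beta>_hom = left_coaction_hom[OF coaction_\<beta>]
lemmas Ho_module = opposite_hopf_module[OF algebra_module]
lemmas Xo_module = opposite_module[OF X.algebra_module]

lemmas opposite_hom_rules = hom_unop[where A = X] hom_unop_hopf[where H = H]
  hom_Op[where A = X] hom_Op_hopf[where H = H]
  opposite_closed(1)[where A = X] opposite_closed(2)[where H = H]
  opposite_closed(3)[where A = X] opposite_closed(4)[where H = H] Ho_module Xo_module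

lemmas coaction_rules = findim_hom_rules X.algebra_hom_rules opposite_hom_rules
  hom_comp[OF \<alpha>_hom] hom_comp[OF \<beta>_hom] hom_closed[OF \<alpha>_hom] hom_closed[OF \<beta>_hom]

lemma act_hom_left:
  assumes "g \<in> module_hom K P X" and "h \<in> carrier H"
  shows "(\<lambda>p. act (g p) h) \<in> module_hom K P X"
  unfolding dual_act_def by (intro conjI ballI coaction_rules assms)

lemma act_hom_right:
  assumes "module K P" and "y \<in> carrier X" and "g \<in> module_hom K P H"
  shows "(\<lambda>p. act y (g p)) \<in> module_hom K P X"
  unfolding dual_act_def
  by (intro conjI ballI coaction_rules assms hom_closed[OF assms(3)])

lemma act_closed: "\<lbrakk>y \<in> carrier X; h \<in> carrier H\<rbrakk> \<Longrightarrow> act y h \<in> carrier X"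
  using hom_closed[OF act_hom_left[OF hom_id]] by blast

lemmas act_rules = coaction_rules act_hom_left act_hom_right act_closed

text \<open>The action law is the coassociativity of \<open>\<beta>\<close>, because the coproduct of the dual is
  dual to the product of \<open>H\<close>.\<close>

lemma act_act:
  assumes y: "y \<in> carrier X" and h: "h \<in> carrier H" and h': "h' \<in> carrier H"
  shows "act (act y h) h' = act y (h \<otimes>\<^bsub>H\<^esub> h')"
proof -
  note rules = act_rules h h' y
  let ?f = "\<lambda>\<theta> \<theta>' w. pairing h \<theta> \<odot>\<^bsub>X\<^esub> (pairing h' \<theta>' \<odot>\<^bsub>X\<^esub> w)"
  have "act (act y h) h' = bsum X (\<lambda>\<theta> z. act (pairing h \<theta> \<odot>\<^bsub>X\<^esub> z) h') y"
    unfolding dual_act_def[of K H X \<beta> y]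
    by (rule tlift_apply[OF dual_module X.algebra_module X.algebra_module X.algebra_module,
          where g = "\<lambda>u. act u h'"]; intro conjI ballI rules)
  also have "\<dots> = bsum X (\<lambda>\<theta> z. bsum X (\<lambda>\<theta>' w. ?f \<theta> \<theta>' w) z) y"
  proof (intro tlift_cong)
    fix \<theta> z assume \<theta>: "\<theta> \<in> carrier Hd" and z: "z \<in> carrier X"
    have "act (pairing h \<theta> \<odot>\<^bsub>X\<^esub> z) h' = pairing h \<theta> \<odot>\<^bsub>X\<^esub> act z h'"
      by (rule module_hom_smult[OF act_hom_left[OF hom_id h']]; intro rules \<theta> z)
    also have "\<dots> = bsum X (\<lambda>\<theta>' w. ?f \<theta> \<theta>' w) z"
      unfolding dual_act_def
      by (rule tlift_apply[OF dual_module X.algebra_module X.algebra_module X.algebra_module,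
            where g = "\<lambda>u. pairing h \<theta> \<odot>\<^bsub>X\<^esub> u"]; intro conjI ballI rules \<theta> z)
    finally show "act (pairing h \<theta> \<odot>\<^bsub>X\<^esub> z) h' = bsum X (\<lambda>\<theta>' w. ?f \<theta> \<theta>' w) z" .
  qed
  also have "\<dots> = bsum X (\<lambda>\<theta> w. tlift K Hd Hd X (\<lambda>\<theta>1 \<theta>2. ?f \<theta>1 \<theta>2 w) (comult Hd \<theta>)) y"
    by (rule left_coaction_coassoc[OF coaction_\<beta> dual_module X.algebra_module X.algebra_module
          dual_comult_hom _ y]) (intro conjI ballI rules)
  also have "\<dots> = act y (h \<otimes>\<^bsub>H\<^esub> h')"
    unfolding dual_act_def
  proof (intro tlift_cong)
    fix \<theta> w assume \<theta>: "\<theta> \<in> carrier Hd" and w: "w \<in> carrier X"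
    have "tlift K Hd Hd X (\<lambda>\<theta>1 \<theta>2. ?f \<theta>1 \<theta>2 w) (comult Hd \<theta>)
      = tlift K Hd Hd X (\<lambda>\<theta>1 \<theta>2. (pairing h \<theta>1 \<otimes>\<^bsub>K\<^esub> pairing h' \<theta>2) \<odot>\<^bsub>X\<^esub> w) (comult Hd \<theta>)"
      by (intro tlift_cong) (simp add: X.smult_assoc1 pairing_closed h h' w)
    also have "\<dots> = tlift K Hd Hd KK (\<lambda>\<theta>1 \<theta>2. pairing h \<theta>1 \<otimes>\<^bsub>K\<^esub> pairing h' \<theta>2) (comult Hd \<theta>) \<odot>\<^bsub>X\<^esub> w"
      by (rule tlift_apply[symmetric, OF dual_module dual_module scalar_module X.algebra_module,
            where g = "\<lambda>c. c \<odot>\<^bsub>X\<^esub> w"]; intro conjI ballI rules \<theta> w)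
    also have "\<dots> = pairing (h \<otimes>\<^bsub>H\<^esub> h') \<theta> \<odot>\<^bsub>X\<^esub> w"
      by (simp add: dual_comult_eval \<theta> h h')
    finally show "tlift K Hd Hd X (\<lambda>\<theta>1 \<theta>2. ?f \<theta>1 \<theta>2 w) (comult Hd \<theta>)
      = pairing (h \<otimes>\<^bsub>H\<^esub> h') \<theta> \<odot>\<^bsub>X\<^esub> w" .
  qed
  finally show ?thesis .
qed

text \<open>The counit of the dual is evaluation at the unit of \<open>H\<close>.\<close>

lemma act_one:
  assumes "y \<in> carrier X"
  shows "act y \<one>\<^bsub>H\<^esub> = y"
  using coaction_\<beta> assms by (simp add: left_coaction_def dual_act_def dual_hopf_simps(8))

lemma asum_counit:
  assumes "x \<in> carrier X"
  shows "asum X (\<lambda>h z. counit H h \<odot>\<^bsub>X\<^esub> z) x = x"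
  using coaction_\<alpha> assms by (simp add: left_coaction_def)

text \<open>The opposite Hopf algebra has the coproduct of \<open>H\<close>.\<close>

lemma asum_coassoc:
  assumes W: "module K W" and f: "trilinear K H H X W f" and x: "x \<in> carrier X"
  shows "asum W (\<lambda>h z. asum W (\<lambda>k u. f h k u) z) x = asum W (\<lambda>h u. sweedler W (\<lambda>h1 h2. f h1 h2 u) h) x"
proof -
  have Op: "Op \<in> module_hom K H Ho" using hom_Op_hopf[OF hom_id] .
  have comult: "comult Ho \<in> module_hom K Ho (tensor_space K Ho Ho)"
    unfolding opposite_hopf_comult[abs_def]
    by (rule hom_comp[OF tmap_hom[OF algebra_module algebra_module Ho_module Ho_module Op Op]])
      (intro coaction_rules)
  have tri: "trilinear K Ho Ho X W (\<lambda>c d z. f (unop c) (unop d) z)"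
  proof (intro conjI ballI)
    fix c d assume "c \<in> carrier Ho" "d \<in> carrier Ho"
    then show "(\<lambda>z. f (unop c) (unop d) z) \<in> module_hom K X W" using f by auto
  next
    fix c z assume c: "c \<in> carrier Ho" and z: "z \<in> carrier X"
    have "(\<lambda>k. f (unop c) k z) \<in> module_hom K H W" using f c z by auto
    then show "(\<lambda>d. f (unop c) (unop d) z) \<in> module_hom K Ho W"
      by (rule hom_comp) (rule hom_unop_hopf[OF hom_id])
  next
    fix d z assume d: "d \<in> carrier Ho" and z: "z \<in> carrier X"
    have "(\<lambda>k. f k (unop d) z) \<in> module_hom K H W" using f d z by auto
    then show "(\<lambda>c. f (unop c) (unop d) z) \<in> module_hom K Ho W"
      by (rule hom_comp) (rule hom_unop_hopf[OF hom_id])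
  qed
  have "asum W (\<lambda>h z. asum W (\<lambda>k u. f h k u) z) x
    = tlift K Ho X W (\<lambda>c u. tlift K Ho Ho W (\<lambda>c1 c2. f (unop c1) (unop c2) u) (comult Ho c)) (\<alpha> x)"
    by (rule left_coaction_coassoc[OF coaction_\<alpha> Ho_module X.algebra_module W comult tri x])
  also have "\<dots> = asum W (\<lambda>h u. sweedler W (\<lambda>h1 h2. f h1 h2 u) h) x"
  proof (intro tlift_cong)
    fix c u assume c: "c \<in> carrier Ho" and u: "u \<in> carrier X"
    have b: "bilinear K Ho Ho W (\<lambda>c1 c2. f (unop c1) (unop c2) u)" using tri u by blast
    have mem: "comult H (unop c) \<in> carrier (tensor_space K H H)" using c by (intro coaction_rules)
    show "tlift K Ho Ho W (\<lambda>c1 c2. f (unop c1) (unop c2) u) (comult Ho c)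
      = sweedler W (\<lambda>h1 h2. f h1 h2 u) (unop c)"
      unfolding opposite_hopf_comult
        tlift_tmap[OF algebra_module algebra_module Ho_module Ho_module Op Op W b mem]
      by simp
  qed
  finally show ?thesis .
qed

end

section \<open>The Heisenberg condition\<close>

context coacted_algebra
begin

abbreviation AT :: "('k, (('a \<times> ('a \<Rightarrow> 'k) \<Rightarrow> 'k) set \<times> 'x opp \<Rightarrow> 'k) set) module" where
  "AT \<equiv> tensor_space K HT Xo"
abbreviation HX :: "('k, ('a \<times> 'x \<Rightarrow> 'k) set) module" where "HX \<equiv> tensor_space K H X"
abbreviation Heis_Xo :: "('k, (('a \<times> ('a \<Rightarrow> 'k) \<Rightarrow> 'k) set \<times> 'x opp \<Rightarrow> 'k) set) module" where
  "Heis_Xo \<equiv> tensor K Heis Xo"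

text \<open>The product \<open>(1 # \<theta>)(h # 1)\<close>, see \<open>heisenberg_right_left\<close>.\<close>

abbreviation cross :: "'a \<Rightarrow> ('a \<Rightarrow> 'k) \<Rightarrow> ('a \<times> ('a \<Rightarrow> 'k) \<Rightarrow> 'k) set" where
  "cross h \<theta> \<equiv> sweedler HT (\<lambda>h1 h2. tlift K Hd Hd HT (\<lambda>\<theta>1 \<theta>2.
      pairing h2 \<theta>1 \<odot>\<^bsub>HT\<^esub> tens K H Hd h1 \<theta>2) (comult Hd \<theta>)) h"

text \<open>The two sides of the Heisenberg condition after multiplying out. Products in \<open>X\<close> appear in
  reversed order because the second leg lies in the opposite algebra.\<close>

abbreviation left_right_product :: "'x \<Rightarrow> 'x \<Rightarrow> (('a \<times> ('a \<Rightarrow> 'k) \<Rightarrow> 'k) set \<times> 'x opp \<Rightarrow> 'k) set" where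
  "left_right_product x y \<equiv> asum AT (\<lambda>h z. bsum AT (\<lambda>\<theta> w.
     tens K HT Xo (tens K H Hd h (antipode Hd \<theta>)) (Op (w \<otimes>\<^bsub>X\<^esub> z))) y) x"

abbreviation right_left_product :: "'x \<Rightarrow> 'x \<Rightarrow> (('a \<times> ('a \<Rightarrow> 'k) \<Rightarrow> 'k) set \<times> 'x opp \<Rightarrow> 'k) set" where
  "right_left_product x y \<equiv> asum AT (\<lambda>h z. bsum AT (\<lambda>\<theta> w.
     tens K HT Xo (cross h (antipode Hd \<theta>)) (Op (z \<otimes>\<^bsub>X\<^esub> w))) y) x"

lemma AT_module: "module K AT"
  by (rule tensor_space_module[OF HT_module Xo_module])

lemma HX_module: "module K HX"
  by (rule tensor_space_module[OF algebra_module X.algebra_module])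

lemma Heis_Xo_mult_bilinear: "bilinear K AT AT AT (mult Heis_Xo)"
  using tensor_mult_bilinear[OF heisenberg_module Xo_module _ X.opposite_mult_bilinear]
    heisenberg_mult_bilinear by simp

lemma Heis_Xo_mult_tens:
  assumes "s \<in> carrier HT" "x \<in> carrier X" "s' \<in> carrier HT" "x' \<in> carrier X"
  shows "tens K HT Xo s (Op x) \<otimes>\<^bsub>Heis_Xo\<^esub> tens K HT Xo s' (Op x')
    = tens K HT Xo (s \<otimes>\<^bsub>Heis\<^esub> s') (Op (x' \<otimes>\<^bsub>X\<^esub> x))"
  using tensor_mult_tens[OF heisenberg_module Xo_module _ X.opposite_mult_bilinear, of s "Op x" s' "Op x'"]
    heisenberg_mult_bilinear assms by simp

text \<open>The elements \<open>(id \<otimes> \<^sup>o\<^sup>p)\<alpha>(x)\<close> and \<open>(S \<otimes> \<^sup>o\<^sup>p)\<beta>(y)\<close> that enter the Heisenberg condition, \<open>S\<close> being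
  the antipode of the dual.\<close>

definition a_leg :: "'x \<Rightarrow> ('a \<times> 'x opp \<Rightarrow> 'k) set" where
  "a_leg x = tmap K H X H Xo id Op (alpha_dot K H X \<alpha> x)"

definition b_leg :: "'x \<Rightarrow> (('a \<Rightarrow> 'k) \<times> 'x opp \<Rightarrow> 'k) set" where
  "b_leg y = tmap K Hd X Hd Xo (antipode Hd) Op (\<beta> y)"

lemma Op_hom: "Op \<in> module_hom K X Xo"
  by (rule hom_Op[OF hom_id])

lemma unop_hom: "unop \<in> module_hom K Ho H"
  by (rule hom_unop_hopf[OF hom_id])

lemma a_leg_closed: "x \<in> carrier X \<Longrightarrow> a_leg x \<in> carrier (tensor_space K H Xo)"
  unfolding a_leg_def alpha_dot_def
  by (rule hom_closed[OF tmap_hom[OF algebra_module X.algebra_module algebra_module Xo_module id_module_hom Op_hom]],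
      rule hom_closed[OF tmap_hom[OF Ho_module X.algebra_module algebra_module X.algebra_module unop_hom id_module_hom]],
      rule hom_closed[OF \<alpha>_hom])

lemma b_leg_closed: "y \<in> carrier X \<Longrightarrow> b_leg y \<in> carrier (tensor_space K Hd Xo)"
  unfolding b_leg_def
  by (rule hom_closed[OF tmap_hom[OF dual_module X.algebra_module dual_module Xo_module dual_antipode_hom Op_hom]],
      rule hom_closed[OF \<beta>_hom])

lemma iota1_hom: "iota1 K H X \<in> module_hom K (tensor_space K H Xo) AT"
proof -
  have "(\<lambda>h. tens K H Hd h \<one>\<^bsub>Hd\<^esub>) \<in> module_hom K H Heis"
    unfolding heisenberg_norm by (intro act_rules)
  from tmap_hom[OF algebra_module Xo_module heisenberg_module Xo_module this id_module_hom]
  show ?thesis by (simp add: iota1_def)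
qed

lemma iota2_hom: "iota2 K H X \<in> module_hom K (tensor_space K Hd Xo) AT"
proof -
  have "(\<lambda>\<theta>. tens K H Hd \<one>\<^bsub>H\<^esub> \<theta>) \<in> module_hom K Hd Heis"
    unfolding heisenberg_norm by (intro act_rules)
  from tmap_hom[OF dual_module Xo_module heisenberg_module Xo_module this id_module_hom]
  show ?thesis by (simp add: iota2_def)
qed

lemma iota1_a_leg:
  assumes x: "x \<in> carrier X"
  shows "iota1 K H X (a_leg x) = asum AT (\<lambda>h z. tens K HT Xo (tens K H Hd h \<one>\<^bsub>Hd\<^esub>) (Op z)) x"
proof -
  have b1: "bilinear K H Xo AT (\<lambda>h z. tens K HT Xo (tens K H Hd h \<one>\<^bsub>Hd\<^esub>) (id z))"
    unfolding id_def by (intro conjI ballI act_rules)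
  have b2: "bilinear K H X AT (\<lambda>h z. tens K HT Xo (tens K H Hd (id h) \<one>\<^bsub>Hd\<^esub>) (id (Op z)))"
    unfolding id_def by (intro conjI ballI act_rules)
  note c = hom_closed[OF \<alpha>_hom x]
  note c' = hom_closed[OF tmap_hom[OF Ho_module X.algebra_module algebra_module X.algebra_module unop_hom id_module_hom] c]
  have "iota1 K H X (a_leg x) = tlift K H Xo AT (\<lambda>h z. tens K HT Xo (tens K H Hd h \<one>\<^bsub>Hd\<^esub>) (id z)) (a_leg x)"
    by (simp add: iota1_def tmap_as_tlift)
  also have "\<dots> = asum AT (\<lambda>h z. tens K HT Xo (tens K H Hd h \<one>\<^bsub>Hd\<^esub>) (Op z)) x"
    unfolding a_leg_def alpha_dot_def
      tlift_tmap[OF algebra_module X.algebra_module algebra_module Xo_module id_module_hom Op_hom AT_module b1 c']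
      tlift_tmap[OF Ho_module X.algebra_module algebra_module X.algebra_module unop_hom id_module_hom AT_module b2 c]
    by simp
  finally show ?thesis .
qed

lemma iota2_b_leg:
  assumes y: "y \<in> carrier X"
  shows "iota2 K H X (b_leg y) = bsum AT (\<lambda>\<theta> w. tens K HT Xo (tens K H Hd \<one>\<^bsub>H\<^esub> (antipode Hd \<theta>)) (Op w)) y"
proof -
  have b1: "bilinear K Hd Xo AT (\<lambda>\<theta> w. tens K HT Xo (tens K H Hd \<one>\<^bsub>H\<^esub> \<theta>) (id w))"
    unfolding id_def by (intro conjI ballI act_rules)
  note c = hom_closed[OF \<beta>_hom y]
  have "iota2 K H X (b_leg y) = tlift K Hd Xo AT (\<lambda>\<theta> w. tens K HT Xo (tens K H Hd \<one>\<^bsub>H\<^esub> \<theta>) (id w)) (b_leg y)"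
    by (simp add: iota2_def tmap_as_tlift)
  also have "\<dots> = bsum AT (\<lambda>\<theta> w. tens K HT Xo (tens K H Hd \<one>\<^bsub>H\<^esub> (antipode Hd \<theta>)) (Op w)) y"
    unfolding b_leg_def
      tlift_tmap[OF dual_module X.algebra_module dual_module Xo_module dual_antipode_hom Op_hom AT_module b1 c]
    by simp
  finally show ?thesis .
qed

lemma iota1_mult_iota2:
  assumes x: "x \<in> carrier X" and y: "y \<in> carrier X"
  shows "iota1 K H X (a_leg x) \<otimes>\<^bsub>Heis_Xo\<^esub> iota2 K H X (b_leg y)
    = left_right_product x y"
proof -
  note rules = act_rules x y
  have "iota1 K H X (a_leg x) \<otimes>\<^bsub>Heis_Xo\<^esub> iota2 K H X (b_leg y)
    = asum AT (\<lambda>h z. bsum AT (\<lambda>\<theta> w. tens K HT Xo (tens K H Hd h \<one>\<^bsub>Hd\<^esub>) (Op z)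
        \<otimes>\<^bsub>Heis_Xo\<^esub> tens K HT Xo (tens K H Hd \<one>\<^bsub>H\<^esub> (antipode Hd \<theta>)) (Op w)) y) x"
    unfolding iota1_a_leg[OF x] iota2_b_leg[OF y]
    by (rule tlift_bilinear[OF Ho_module X.algebra_module dual_module X.algebra_module AT_module AT_module
          AT_module Heis_Xo_mult_bilinear]; intro conjI ballI rules)
  also have "\<dots> = left_right_product x y"
  proof (intro tlift_cong)
    fix c z \<theta> w
    assume m: "c \<in> carrier Ho" "z \<in> carrier X" "\<theta> \<in> carrier Hd" "w \<in> carrier X"
    have u: "unop c \<in> carrier H" "antipode Hd \<theta> \<in> carrier Hd"
      using m by (auto intro: dual_antipode_closed simp del: dual_hopf_simps)
    have t: "tens K H Hd (unop c) \<one>\<^bsub>Hd\<^esub> \<in> carrier HT"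
      and t': "tens K H Hd \<one>\<^bsub>H\<^esub> (antipode Hd \<theta>) \<in> carrier HT"
      by (rule tens_closed[OF algebra_module dual_module]; intro rules u)+
    show "tens K HT Xo (tens K H Hd (unop c) \<one>\<^bsub>Hd\<^esub>) (Op z)
        \<otimes>\<^bsub>Heis_Xo\<^esub> tens K HT Xo (tens K H Hd \<one>\<^bsub>H\<^esub> (antipode Hd \<theta>)) (Op w)
      = tens K HT Xo (tens K H Hd (unop c) (antipode Hd \<theta>)) (Op (w \<otimes>\<^bsub>X\<^esub> z))"
      unfolding Heis_Xo_mult_tens[OF t m(2) t' m(4)] heisenberg_left_right[OF u] ..
  qed
  finally show ?thesis .
qed

lemma iota2_mult_iota1:
  assumes x: "x \<in> carrier X" and y: "y \<in> carrier X"
  shows "iota2 K H X (b_leg y) \<otimes>\<^bsub>Heis_Xo\<^esub> iota1 K H X (a_leg x)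
    = right_left_product x y"
proof -
  note rules = act_rules x y
  have "iota2 K H X (b_leg y) \<otimes>\<^bsub>Heis_Xo\<^esub> iota1 K H X (a_leg x)
    = bsum AT (\<lambda>\<theta> w. asum AT (\<lambda>h z. tens K HT Xo (tens K H Hd \<one>\<^bsub>H\<^esub> (antipode Hd \<theta>)) (Op w)
        \<otimes>\<^bsub>Heis_Xo\<^esub> tens K HT Xo (tens K H Hd h \<one>\<^bsub>Hd\<^esub>) (Op z)) x) y"
    unfolding iota1_a_leg[OF x] iota2_b_leg[OF y]
    by (rule tlift_bilinear[OF dual_module X.algebra_module Ho_module X.algebra_module AT_module AT_module
          AT_module Heis_Xo_mult_bilinear]; intro conjI ballI rules)
  also have "\<dots> = bsum AT (\<lambda>\<theta> w. asum AT (\<lambda>h z. tens K HT Xo (cross h (antipode Hd \<theta>)) (Op (z \<otimes>\<^bsub>X\<^esub> w))) x) y"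
  proof (intro tlift_cong)
    fix \<theta> w c z
    assume m: "\<theta> \<in> carrier Hd" "w \<in> carrier X" "c \<in> carrier Ho" "z \<in> carrier X"
    have u: "unop c \<in> carrier H" "antipode Hd \<theta> \<in> carrier Hd"
      using m by (auto intro: dual_antipode_closed simp del: dual_hopf_simps)
    have t: "tens K H Hd (unop c) \<one>\<^bsub>Hd\<^esub> \<in> carrier HT"
      and t': "tens K H Hd \<one>\<^bsub>H\<^esub> (antipode Hd \<theta>) \<in> carrier HT"
      by (rule tens_closed[OF algebra_module dual_module]; intro rules u)+
    show "tens K HT Xo (tens K H Hd \<one>\<^bsub>H\<^esub> (antipode Hd \<theta>)) (Op w)
        \<otimes>\<^bsub>Heis_Xo\<^esub> tens K HT Xo (tens K H Hd (unop c) \<one>\<^bsub>Hd\<^esub>) (Op z)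
      = tens K HT Xo (cross (unop c) (antipode Hd \<theta>)) (Op (z \<otimes>\<^bsub>X\<^esub> w))"
      unfolding Heis_Xo_mult_tens[OF t' m(2) t m(4)] heisenberg_right_left[OF u] ..
  qed
  also have "\<dots> = right_left_product x y"
    by (rule tlift_fubini[OF dual_module X.algebra_module Ho_module X.algebra_module AT_module];
        intro conjI ballI rules)
  finally show ?thesis .
qed

lemma braided_commutative_iff:
  "braided_commutative K H X \<alpha> \<beta> \<longleftrightarrow> (\<forall>x \<in> carrier X. \<forall>y \<in> carrier X.
    left_right_product x y
    = right_left_product x y)"
proof -
  have E1: "module K (tensor K H Xo)" and E2: "module K (tensor K Hd Xo)" and A: "module K Heis_Xo"
    by (intro tensor_module algebra_module Xo_module dual_module heisenberg_module)+
  have mA: "bilinear K Heis_Xo Heis_Xo Heis_Xo (mult Heis_Xo)"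
    using Heis_Xo_mult_bilinear by simp
  have i1: "iota1 K H X \<in> module_hom K (tensor K H Xo) Heis_Xo"
    and i2: "iota2 K H X \<in> module_hom K (tensor K Hd Xo) Heis_Xo"
    using iota1_hom iota2_hom by simp_all
  have c: "a_leg x \<in> carrier (tensor K H Xo)" "b_leg x \<in> carrier (tensor K Hd Xo)"
    if "x \<in> carrier X" for x
    using a_leg_closed[OF that] b_leg_closed[OF that] by simp_all
  show ?thesis
    unfolding braided_commutative_def Let_def a_leg_def[symmetric] b_leg_def[symmetric]
    by (intro ball_cong refl)
      (simp only: mult_map_tmap[OF E1 E2 A mA i1 i2 c(1) c(2)] mult_map_tmap[OF E2 E1 A mA i2 i1 c(2) c(1)]
        iota1_mult_iota2 iota2_mult_iota1)
qed


section \<open>Evaluating the dual leg\<close>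

text \<open>The map \<open>(h # \<theta>) \<otimes> x\<^sup>o\<^sup>p \<mapsto> h \<otimes> \<theta>(g) x\<close>.\<close>

definition dual_eval :: "'a \<Rightarrow> (('a \<times> ('a \<Rightarrow> 'k) \<Rightarrow> 'k) set \<times> 'x opp \<Rightarrow> 'k) set \<Rightarrow> ('a \<times> 'x \<Rightarrow> 'k) set" where
  "dual_eval g = tlift K HT Xo HX (\<lambda>s x.
     tlift K H Hd HX (\<lambda>h \<theta>. tens K H X h (pairing g \<theta> \<odot>\<^bsub>X\<^esub> unop x)) s)"

lemma dual_eval_bilinear:
  "g \<in> carrier H \<Longrightarrow> bilinear K HT Xo HX (\<lambda>s x.
     tlift K H Hd HX (\<lambda>h \<theta>. tens K H X h (pairing g \<theta> \<odot>\<^bsub>X\<^esub> unop x)) s)"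
  by (intro conjI ballI act_rules)

lemma dual_eval_hom: "g \<in> carrier H \<Longrightarrow> dual_eval g \<in> module_hom K AT HX"
  unfolding dual_eval_def by (rule tlift_hom[OF HT_module Xo_module HX_module dual_eval_bilinear])

lemma dual_eval_tens:
  assumes "g \<in> carrier H" and "s \<in> carrier HT" and "x \<in> carrier X"
  shows "dual_eval g (tens K HT Xo s (Op x))
    = tlift K H Hd HX (\<lambda>h \<theta>. tens K H X h (pairing g \<theta> \<odot>\<^bsub>X\<^esub> x)) s"
proof -
  have Op: "Op x \<in> carrier Xo" using assms(3) by simp
  show ?thesis
    unfolding dual_eval_def
      tlift_tens[OF HT_module Xo_module HX_module dual_eval_bilinear[OF assms(1)] assms(2) Op]
    by simp
qed

lemma dual_eval_tens_tens:
  assumes g: "g \<in> carrier H" and h: "h \<in> carrier H" and \<theta>: "\<theta> \<in> carrier Hd" and x: "x \<in> carrier X"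
  shows "dual_eval g (tens K HT Xo (tens K H Hd h \<theta>) (Op x)) = tens K H X h (pairing g \<theta> \<odot>\<^bsub>X\<^esub> x)"
proof -
  have t: "tens K H Hd h \<theta> \<in> carrier HT" by (intro act_rules h \<theta>)
  have b: "bilinear K H Hd HX (\<lambda>h \<theta>. tens K H X h (pairing g \<theta> \<odot>\<^bsub>X\<^esub> x))"
    by (intro conjI ballI act_rules g x)
  show ?thesis
    unfolding dual_eval_tens[OF g t x] by (rule tlift_tens[OF algebra_module dual_module HX_module b h \<theta>])
qed

text \<open>As for tensors over the dual: with dual bases, inserting \<open>\<phi>\<^sub>b\<close> into the middle leg of the
  evaluation at \<open>b\<close> and summing over \<open>b\<close> gives back the element.\<close>

lemma dual_eval_separates:
  assumes u: "u \<in> carrier AT" and u': "u' \<in> carrier AT"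
    and eq: "\<And>g. g \<in> carrier H \<Longrightarrow> dual_eval g u = dual_eval g u'"
  shows "u = u'"
proof -
  obtain B \<phi> where B: "finite B" "B \<subseteq> carrier H" and \<phi>: "\<And>b. b \<in> B \<Longrightarrow> \<phi> b \<in> carrier Hd"
    and ex: "\<And>\<theta>. \<theta> \<in> carrier Hd \<Longrightarrow> \<theta> = (\<Oplus>\<^bsub>Hd\<^esub>b \<in> B. pairing b \<theta> \<odot>\<^bsub>Hd\<^esub> \<phi> b)"
    by (rule dual_basis_expansion) (rule that)
  have bH: "b \<in> carrier H" if "b \<in> B" for b using that B by auto
  interpret AT: module K AT by (rule AT_module)
  interpret D: module K Hd by (rule dual_module)
  \<comment> \<open>\<open>J b\<close> inserts \<open>\<phi> b\<close> as the functional leg.\<close>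
  define J where "J b = tlift K H X AT (\<lambda>h x. tens K HT Xo (tens K H Hd h (\<phi> b)) (Op x))" for b
  have Jb: "bilinear K H X AT (\<lambda>h x. tens K HT Xo (tens K H Hd h (\<phi> b)) (Op x))" if "b \<in> B" for b
    by (intro conjI ballI act_rules \<phi> that)
  have J: "J b \<in> module_hom K HX AT" if "b \<in> B" for b
    unfolding J_def by (rule tlift_hom[OF algebra_module X.algebra_module AT_module Jb[OF that]])
  have JE: "(\<lambda>v. J b (dual_eval b v)) \<in> module_hom K AT AT" if "b \<in> B" for b
    by (rule hom_comp[OF J[OF that] dual_eval_hom[OF bH[OF that]]])
  have sum: "(\<lambda>v. \<Oplus>\<^bsub>AT\<^esub>b \<in> B. J b (dual_eval b v)) \<in> module_hom K AT AT"
    by (rule hom_finsum[OF AT_module AT_module B(1) JE])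
  have pure: "tens K HT Xo (tens K H Hd h \<theta>) (Op x)
      = (\<Oplus>\<^bsub>AT\<^esub>b \<in> B. J b (dual_eval b (tens K HT Xo (tens K H Hd h \<theta>) (Op x))))"
    if h: "h \<in> carrier H" and \<theta>: "\<theta> \<in> carrier Hd" and x: "x \<in> carrier X" for h \<theta> x
  proof -
    have hom: "(\<lambda>\<theta>. tens K HT Xo (tens K H Hd h \<theta>) (Op x)) \<in> module_hom K Hd AT"
      by (intro act_rules h x)
    have "tens K HT Xo (tens K H Hd h \<theta>) (Op x)
      = tens K HT Xo (tens K H Hd h (\<Oplus>\<^bsub>Hd\<^esub>b \<in> B. pairing b \<theta> \<odot>\<^bsub>Hd\<^esub> \<phi> b)) (Op x)"
      by (rule arg_cong[where f = "\<lambda>\<theta>. tens K HT Xo (tens K H Hd h \<theta>) (Op x)", OF ex[OF \<theta>]])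
    also have "\<dots> = (\<Oplus>\<^bsub>AT\<^esub>b \<in> B. tens K HT Xo (tens K H Hd h (pairing b \<theta> \<odot>\<^bsub>Hd\<^esub> \<phi> b)) (Op x))"
      by (rule hom_finsum_apply[OF dual_module AT_module hom B(1)])
        (use \<phi> bH \<theta> pairing_closed in auto)
    also have "\<dots> = (\<Oplus>\<^bsub>AT\<^esub>b \<in> B. J b (dual_eval b (tens K HT Xo (tens K H Hd h \<theta>) (Op x))))"
    proof (rule AT.finsum_cong'[OF refl])
      show "(\<lambda>b. J b (dual_eval b (tens K HT Xo (tens K H Hd h \<theta>) (Op x)))) \<in> B \<rightarrow> carrier AT"
        by (rule Pi_I, rule hom_closed[OF JE], assumption) (intro act_rules h \<theta> x)
      fix b assume b: "b \<in> B"
      have p: "pairing b \<theta> \<in> carrier K" by (rule pairing_closed[OF bH[OF b] \<theta>])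
      have px: "pairing b \<theta> \<odot>\<^bsub>X\<^esub> x \<in> carrier X" by (rule X.smult_closed[OF p x])
      have "J b (dual_eval b (tens K HT Xo (tens K H Hd h \<theta>) (Op x)))
        = tens K HT Xo (tens K H Hd h (\<phi> b)) (Op (pairing b \<theta> \<odot>\<^bsub>X\<^esub> x))"
        unfolding dual_eval_tens_tens[OF bH[OF b] h \<theta> x] J_def
        by (rule tlift_tens[OF algebra_module X.algebra_module AT_module Jb[OF b] h px])
      also have "\<dots> = pairing b \<theta> \<odot>\<^bsub>AT\<^esub> tens K HT Xo (tens K H Hd h (\<phi> b)) (Op x)"
        by (rule module_hom_smult[where f = "\<lambda>x. tens K HT Xo (tens K H Hd h (\<phi> b)) (Op x)" and M = X
              and R = K, OF _ p x]) (intro act_rules h \<phi> b)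
      also have "\<dots> = tens K HT Xo (tens K H Hd h (pairing b \<theta> \<odot>\<^bsub>Hd\<^esub> \<phi> b)) (Op x)"
        by (rule module_hom_smult[OF hom p \<phi>[OF b], symmetric])
      finally show "tens K HT Xo (tens K H Hd h (pairing b \<theta> \<odot>\<^bsub>Hd\<^esub> \<phi> b)) (Op x)
        = J b (dual_eval b (tens K HT Xo (tens K H Hd h \<theta>) (Op x)))" by simp
    qed
    finally show ?thesis .
  qed
  have rec: "v = (\<Oplus>\<^bsub>AT\<^esub>b \<in> B. J b (dual_eval b v))" if v: "v \<in> carrier AT" for v
  proof (rule tensor_hom_ext[OF HT_module Xo_module hom_id sum _ v])
    fix s x' assume s: "s \<in> carrier HT" and "x' \<in> carrier Xo"
    then obtain x where x: "x' = Op x" "x \<in> carrier X" by auto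
    have left: "(\<lambda>s. tens K HT Xo s (Op x)) \<in> module_hom K HT AT"
      by (intro act_rules x)
    show "tens K HT Xo s x' = (\<Oplus>\<^bsub>AT\<^esub>b \<in> B. J b (dual_eval b (tens K HT Xo s x')))"
      unfolding x(1)
      by (rule tensor_hom_ext[OF algebra_module dual_module left hom_comp[OF sum left] pure[OF _ _ x(2)] s])
  qed
  have "(\<Oplus>\<^bsub>AT\<^esub>b \<in> B. J b (dual_eval b u)) = (\<Oplus>\<^bsub>AT\<^esub>b \<in> B. J b (dual_eval b u'))"
  proof (rule AT.finsum_cong'[OF refl])
    show "(\<lambda>b. J b (dual_eval b u')) \<in> B \<rightarrow> carrier AT"
      by (rule Pi_I, rule hom_closed[OF JE _ ], assumption, rule u')
  qed (simp add: eq bH)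
  then show ?thesis by (rule trans[OF rec[OF u] trans[OF _ rec[OF u', symmetric]]])
qed

abbreviation left_right_value :: "'x \<Rightarrow> 'x \<Rightarrow> 'a \<Rightarrow> ('a \<times> 'x \<Rightarrow> 'k) set" where
  "left_right_value x y g \<equiv> asum HX (\<lambda>h z. tens K H X h (act y (antipode H g) \<otimes>\<^bsub>X\<^esub> z)) x"

abbreviation right_left_value :: "'x \<Rightarrow> 'x \<Rightarrow> 'a \<Rightarrow> ('a \<times> 'x \<Rightarrow> 'k) set" where
  "right_left_value x y g \<equiv> asum HX (\<lambda>h z. sweedler HX (\<lambda>h1 h2.
     tens K H X h1 (z \<otimes>\<^bsub>X\<^esub> act y (antipode H (h2 \<otimes>\<^bsub>H\<^esub> g)))) h) x"

lemma dual_eval_left_right: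
  assumes x: "x \<in> carrier X" and y: "y \<in> carrier X" and g: "g \<in> carrier H"
  shows "dual_eval g (left_right_product x y)
    = left_right_value x y g"
proof -
  note rules = act_rules x y g
  have "dual_eval g (left_right_product x y)
    = asum HX (\<lambda>h z. dual_eval g (bsum AT (\<lambda>\<theta> w.
      tens K HT Xo (tens K H Hd h (antipode Hd \<theta>)) (Op (w \<otimes>\<^bsub>X\<^esub> z))) y)) x"
    by (rule tlift_apply[OF Ho_module X.algebra_module AT_module HX_module _ dual_eval_hom[OF g]];
        intro conjI ballI rules)
  also have "\<dots> = left_right_value x y g"
  proof (intro tlift_cong)
    fix c z assume "c \<in> carrier Ho" and z: "z \<in> carrier X"
    then have h: "unop c \<in> carrier H" by auto
    let ?h = "unop c"
    have "dual_eval g (bsum AT (\<lambda>\<theta> w. tens K HT Xo (tens K H Hd ?h (antipode Hd \<theta>)) (Op (w \<otimes>\<^bsub>X\<^esub> z))) y)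
      = bsum HX (\<lambda>\<theta> w. dual_eval g (tens K HT Xo (tens K H Hd ?h (antipode Hd \<theta>)) (Op (w \<otimes>\<^bsub>X\<^esub> z)))) y"
      by (rule tlift_apply[OF dual_module X.algebra_module AT_module HX_module _ dual_eval_hom[OF g]];
          intro conjI ballI rules h z)
    also have "\<dots> = bsum HX (\<lambda>\<theta> w. tens K H X ?h ((pairing (antipode H g) \<theta> \<odot>\<^bsub>X\<^esub> w) \<otimes>\<^bsub>X\<^esub> z)) y"
    proof (intro tlift_cong)
      fix \<theta> w assume \<theta>: "\<theta> \<in> carrier Hd" and w: "w \<in> carrier X"
      have wz: "w \<otimes>\<^bsub>X\<^esub> z \<in> carrier X" by (rule X.A.m_closed[OF w z])
      have p: "pairing (antipode H g) \<theta> \<in> carrier K" by (rule pairing_closed[OF antipode_closed[OF g] \<theta>])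
      show "dual_eval g (tens K HT Xo (tens K H Hd ?h (antipode Hd \<theta>)) (Op (w \<otimes>\<^bsub>X\<^esub> z)))
        = tens K H X ?h ((pairing (antipode H g) \<theta> \<odot>\<^bsub>X\<^esub> w) \<otimes>\<^bsub>X\<^esub> z)"
        unfolding dual_eval_tens_tens[OF g h dual_antipode_closed[OF \<theta>] wz] pairing_dual_antipode[OF g]
          X.smult_mult_left[OF p w z] ..
    qed
    also have "\<dots> = tens K H X ?h (act y (antipode H g) \<otimes>\<^bsub>X\<^esub> z)"
      unfolding dual_act_def
      by (rule tlift_apply[symmetric, OF dual_module X.algebra_module X.algebra_module HX_module,
            where g = "\<lambda>u. tens K H X ?h (u \<otimes>\<^bsub>X\<^esub> z)"]; intro conjI ballI rules h z)
    finally show "dual_eval g (bsum AT (\<lambda>\<theta> w. tens K HT Xo (tens K H Hd ?h (antipode Hd \<theta>)) (Op (w \<otimes>\<^bsub>X\<^esub> z))) y)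
      = tens K H X ?h (act y (antipode H g) \<otimes>\<^bsub>X\<^esub> z)" .
  qed
  finally show ?thesis .
qed

text \<open>The functional is paired with \<open>h\<^sub>2\<close> in one leg and with \<open>g\<close> in the other, hence with
  the product \<open>h\<^sub>2 g\<close> altogether.\<close>

lemma dual_eval_cross:
  assumes g: "g \<in> carrier H" and h: "h \<in> carrier H" and \<theta>: "\<theta> \<in> carrier Hd" and v: "v \<in> carrier X"
  shows "dual_eval g (tens K HT Xo (cross h \<theta>) (Op v))
    = sweedler HX (\<lambda>h1 h2. tens K H X h1 (pairing (h2 \<otimes>\<^bsub>H\<^esub> g) \<theta> \<odot>\<^bsub>X\<^esub> v)) h"
proof -
  note rules = act_rules g h \<theta> v
  let ?e = "\<lambda>s. dual_eval g (tens K HT Xo s (Op v))"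
  have e_hom: "?e \<in> module_hom K HT HX"
    by (rule hom_comp[OF dual_eval_hom[OF g]]) (intro rules)
  have "?e (cross h \<theta>) = sweedler HX (\<lambda>h1 h2. ?e (tlift K Hd Hd HT (\<lambda>\<theta>1 \<theta>2.
      pairing h2 \<theta>1 \<odot>\<^bsub>HT\<^esub> tens K H Hd h1 \<theta>2) (comult Hd \<theta>))) h"
    by (rule sweedler_apply[OF HT_module HX_module _ e_hom h]; intro conjI ballI rules)
  also have "\<dots> = sweedler HX (\<lambda>h1 h2. tens K H X h1 (pairing (h2 \<otimes>\<^bsub>H\<^esub> g) \<theta> \<odot>\<^bsub>X\<^esub> v)) h"
  proof (intro tlift_cong)
    fix h1 h2 assume h1: "h1 \<in> carrier H" and h2: "h2 \<in> carrier H"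
    have hom: "(\<lambda>c. tens K H X h1 (c \<odot>\<^bsub>X\<^esub> v)) \<in> module_hom K KK HX"
      by (intro rules h1)
    have "?e (tlift K Hd Hd HT (\<lambda>\<theta>1 \<theta>2. pairing h2 \<theta>1 \<odot>\<^bsub>HT\<^esub> tens K H Hd h1 \<theta>2) (comult Hd \<theta>))
      = tlift K Hd Hd HX (\<lambda>\<theta>1 \<theta>2. ?e (pairing h2 \<theta>1 \<odot>\<^bsub>HT\<^esub> tens K H Hd h1 \<theta>2)) (comult Hd \<theta>)"
      by (rule tlift_apply[OF dual_module dual_module HT_module HX_module _ e_hom];
          intro conjI ballI rules h1 h2)
    also have "\<dots> = tlift K Hd Hd HX (\<lambda>\<theta>1 \<theta>2. tens K H X h1 ((pairing h2 \<theta>1 \<otimes>\<^bsub>K\<^esub> pairing g \<theta>2) \<odot>\<^bsub>X\<^esub> v))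
        (comult Hd \<theta>)"
    proof (intro tlift_cong)
      fix \<theta>1 \<theta>2 assume t: "\<theta>1 \<in> carrier Hd" "\<theta>2 \<in> carrier Hd"
      have p: "pairing h2 \<theta>1 \<in> carrier K" "pairing g \<theta>2 \<in> carrier K"
        by (rule pairing_closed[OF h2 t(1)], rule pairing_closed[OF g t(2)])
      have m: "tens K H Hd h1 \<theta>2 \<in> carrier HT" by (rule tens_closed[OF algebra_module dual_module h1 t(2)])
      have "?e (pairing h2 \<theta>1 \<odot>\<^bsub>HT\<^esub> tens K H Hd h1 \<theta>2)
        = pairing h2 \<theta>1 \<odot>\<^bsub>HX\<^esub> tens K H X h1 (pairing g \<theta>2 \<odot>\<^bsub>X\<^esub> v)"
        unfolding module_hom_smult[OF e_hom p(1) m] dual_eval_tens_tens[OF g h1 t(2) v] ..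
      also have "\<dots> = tens K H X h1 (pairing h2 \<theta>1 \<odot>\<^bsub>X\<^esub> (pairing g \<theta>2 \<odot>\<^bsub>X\<^esub> v))"
        by (rule bilinear_smult_right[OF tens_bilinear[OF algebra_module X.algebra_module], symmetric, OF p(1) h1])
          (rule X.smult_closed[OF p(2) v])
      also have "\<dots> = tens K H X h1 ((pairing h2 \<theta>1 \<otimes>\<^bsub>K\<^esub> pairing g \<theta>2) \<odot>\<^bsub>X\<^esub> v)"
        by (simp only: X.smult_assoc1[OF p v])
      finally show "?e (pairing h2 \<theta>1 \<odot>\<^bsub>HT\<^esub> tens K H Hd h1 \<theta>2)
        = tens K H X h1 ((pairing h2 \<theta>1 \<otimes>\<^bsub>K\<^esub> pairing g \<theta>2) \<odot>\<^bsub>X\<^esub> v)" .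
    qed
    also have "\<dots> = tens K H X h1 (tlift K Hd Hd KK (\<lambda>\<theta>1 \<theta>2. pairing h2 \<theta>1 \<otimes>\<^bsub>K\<^esub> pairing g \<theta>2)
        (comult Hd \<theta>) \<odot>\<^bsub>X\<^esub> v)"
      by (rule tlift_apply[symmetric, OF dual_module dual_module scalar_module HX_module
            pairing_pairing_bilinear[OF h2 g] hom dual_comult_closed[OF \<theta>]])
    also have "\<dots> = tens K H X h1 (pairing (h2 \<otimes>\<^bsub>H\<^esub> g) \<theta> \<odot>\<^bsub>X\<^esub> v)"
      unfolding dual_comult_eval[OF \<theta> h2 g] ..
    finally show "?e (tlift K Hd Hd HT (\<lambda>\<theta>1 \<theta>2. pairing h2 \<theta>1 \<odot>\<^bsub>HT\<^esub> tens K H Hd h1 \<theta>2) (comult Hd \<theta>))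
      = tens K H X h1 (pairing (h2 \<otimes>\<^bsub>H\<^esub> g) \<theta> \<odot>\<^bsub>X\<^esub> v)" .
  qed
  finally show ?thesis .
qed

lemma dual_eval_right_left:
  assumes x: "x \<in> carrier X" and y: "y \<in> carrier X" and g: "g \<in> carrier H"
  shows "dual_eval g (right_left_product x y)
    = right_left_value x y g"
proof -
  note rules = act_rules x y g
  have "dual_eval g (right_left_product x y)
    = asum HX (\<lambda>h z. dual_eval g (bsum AT (\<lambda>\<theta> w.
      tens K HT Xo (cross h (antipode Hd \<theta>)) (Op (z \<otimes>\<^bsub>X\<^esub> w))) y)) x"
    by (rule tlift_apply[OF Ho_module X.algebra_module AT_module HX_module _ dual_eval_hom[OF g]];
        intro conjI ballI rules)
  also have "\<dots> = right_left_value x y g"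
  proof (intro tlift_cong)
    fix c z assume "c \<in> carrier Ho" and z: "z \<in> carrier X"
    then have h: "unop c \<in> carrier H" by auto
    let ?h = "unop c"
    let ?t = "\<lambda>h1 h2 \<theta> w. tens K H X h1 (pairing (antipode H (h2 \<otimes>\<^bsub>H\<^esub> g)) \<theta> \<odot>\<^bsub>X\<^esub> (z \<otimes>\<^bsub>X\<^esub> w))"
    have "dual_eval g (bsum AT (\<lambda>\<theta> w. tens K HT Xo (cross ?h (antipode Hd \<theta>)) (Op (z \<otimes>\<^bsub>X\<^esub> w))) y)
      = bsum HX (\<lambda>\<theta> w. dual_eval g (tens K HT Xo (cross ?h (antipode Hd \<theta>)) (Op (z \<otimes>\<^bsub>X\<^esub> w)))) y"
      by (rule tlift_apply[OF dual_module X.algebra_module AT_module HX_module _ dual_eval_hom[OF g]];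
          intro conjI ballI rules h z)
    also have "\<dots> = bsum HX (\<lambda>\<theta> w. sweedler HX (\<lambda>h1 h2. ?t h1 h2 \<theta> w) ?h) y"
    proof (intro tlift_cong)
      fix \<theta> w assume \<theta>: "\<theta> \<in> carrier Hd" and w: "w \<in> carrier X"
      show "dual_eval g (tens K HT Xo (cross ?h (antipode Hd \<theta>)) (Op (z \<otimes>\<^bsub>X\<^esub> w)))
        = sweedler HX (\<lambda>h1 h2. ?t h1 h2 \<theta> w) ?h"
        unfolding dual_eval_cross[OF g h dual_antipode_closed[OF \<theta>] X.A.m_closed[OF z w]]
        by (intro tlift_cong) (simp only: pairing_dual_antipode A.m_closed g)
    qed
    also have "\<dots> = sweedler HX (\<lambda>h1 h2. bsum HX (\<lambda>\<theta> w. ?t h1 h2 \<theta> w) y) ?h"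
      by (rule tlift_fubini[OF dual_module X.algebra_module algebra_module algebra_module HX_module];
          intro conjI ballI rules h z)
    also have "\<dots> = sweedler HX (\<lambda>h1 h2. tens K H X h1 (z \<otimes>\<^bsub>X\<^esub> act y (antipode H (h2 \<otimes>\<^bsub>H\<^esub> g)))) ?h"
    proof (intro tlift_cong)
      fix h1 h2 assume h1: "h1 \<in> carrier H" and h2: "h2 \<in> carrier H"
      let ?k = "antipode H (h2 \<otimes>\<^bsub>H\<^esub> g)"
      have k: "?k \<in> carrier H" by (intro rules h2)
      have "bsum HX (\<lambda>\<theta> w. ?t h1 h2 \<theta> w) y
        = bsum HX (\<lambda>\<theta> w. tens K H X h1 (z \<otimes>\<^bsub>X\<^esub> (pairing ?k \<theta> \<odot>\<^bsub>X\<^esub> w))) y"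
        by (intro tlift_cong) (simp only: X.smult_mult_right pairing_closed k z)
      also have "\<dots> = tens K H X h1 (z \<otimes>\<^bsub>X\<^esub> act y ?k)"
        unfolding dual_act_def
        by (rule tlift_apply[symmetric, OF dual_module X.algebra_module X.algebra_module HX_module,
              where g = "\<lambda>u. tens K H X h1 (z \<otimes>\<^bsub>X\<^esub> u)"]; intro conjI ballI rules h1 k z)
      finally show "bsum HX (\<lambda>\<theta> w. ?t h1 h2 \<theta> w) y = tens K H X h1 (z \<otimes>\<^bsub>X\<^esub> act y ?k)" .
    qed
    finally show "dual_eval g (bsum AT (\<lambda>\<theta> w. tens K HT Xo (cross ?h (antipode Hd \<theta>)) (Op (z \<otimes>\<^bsub>X\<^esub> w))) y)
      = sweedler HX (\<lambda>h1 h2. tens K H X h1 (z \<otimes>\<^bsub>X\<^esub> act y (antipode H (h2 \<otimes>\<^bsub>H\<^esub> g)))) ?h" .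
  qed
  finally show ?thesis .
qed

lemma braided_commutative_evaluated:
  "braided_commutative K H X \<alpha> \<beta> \<longleftrightarrow> (\<forall>x \<in> carrier X. \<forall>y \<in> carrier X. \<forall>g \<in> carrier H.
    left_right_value x y g
    = right_left_value x y g)"
  unfolding braided_commutative_iff
proof (intro ball_cong refl)
  fix x y assume x: "x \<in> carrier X" and y: "y \<in> carrier X"
  let ?L = "left_right_product x y" and ?R = "right_left_product x y"
  have L: "?L \<in> carrier AT" by (intro conjI ballI act_rules x y)
  have R: "?R \<in> carrier AT" by (intro conjI ballI act_rules x y)
  have "?L = ?R \<longleftrightarrow> (\<forall>g \<in> carrier H. dual_eval g ?L = dual_eval g ?R)"
    using dual_eval_separates[OF L R] by auto
  then show "?L = ?R \<longleftrightarrow> (\<forall>g \<in> carrier H.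
      left_right_value x y g
      = right_left_value x y g)"
    by (simp only: dual_eval_left_right[OF x y] dual_eval_right_left[OF x y] cong: ball_cong)
qed

section \<open>The equivalence\<close>

text \<open>The Heisenberg condition evaluated at \<open>g = 1\<close>, with the counit applied to the leg in \<open>H\<close>.\<close>

lemma twisted_commutative_if_braided:
  assumes bc: "braided_commutative K H X \<alpha> \<beta>" and x: "x \<in> carrier X" and y: "y \<in> carrier X"
  shows "y \<otimes>\<^bsub>X\<^esub> x = asum X (\<lambda>h z. z \<otimes>\<^bsub>X\<^esub> act y (antipode H h)) x"
proof -
  note rules = act_rules x y
  let ?e = "tlift K H X X (\<lambda>h z. counit H h \<odot>\<^bsub>X\<^esub> z)"
  have eb: "bilinear K H X X (\<lambda>h z. counit H h \<odot>\<^bsub>X\<^esub> z)" by (intro conjI ballI rules)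
  have e: "?e \<in> module_hom K HX X"
    by (rule tlift_hom[OF algebra_module X.algebra_module X.algebra_module eb])
  note e_tens = tlift_tens[OF algebra_module X.algebra_module X.algebra_module eb]
  have "y \<otimes>\<^bsub>X\<^esub> x = y \<otimes>\<^bsub>X\<^esub> asum X (\<lambda>h z. counit H h \<odot>\<^bsub>X\<^esub> z) x"
    by (simp only: asum_counit[OF x])
  also have "\<dots> = asum X (\<lambda>h z. y \<otimes>\<^bsub>X\<^esub> (counit H h \<odot>\<^bsub>X\<^esub> z)) x"
    by (rule tlift_apply[OF Ho_module X.algebra_module X.algebra_module X.algebra_module,
          where g = "\<lambda>u. y \<otimes>\<^bsub>X\<^esub> u"]; intro conjI ballI rules)
  also have "\<dots> = asum X (\<lambda>h z. ?e (tens K H X h (y \<otimes>\<^bsub>X\<^esub> z))) x"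
  proof (intro tlift_cong)
    fix c z assume "c \<in> carrier Ho" and z: "z \<in> carrier X"
    then have h: "unop c \<in> carrier H" by auto
    show "y \<otimes>\<^bsub>X\<^esub> (counit H (unop c) \<odot>\<^bsub>X\<^esub> z) = ?e (tens K H X (unop c) (y \<otimes>\<^bsub>X\<^esub> z))"
      unfolding e_tens[OF h X.A.m_closed[OF y z]] X.smult_mult_right[OF counit_closed[OF h] y z] ..
  qed
  also have "\<dots> = ?e (asum HX (\<lambda>h z. tens K H X h (y \<otimes>\<^bsub>X\<^esub> z)) x)"
    by (rule tlift_apply[symmetric, OF Ho_module X.algebra_module HX_module X.algebra_module _ e];
        intro conjI ballI rules)
  \<comment> \<open>Here \<open>y = y \<lhd> S(1)\<close> brings in the Heisenberg condition at \<open>g = 1\<close>.\<close>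
  also have "asum HX (\<lambda>h z. tens K H X h (y \<otimes>\<^bsub>X\<^esub> z)) x
    = asum HX (\<lambda>h z. tens K H X h (act y (antipode H \<one>\<^bsub>H\<^esub>) \<otimes>\<^bsub>X\<^esub> z)) x"
    by (simp only: antipode_one act_one[OF y])
  also have "\<dots> = asum HX (\<lambda>h z. sweedler HX (\<lambda>h1 h2. tens K H X h1
      (z \<otimes>\<^bsub>X\<^esub> act y (antipode H (h2 \<otimes>\<^bsub>H\<^esub> \<one>\<^bsub>H\<^esub>)))) h) x"
    using bc[unfolded braided_commutative_evaluated] x y A.one_closed by blast
  also have "?e \<dots> = asum X (\<lambda>h z. ?e (sweedler HX (\<lambda>h1 h2. tens K H X h1
      (z \<otimes>\<^bsub>X\<^esub> act y (antipode H (h2 \<otimes>\<^bsub>H\<^esub> \<one>\<^bsub>H\<^esub>)))) h)) x"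
    by (rule tlift_apply[OF Ho_module X.algebra_module HX_module X.algebra_module _ e];
        intro conjI ballI rules)
  also have "\<dots> = asum X (\<lambda>h z. z \<otimes>\<^bsub>X\<^esub> act y (antipode H h)) x"
  proof (intro tlift_cong)
    fix c z assume "c \<in> carrier Ho" and z: "z \<in> carrier X"
    then have h: "unop c \<in> carrier H" by auto
    have "?e (sweedler HX (\<lambda>h1 h2. tens K H X h1 (z \<otimes>\<^bsub>X\<^esub> act y (antipode H (h2 \<otimes>\<^bsub>H\<^esub> \<one>\<^bsub>H\<^esub>)))) (unop c))
      = sweedler X (\<lambda>h1 h2. ?e (tens K H X h1 (z \<otimes>\<^bsub>X\<^esub> act y (antipode H (h2 \<otimes>\<^bsub>H\<^esub> \<one>\<^bsub>H\<^esub>))))) (unop c)"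
      by (rule sweedler_apply[OF HX_module X.algebra_module _ e h]; intro conjI ballI rules z)
    also have "\<dots> = sweedler X (\<lambda>h1 h2. counit H h1 \<odot>\<^bsub>X\<^esub> (z \<otimes>\<^bsub>X\<^esub> act y (antipode H h2))) (unop c)"
    proof (intro tlift_cong)
      fix h1 h2 assume h1: "h1 \<in> carrier H" and h2: "h2 \<in> carrier H"
      have m: "z \<otimes>\<^bsub>X\<^esub> act y (antipode H h2) \<in> carrier X" by (intro rules z h2)
      show "?e (tens K H X h1 (z \<otimes>\<^bsub>X\<^esub> act y (antipode H (h2 \<otimes>\<^bsub>H\<^esub> \<one>\<^bsub>H\<^esub>))))
        = counit H h1 \<odot>\<^bsub>X\<^esub> (z \<otimes>\<^bsub>X\<^esub> act y (antipode H h2))"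
        unfolding A.r_one[OF h2] by (rule e_tens[OF h1 m])
    qed
    also have "\<dots> = z \<otimes>\<^bsub>X\<^esub> act y (antipode H (unop c))"
      by (rule sweedler_counit_left[OF X.algebra_module _ h]; intro rules z)
    finally show "?e (sweedler HX (\<lambda>h1 h2. tens K H X h1
        (z \<otimes>\<^bsub>X\<^esub> act y (antipode H (h2 \<otimes>\<^bsub>H\<^esub> \<one>\<^bsub>H\<^esub>)))) (unop c))
      = z \<otimes>\<^bsub>X\<^esub> act y (antipode H (unop c))" .
  qed
  finally show ?thesis .
qed

text \<open>The twisted rule for the factors \<open>y \<lhd> h\<close> and \<open>z\<close> produces \<open>y \<lhd> h\<^sub>1 S(h\<^sub>2)\<close>, and the antipode
  axiom reduces this to \<open>\<epsilon>(h) y\<close>.\<close>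

lemma right_left_if_twisted:
  assumes tw: "\<And>x y. \<lbrakk>x \<in> carrier X; y \<in> carrier X\<rbrakk>
      \<Longrightarrow> y \<otimes>\<^bsub>X\<^esub> x = asum X (\<lambda>h z. z \<otimes>\<^bsub>X\<^esub> act y (antipode H h)) x"
    and x: "x \<in> carrier X" and y: "y \<in> carrier X"
  shows "asum X (\<lambda>h z. act y h \<otimes>\<^bsub>X\<^esub> z) x = x \<otimes>\<^bsub>X\<^esub> y"
proof -
  note rules = act_rules x y
  have "asum X (\<lambda>h z. act y h \<otimes>\<^bsub>X\<^esub> z) x
    = asum X (\<lambda>h z. asum X (\<lambda>k u. u \<otimes>\<^bsub>X\<^esub> act y (h \<otimes>\<^bsub>H\<^esub> antipode H k)) z) x"
  proof (intro tlift_cong)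
    fix c z assume "c \<in> carrier Ho" and z: "z \<in> carrier X"
    then have h: "unop c \<in> carrier H" by auto
    have "act y (unop c) \<otimes>\<^bsub>X\<^esub> z = asum X (\<lambda>k u. u \<otimes>\<^bsub>X\<^esub> act (act y (unop c)) (antipode H k)) z"
      by (rule tw[OF z act_closed[OF y h]])
    also have "\<dots> = asum X (\<lambda>k u. u \<otimes>\<^bsub>X\<^esub> act y (unop c \<otimes>\<^bsub>H\<^esub> antipode H k)) z"
    proof (intro tlift_cong)
      fix d u assume "d \<in> carrier Ho"
      then have d: "antipode H (unop d) \<in> carrier H" by (auto intro: antipode_closed)
      show "u \<otimes>\<^bsub>X\<^esub> act (act y (unop c)) (antipode H (unop d))
        = u \<otimes>\<^bsub>X\<^esub> act y (unop c \<otimes>\<^bsub>H\<^esub> antipode H (unop d))"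
        unfolding act_act[OF y h d] ..
    qed
    finally show "act y (unop c) \<otimes>\<^bsub>X\<^esub> z = asum X (\<lambda>k u. u \<otimes>\<^bsub>X\<^esub> act y (unop c \<otimes>\<^bsub>H\<^esub> antipode H k)) z" .
  qed
  also have "\<dots> = asum X (\<lambda>h u. sweedler X (\<lambda>h1 h2. u \<otimes>\<^bsub>X\<^esub> act y (h1 \<otimes>\<^bsub>H\<^esub> antipode H h2)) h) x"
    by (rule asum_coassoc[OF X.algebra_module _ x]) (intro conjI ballI rules)
  also have "\<dots> = asum X (\<lambda>h u. (counit H h \<odot>\<^bsub>X\<^esub> u) \<otimes>\<^bsub>X\<^esub> y) x"
  proof (intro tlift_cong)
    fix c u assume "c \<in> carrier Ho" and u: "u \<in> carrier X"
    then have h: "unop c \<in> carrier H" by auto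
    note \<epsilon> = counit_closed[OF h]
    have hom: "(\<lambda>k. u \<otimes>\<^bsub>X\<^esub> act y k) \<in> module_hom K H X" by (intro rules u)
    have "sweedler X (\<lambda>h1 h2. u \<otimes>\<^bsub>X\<^esub> act y (h1 \<otimes>\<^bsub>H\<^esub> antipode H h2)) (unop c)
      = u \<otimes>\<^bsub>X\<^esub> act y (sweedler H (\<lambda>h1 h2. h1 \<otimes>\<^bsub>H\<^esub> antipode H h2) (unop c))"
      by (rule sweedler_apply[symmetric, OF algebra_module X.algebra_module _ hom h]) (intro conjI ballI rules)
    also have "\<dots> = counit H (unop c) \<odot>\<^bsub>X\<^esub> (u \<otimes>\<^bsub>X\<^esub> act y \<one>\<^bsub>H\<^esub>)"
      unfolding sweedler_antipode_right[OF h] by (rule module_hom_smult[OF hom \<epsilon> A.one_closed])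
    also have "\<dots> = (counit H (unop c) \<odot>\<^bsub>X\<^esub> u) \<otimes>\<^bsub>X\<^esub> y"
      unfolding act_one[OF y] X.smult_mult_left[OF \<epsilon> u y] ..
    finally show "sweedler X (\<lambda>h1 h2. u \<otimes>\<^bsub>X\<^esub> act y (h1 \<otimes>\<^bsub>H\<^esub> antipode H h2)) (unop c)
      = (counit H (unop c) \<odot>\<^bsub>X\<^esub> u) \<otimes>\<^bsub>X\<^esub> y" .
  qed
  also have "\<dots> = asum X (\<lambda>h u. counit H h \<odot>\<^bsub>X\<^esub> u) x \<otimes>\<^bsub>X\<^esub> y"
    by (rule tlift_apply[symmetric, OF Ho_module X.algebra_module X.algebra_module X.algebra_module,
          where g = "\<lambda>u. u \<otimes>\<^bsub>X\<^esub> y"]; intro conjI ballI rules)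
  also have "\<dots> = x \<otimes>\<^bsub>X\<^esub> y" by (simp only: asum_counit[OF x])
  finally show ?thesis .
qed

text \<open>All that is needed is \<open>z\<^sub>[\<^sub>0\<^sub>] (y \<lhd> S(z\<^sub>[\<^sub>-\<^sub>1\<^sub>] g)) = (y \<lhd> S(g)) z\<close>: exchanging the factors by the
  right-left rule yields \<open>S(h\<^sub>1 g) h\<^sub>2\<close>, to which \<open>antipode_cancel\<close> applies. Coassociativity of \<open>\<alpha>\<close>
  carries the identity to the second leg.\<close>

lemma braided_if_right_left:
  assumes rl: "\<And>x y. \<lbrakk>x \<in> carrier X; y \<in> carrier X\<rbrakk>
      \<Longrightarrow> x \<otimes>\<^bsub>X\<^esub> y = asum X (\<lambda>h z. act y h \<otimes>\<^bsub>X\<^esub> z) x"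
  shows "braided_commutative K H X \<alpha> \<beta>"
  unfolding braided_commutative_evaluated
proof (intro ballI)
  fix x y g assume x: "x \<in> carrier X" and y: "y \<in> carrier X" and g: "g \<in> carrier H"
  note rules = act_rules x y g
  have twist: "asum X (\<lambda>k u. u \<otimes>\<^bsub>X\<^esub> act y (antipode H (k \<otimes>\<^bsub>H\<^esub> g))) z = act y (antipode H g) \<otimes>\<^bsub>X\<^esub> z"
    if z: "z \<in> carrier X" for z
  proof -
    have "asum X (\<lambda>k u. u \<otimes>\<^bsub>X\<^esub> act y (antipode H (k \<otimes>\<^bsub>H\<^esub> g))) z
      = asum X (\<lambda>k u. asum X (\<lambda>l v. act y (antipode H (k \<otimes>\<^bsub>H\<^esub> g) \<otimes>\<^bsub>H\<^esub> l) \<otimes>\<^bsub>X\<^esub> v) u) z"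
    proof (intro tlift_cong)
      fix c u assume "c \<in> carrier Ho" and u: "u \<in> carrier X"
      then have k: "antipode H (unop c \<otimes>\<^bsub>H\<^esub> g) \<in> carrier H" using g by (auto intro: antipode_closed)
      have "u \<otimes>\<^bsub>X\<^esub> act y (antipode H (unop c \<otimes>\<^bsub>H\<^esub> g))
        = asum X (\<lambda>l v. act (act y (antipode H (unop c \<otimes>\<^bsub>H\<^esub> g))) l \<otimes>\<^bsub>X\<^esub> v) u"
        by (rule rl[OF u act_closed[OF y k]])
      also have "\<dots> = asum X (\<lambda>l v. act y (antipode H (unop c \<otimes>\<^bsub>H\<^esub> g) \<otimes>\<^bsub>H\<^esub> l) \<otimes>\<^bsub>X\<^esub> v) u"
      proof (intro tlift_cong)
        fix d v assume "d \<in> carrier Ho"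
        then have d: "unop d \<in> carrier H" by auto
        show "act (act y (antipode H (unop c \<otimes>\<^bsub>H\<^esub> g))) (unop d) \<otimes>\<^bsub>X\<^esub> v
          = act y (antipode H (unop c \<otimes>\<^bsub>H\<^esub> g) \<otimes>\<^bsub>H\<^esub> unop d) \<otimes>\<^bsub>X\<^esub> v"
          unfolding act_act[OF y k d] ..
      qed
      finally show "u \<otimes>\<^bsub>X\<^esub> act y (antipode H (unop c \<otimes>\<^bsub>H\<^esub> g))
        = asum X (\<lambda>l v. act y (antipode H (unop c \<otimes>\<^bsub>H\<^esub> g) \<otimes>\<^bsub>H\<^esub> l) \<otimes>\<^bsub>X\<^esub> v) u" .
    qed
    also have "\<dots> = asum X (\<lambda>h v. sweedler X (\<lambda>k l. act y (antipode H (k \<otimes>\<^bsub>H\<^esub> g) \<otimes>\<^bsub>H\<^esub> l) \<otimes>\<^bsub>X\<^esub> v) h) z"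
      by (rule asum_coassoc[OF X.algebra_module _ z]) (intro conjI ballI rules)
    also have "\<dots> = asum X (\<lambda>h v. act y (antipode H g) \<otimes>\<^bsub>X\<^esub> (counit H h \<odot>\<^bsub>X\<^esub> v)) z"
    proof (intro tlift_cong)
      fix c v assume "c \<in> carrier Ho" and v: "v \<in> carrier X"
      then have h: "unop c \<in> carrier H" by auto
      note \<epsilon> = counit_closed[OF h]
      have Sg: "antipode H g \<in> carrier H" and yg: "act y (antipode H g) \<in> carrier X" by (intro rules)+
      have hom: "(\<lambda>k. act y k \<otimes>\<^bsub>X\<^esub> v) \<in> module_hom K H X" by (intro rules v)
      have "sweedler X (\<lambda>k l. act y (antipode H (k \<otimes>\<^bsub>H\<^esub> g) \<otimes>\<^bsub>H\<^esub> l) \<otimes>\<^bsub>X\<^esub> v) (unop c)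
        = act y (sweedler H (\<lambda>k l. antipode H (k \<otimes>\<^bsub>H\<^esub> g) \<otimes>\<^bsub>H\<^esub> l) (unop c)) \<otimes>\<^bsub>X\<^esub> v"
        by (rule sweedler_apply[symmetric, OF algebra_module X.algebra_module _ hom h]) (intro conjI ballI rules)
      also have "\<dots> = counit H (unop c) \<odot>\<^bsub>X\<^esub> (act y (antipode H g) \<otimes>\<^bsub>X\<^esub> v)"
        unfolding antipode_cancel[OF h g] by (rule module_hom_smult[OF hom \<epsilon> Sg])
      also have "\<dots> = act y (antipode H g) \<otimes>\<^bsub>X\<^esub> (counit H (unop c) \<odot>\<^bsub>X\<^esub> v)"
        by (rule X.smult_mult_right[OF \<epsilon> yg v, symmetric])
      finally show "sweedler X (\<lambda>k l. act y (antipode H (k \<otimes>\<^bsub>H\<^esub> g) \<otimes>\<^bsub>H\<^esub> l) \<otimes>\<^bsub>X\<^esub> v) (unop c)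
        = act y (antipode H g) \<otimes>\<^bsub>X\<^esub> (counit H (unop c) \<odot>\<^bsub>X\<^esub> v)" .
    qed
    also have "\<dots> = act y (antipode H g) \<otimes>\<^bsub>X\<^esub> asum X (\<lambda>h v. counit H h \<odot>\<^bsub>X\<^esub> v) z"
      by (rule tlift_apply[symmetric, OF Ho_module X.algebra_module X.algebra_module X.algebra_module,
            where g = "\<lambda>u. act y (antipode H g) \<otimes>\<^bsub>X\<^esub> u"]; intro conjI ballI rules z)
    also have "\<dots> = act y (antipode H g) \<otimes>\<^bsub>X\<^esub> z" by (simp only: asum_counit[OF z])
    finally show ?thesis .
  qed
  have "right_left_value x y g
    = asum HX (\<lambda>h z. asum HX (\<lambda>k u. tens K H X h (u \<otimes>\<^bsub>X\<^esub> act y (antipode H (k \<otimes>\<^bsub>H\<^esub> g)))) z) x"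
    by (rule asum_coassoc[OF HX_module _ x, symmetric]) (intro conjI ballI rules)
  also have "\<dots> = left_right_value x y g"
  proof (intro tlift_cong)
    fix c z assume "c \<in> carrier Ho" and z: "z \<in> carrier X"
    then have h: "unop c \<in> carrier H" by auto
    have "asum HX (\<lambda>k u. tens K H X (unop c) (u \<otimes>\<^bsub>X\<^esub> act y (antipode H (k \<otimes>\<^bsub>H\<^esub> g)))) z
      = tens K H X (unop c) (asum X (\<lambda>k u. u \<otimes>\<^bsub>X\<^esub> act y (antipode H (k \<otimes>\<^bsub>H\<^esub> g))) z)"
      by (rule tlift_apply[symmetric, OF Ho_module X.algebra_module X.algebra_module HX_module,
            where g = "\<lambda>u. tens K H X (unop c) u"]; intro conjI ballI rules h z)
    then show "asum HX (\<lambda>k u. tens K H X (unop c) (u \<otimes>\<^bsub>X\<^esub> act y (antipode H (k \<otimes>\<^bsub>H\<^esub> g)))) z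
      = tens K H X (unop c) (act y (antipode H g) \<otimes>\<^bsub>X\<^esub> z)"
      unfolding twist[OF z] .
  qed
  finally show "left_right_value x y g
    = right_left_value x y g"
    by (rule sym)
qed

lemma braided_commutative_equivalence:
  "braided_commutative K H X \<alpha> \<beta> \<longleftrightarrow> rl_braided_commutative K H X act \<alpha>"
proof
  assume "braided_commutative K H X \<alpha> \<beta>"
  note tw = twisted_commutative_if_braided[OF this]
  show "rl_braided_commutative K H X act \<alpha>"
    unfolding rl_braided_commutative_def
    by (intro ballI) (rule right_left_if_twisted[OF tw, symmetric])
next
  assume "rl_braided_commutative K H X act \<alpha>"
  then show "braided_commutative K H X \<alpha> \<beta>"
    unfolding rl_braided_commutative_def by (intro braided_if_right_left) blast
qed

end

theorem proposition4p39:
  fixes K :: "('k, 'r) ring_scheme"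
    and H :: "('k, 'a) hopf"
    and X :: "('k, 'x, 'm) module_scheme"
    and \<alpha> :: "'x \<Rightarrow> ('a opp \<times> 'x \<Rightarrow> 'k) set"
    and \<beta> :: "'x \<Rightarrow> (('a \<Rightarrow> 'k) \<times> 'x \<Rightarrow> 'k) set"
  assumes "field K"
    and "hopf_algebra K H"
    and "vectorspace.fin_dim K H"
    and "yd_algebra K H X \<alpha> \<beta>"
  shows "braided_commutative K H X \<alpha> \<beta>
     \<longleftrightarrow> rl_braided_commutative K H X (dual_act K H X \<beta>) \<alpha>"
proof -
  have X: "k_algebra K X" and \<alpha>: "left_coaction K (opposite_hopf K H) X \<alpha>"
    and \<beta>: "left_coaction K (dual_hopf K H) X \<beta>"
    using assms(4) by (simp_all add: yd_algebra_def Let_def)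
  interpret coacted_algebra K H X \<alpha> \<beta>
    by (intro coacted_algebra.intro findim_hopf_algebra.intro findim_hopf_algebra_axioms.intro
        coacted_algebra_axioms.intro assms X \<alpha> \<beta>)
  show ?thesis by (rule braided_commutative_equivalence)
qed

end
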